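(* Let $\xi$ be a non-zero complex parameter and let $i\ne j$ with $i,j\in\{1,2\}$. With $W_i(z)$, $\mathcal T_{ij}(\xi;z)$ and $f(\xi;z)$ as defined in the context, $$\xi\, f\Big(\xi;\frac wz\Big)W_i(z)W_j(w)+f\Big(\xi^{-1};\frac zw\Big)W_j(w)W_i(z)=\delta\Big(\frac{\xi w}{z}\Big)w^{-1}\,\mathcal T_{ij}(\xi;w).$$
   Context: Parameters: $q,d\in\mathbb C$ with $q^nd^m\ne1$ for all integers $(n,m)\neq(0,0)$; $q_1=q^{-1}d$, $q_2=q^2$, $q_3=q^{-1}d^{-1}$ (so $q_1q_2q_3=1$); $\beta=-\log q_3/\log q_1$, so $q_3=q_1^{-\beta}$. Formal delta function: $\delta(z)=\sum_{n\in\mathbb Z}z^n$. Heisenberg algebra: generators $h^\perp_{i,n},Q_i^\perp$ ($i=1,2$, $n\in\mathbb Z$), $\mathsf a_0^\perp,\mathsf Q^\perp$ with $[h^\perp_{i,n},h^\perp_{i,m}]=n\delta_{n+m,0}$; $[h^\perp_{i,n},h^\perp_{j,m}]=-n\frac{q_1^n+q_3^n}{1+q_2^{-n}}\delta_{n+m,0}$ for $i\ne j$; $[h^\perp_{i,0},Q_i^\perp]=1$, $[h^\perp_{i,0},Q^\perp_j]=-1$ for $i\ne j$; $[\mathsf a_0^\perp,\mathsf Q^\perp]=\beta/2$; $h^\perp_{1,0}=-h^\perp_{2,0}$, $Q_1^\perp=-Q_2^\perp$; other commutators vanish. $:\ast:$ is the normal ordering (modes with $n<0$ and $Q_i^\perp,\mathsf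 Q^\perp$ to the left; modes with $n\ge 0$ and $\mathsf a_0^\perp$ to the right). $W_i(z)=\Lambda_i^+(z)+\Lambda_i^-(z)$ with $$\Lambda_i^+(z)=:\exp\Big(-\sum_{n\ne0}\frac{q^n}{n}h^\perp_{i,n}z^{-n}\Big):e^{Q_i^\perp}(q^{-1}z)^{h^\perp_{i,0}}q_1^{\mathsf a_0^\perp},\qquad \Lambda_i^-(z)=:\exp\Big(\sum_{n\ne0}\frac{q^{-n}}{n}h^\perp_{i,n}z^{-n}\Big):e^{-Q_i^\perp}(qz)^{-h^\perp_{i,0}}q_1^{-\mathsf a_0^\perp}.$$ For $i\ne j$ and $\xi\in\mathbb C\setminus\{0\}$, $$\mathcal T_{ij}(\xi;z)=q:\Lambda_i^+(\xi z)\Lambda_j^+(z):+q^{-1}:\Lambda_i^-(\xi z)\Lambda_j^-(z):+z^2q(1-q_1\xi)(1-q_3\xi):\Lambda_i^+(\xi z)\Lambda_j^-(z):+z^2q^{-1}(1-q_1^{-1}\xi)(1-q_3^{-1}\xi):\Lambda_i^-(\xi z)\Lambda_j^+(z):.$$ Structure function: $f(\xi;z)=\exp\Big\{\sum_{n\ge1}\Big(\xi^n-\frac{q_1^n+q_3^n}{1+q_2^{-n}}\Big)\frac{z^n}{n}\Big\}$. Identities are between formal series in $z,w$; $f(\xi;w/z)$ (resp. $f(\xi^{-1};z/w)$) is a power series in $w/z$ (resp. $z/w$). *)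

theory Defs
  imports
    Complex_Main
    "HOL-Library.Groups_Big_Fun"
    "HOL-Computational_Algebra.Formal_Power_Series"
begin

section \<open>Parameters\<close>

definition generic :: "complex \<Rightarrow> complex \<Rightarrow> bool" where
  "generic q d \<longleftrightarrow> q \<noteq> 0 \<and> d \<noteq> 0 \<and>
     (\<forall>n m :: int. (n, m) \<noteq> (0, 0) \<longrightarrow> q powi n * d powi m \<noteq> 1)"

definition q1 :: "complex \<Rightarrow> complex \<Rightarrow> complex" where
  "q1 q d = inverse q * d"

definition q2 :: "complex \<Rightarrow> complex \<Rightarrow> complex" where
  "q2 q d = q ^ 2"

definition q3 :: "complex \<Rightarrow> complex \<Rightarrow> complex" where
  "q3 q d = inverse q * inverse d"


section \<open>Diagonalizable operators\<close>

text \<open>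
  \<open>s\<close> is the scalar multiplication of a complex vector space with underlying type \<open>'v\<close>.
  \<open>eigen_decomp s A v f\<close>: the vector \<open>v\<close> is the finite sum of the \<open>f \<mu>\<close>, where \<open>f \<mu>\<close> is zero
  or an eigenvector of \<open>A\<close> with eigenvalue \<open>\<mu>\<close>. Such an \<open>f\<close> is unique if it exists.
\<close>

definition eigen_decomp ::
  "(complex \<Rightarrow> 'v \<Rightarrow> 'v) \<Rightarrow> ('v \<Rightarrow> 'v) \<Rightarrow> 'v \<Rightarrow> (complex \<Rightarrow> 'v::ab_group_add) \<Rightarrow> bool" where
  "eigen_decomp s A v f \<longleftrightarrow>
     finite {\<mu>. f \<mu> \<noteq> 0} \<and> (\<forall>\<mu>. A (f \<mu>) = s \<mu> (f \<mu>)) \<and> v = Sum_any f"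

definition eigen_proj ::
  "(complex \<Rightarrow> 'v \<Rightarrow> 'v) \<Rightarrow> ('v \<Rightarrow> 'v) \<Rightarrow> complex \<Rightarrow> 'v \<Rightarrow> 'v::ab_group_add" where
  "eigen_proj s A \<mu> v = (THE f. eigen_decomp s A v f) \<mu>"

definition exp_diag ::
  "(complex \<Rightarrow> 'v \<Rightarrow> 'v) \<Rightarrow> complex \<Rightarrow> ('v \<Rightarrow> 'v) \<Rightarrow> 'v \<Rightarrow> 'v::ab_group_add" where
  "exp_diag s l A v = Sum_any (\<lambda>\<mu>. s (exp (l * \<mu>)) (eigen_proj s A \<mu> v))"


section \<open>Representations of the Heisenberg algebra\<close>

text \<open>
  \<open>smul\<close> is the scalar multiplication, \<open>hop i n\<close> is the action of \<open>h\<^sub>i\<^sub>,\<^sub>n\<close> (\<open>i = 1, 2\<close>),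
  \<open>a0\<close> that of \<open>a\<^sub>0\<close>. The generators \<open>Q\<^sub>i\<close> and \<open>Q\<close> act only through the shift operators
  \<open>expQ i = e\<^bsup>Q\<^sub>i\<^esup>\<close> and \<open>expQa = e\<^bsup>Q\<^esup>\<close>: a relation \<open>[x, Q] = c\<close> with \<open>c\<close> a scalar becomes
  \<open>x e\<^bsup>Q\<^esup> = e\<^bsup>Q\<^esup> (x + c)\<close>.
\<close>

record 'v heisenberg_ops =
  smul :: "complex \<Rightarrow> 'v \<Rightarrow> 'v"
  hop :: "nat \<Rightarrow> int \<Rightarrow> 'v \<Rightarrow> 'v"
  expQ :: "nat \<Rightarrow> 'v \<Rightarrow> 'v"
  a0 :: "'v \<Rightarrow> 'v"
  expQa :: "'v \<Rightarrow> 'v"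

text \<open>
  The numbers \<open>l1\<close> and \<open>l3\<close> are the chosen values of \<open>log q\<^sub>1\<close> and \<open>log q\<^sub>3\<close>; hence
  \<open>\<beta> = - l3 / l1\<close>, and \<open>q\<^sub>1\<^bsup>x\<^esup>\<close> means \<open>exp (l1 * x)\<close>.

  The last four axioms are what makes the currents well defined. The operators \<open>h\<^sub>i\<^sub>,\<^sub>n\<close> with
  \<open>n > 0\<close> act as on a Fock space: a vector is killed by every product of such operators whose
  total degree is large enough. The zero modes are diagonalizable, and \<open>h\<^sub>i\<^sub>,\<^sub>0\<close> has integral
  eigenvalues, so that \<open>z\<close> to the power \<open>h\<^sub>i\<^sub>,\<^sub>0\<close> only involves integral powers of \<open>z\<close>.
\<close>

locale heisenberg_module =
  fixes q d l1 l3 :: complex and R :: "('v::ab_group_add) heisenberg_ops"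
  assumes vs: "vector_space (smul R)"
    and exp_l1: "exp l1 = q1 q d"
    and exp_l3: "exp l3 = q3 q d"
    and linear_h: "i \<in> {1, 2} \<Longrightarrow> Vector_Spaces.linear (smul R) (smul R) (hop R i n)"
    and linear_expQ: "i \<in> {1, 2} \<Longrightarrow> Vector_Spaces.linear (smul R) (smul R) (expQ R i)"
    and linear_a0: "Vector_Spaces.linear (smul R) (smul R) (a0 R)"
    and linear_expQa: "Vector_Spaces.linear (smul R) (smul R) (expQa R)"
    and h_comm_same: "i \<in> {1, 2} \<Longrightarrow>
      hop R i n (hop R i m v) - hop R i m (hop R i n v) =
        smul R (if n + m = 0 then of_int n else 0) v"
    and h_comm_distinct: "i \<in> {1, 2} \<Longrightarrow> j \<in> {1, 2} \<Longrightarrow> i \<noteq> j \<Longrightarrow>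
      hop R i n (hop R j m v) - hop R j m (hop R i n v) =
        smul R (if n + m = 0
                then - of_int n * (q1 q d powi n + q3 q d powi n) / (1 + q2 q d powi (- n))
                else 0) v"
    and h0_expQ_same: "i \<in> {1, 2} \<Longrightarrow>
      hop R i 0 (expQ R i v) = expQ R i (hop R i 0 v + v)"
    and h0_expQ_distinct: "i \<in> {1, 2} \<Longrightarrow> j \<in> {1, 2} \<Longrightarrow> i \<noteq> j \<Longrightarrow>
      hop R i 0 (expQ R j v) = expQ R j (hop R i 0 v - v)"
    and h_expQ: "i \<in> {1, 2} \<Longrightarrow> j \<in> {1, 2} \<Longrightarrow> n \<noteq> 0 \<Longrightarrow>
      hop R i n (expQ R j v) = expQ R j (hop R i n v)"
    and h0_sum: "hop R 1 0 v = - hop R 2 0 v"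
    and expQ_12: "expQ R 1 (expQ R 2 v) = v"
    and expQ_21: "expQ R 2 (expQ R 1 v) = v"
    and bij_expQa: "bij (expQa R)"
    and a0_expQa: "a0 R (expQa R v) = expQa R (a0 R v + smul R ((- l3 / l1) / 2) v)"
    and a0_h: "i \<in> {1, 2} \<Longrightarrow> a0 R (hop R i n v) = hop R i n (a0 R v)"
    and a0_expQ: "i \<in> {1, 2} \<Longrightarrow> a0 R (expQ R i v) = expQ R i (a0 R v)"
    and h_expQa: "i \<in> {1, 2} \<Longrightarrow> hop R i n (expQa R v) = expQa R (hop R i n v)"
    and expQ_expQa: "i \<in> {1, 2} \<Longrightarrow> expQ R i (expQa R v) = expQa R (expQ R i v)"
    and h_pos_finite: "\<exists>N. \<forall>xs :: (nat \<times> int) list.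
      (\<forall>(i, n) \<in> set xs. i \<in> {1, 2} \<and> n > 0) \<and> sum_list (map snd xs) > N \<longrightarrow>
      foldr (\<lambda>(i, n). hop R i n) xs v = 0"
    and h0_diag: "i \<in> {1, 2} \<Longrightarrow> \<exists>f. eigen_decomp (smul R) (hop R i 0) v f"
    and h0_integral: "i \<in> {1, 2} \<Longrightarrow> hop R i 0 v = smul R \<mu> v \<Longrightarrow> v \<noteq> 0 \<Longrightarrow> \<mu> \<in> \<int>"
    and a0_diag: "\<exists>f. eigen_decomp (smul R) (a0 R) v f"


section \<open>Operator-valued formal series in one variable\<close>

text \<open>
  A formal series \<open>A(z) = \<Sum>\<^sub>m A\<^sub>m z\<^sup>m\<close>, infinite in both directions, is the function
  \<open>m \<mapsto> A\<^sub>m\<close>. Sums of infinitely many operators are taken vectorwise by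
  \<^const>\<open>Sum_any\<close>, which sums over the support of a family and returns \<open>0\<close> if the support is
  infinite. In a \<open>heisenberg_module\<close> with generic \<open>q, d\<close> the support is finite in every sum
  used below: the exponentials have finite coefficients, the creation parts only contain
  nonnegative powers, and all other factors applied to a vector give Laurent polynomials.
\<close>

type_synonym 'v opser = "int \<Rightarrow> 'v \<Rightarrow> 'v"

definition ser_const :: "('v \<Rightarrow> 'v) \<Rightarrow> ('v::ab_group_add) opser" where
  "ser_const A m = (if m = 0 then A else (\<lambda>_. 0))"

definition ser_mult :: "('v::ab_group_add) opser \<Rightarrow> 'v opser \<Rightarrow> 'v opser" (infixr "\<odot>" 70) where
  "(A \<odot> B) m v = Sum_any (\<lambda>k. A k (B (m - k) v))"

fun ser_pow :: "('v::ab_group_add) opser \<Rightarrow> nat \<Rightarrow> 'v opser" where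
  "ser_pow A 0 = ser_const (\<lambda>v. v)"
| "ser_pow A (Suc k) = A \<odot> ser_pow A k"

definition ser_exp ::
  "(complex \<Rightarrow> 'v \<Rightarrow> 'v) \<Rightarrow> ('v::ab_group_add) opser \<Rightarrow> 'v opser" where
  "ser_exp s A m v = Sum_any (\<lambda>k. s (1 / fact k) (ser_pow A k m v))"

text \<open>\<open>A(\<xi> z)\<close>\<close>
definition ser_rescale ::
  "(complex \<Rightarrow> 'v \<Rightarrow> 'v) \<Rightarrow> complex \<Rightarrow> 'v opser \<Rightarrow> 'v opser" where
  "ser_rescale s \<xi> A m v = s (\<xi> powi m) (A m v)"

text \<open>\<open>(c z)\<^sup>A\<close> for an operator \<open>A\<close> with integral eigenvalues\<close>
definition ser_zpow ::
  "(complex \<Rightarrow> 'v \<Rightarrow> 'v) \<Rightarrow> complex \<Rightarrow> ('v \<Rightarrow> 'v) \<Rightarrow> ('v::ab_group_add) opser" where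
  "ser_zpow s c A m v = s (c powi m) (eigen_proj s A (of_int m) v)"


section \<open>The currents\<close>

text \<open>
  A sign \<open>e\<close>, equal to \<open>1\<close> or \<open>-1\<close>, distinguishes \<open>\<Lambda>\<^sub>i\<^sup>+\<close> and \<open>\<Lambda>\<^sub>i\<^sup>-\<close>. For both of them the
  exponent is \<open>\<Sum>\<^sub>n\<^sub>\<noteq>\<^sub>0 - e q\<^bsup>e n\<^esup> / n h\<^sub>i\<^sub>,\<^sub>n z\<^bsup>-n\<^esup>\<close>; the mode \<open>h\<^sub>i\<^sub>,\<^sub>n\<close> sits at the power \<open>m = - n\<close>.
\<close>

definition exponent :: "complex \<Rightarrow> ('v::ab_group_add) heisenberg_ops \<Rightarrow> nat \<Rightarrow> int \<Rightarrow> 'v opser" where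
  "exponent q R i e m v =
     smul R (- of_int e * q powi (e * (- m)) / of_int (- m)) (hop R i (- m) v)"

definition creation :: "complex \<Rightarrow> ('v::ab_group_add) heisenberg_ops \<Rightarrow> nat \<Rightarrow> int \<Rightarrow> 'v opser" where
  "creation q R i e =
     ser_exp (smul R) (\<lambda>m v. if m > 0 then exponent q R i e m v else 0)"

definition annihilation :: "complex \<Rightarrow> ('v::ab_group_add) heisenberg_ops \<Rightarrow> nat \<Rightarrow> int \<Rightarrow> 'v opser" where
  "annihilation q R i e =
     ser_exp (smul R) (\<lambda>m v. if m < 0 then exponent q R i e m v else 0)"

text \<open>\<open>e\<^bsup>e Q\<^sub>i\<^esup>\<close>\<close>
definition shift :: "('v::ab_group_add) heisenberg_ops \<Rightarrow> nat \<Rightarrow> int \<Rightarrow> 'v opser" where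
  "shift R i e = ser_const (if e = 1 then expQ R i else inv (expQ R i))"

text \<open>\<open>(q\<^bsup>-e\<^esup> z)\<^sup>A q\<^sub>1\<^sup>B\<close> with \<open>A = e h\<^sub>i\<^sub>,\<^sub>0\<close> and \<open>B = e a\<^sub>0\<close>\<close>
definition zero_modes ::
  "complex \<Rightarrow> complex \<Rightarrow> ('v::ab_group_add) heisenberg_ops \<Rightarrow> nat \<Rightarrow> int \<Rightarrow> 'v opser" where
  "zero_modes q l1 R i e =
     ser_zpow (smul R) (q powi (- e)) (\<lambda>v. smul R (of_int e) (hop R i 0 v))
     \<odot> ser_const (exp_diag (smul R) l1 (\<lambda>v. smul R (of_int e) (a0 R v)))"

definition Lam ::
  "complex \<Rightarrow> complex \<Rightarrow> ('v::ab_group_add) heisenberg_ops \<Rightarrow> nat \<Rightarrow> int \<Rightarrow> 'v opser" where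
  "Lam q l1 R i e =
     creation q R i e \<odot> annihilation q R i e \<odot> shift R i e \<odot> zero_modes q l1 R i e"

definition W ::
  "complex \<Rightarrow> complex \<Rightarrow> ('v::ab_group_add) heisenberg_ops \<Rightarrow> nat \<Rightarrow> 'v opser" where
  "W q l1 R i m v = Lam q l1 R i 1 m v + Lam q l1 R i (- 1) m v"

text \<open>
  \<open>Lam_pair q l1 R \<xi> i e j e'\<close> is the normally ordered product of the current of type \<open>(i, e)\<close>
  at \<open>\<xi> z\<close> and the current of type \<open>(j, e')\<close> at \<open>z\<close>: the factors of both currents are
  rearranged with the modes of negative index and the shifts on the left, the modes of
  nonnegative index and \<open>a\<^sub>0\<close> on the right.
\<close>

definition Lam_pair ::
  "complex \<Rightarrow> complex \<Rightarrow> ('v::ab_group_add) heisenberg_ops \<Rightarrow> complex \<Rightarrow>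
   nat \<Rightarrow> int \<Rightarrow> nat \<Rightarrow> int \<Rightarrow> 'v opser" where
  "Lam_pair q l1 R \<xi> i e j e' =
     ser_rescale (smul R) \<xi> (creation q R i e) \<odot> creation q R j e'
     \<odot> shift R i e \<odot> shift R j e'
     \<odot> ser_rescale (smul R) \<xi> (annihilation q R i e) \<odot> annihilation q R j e'
     \<odot> ser_rescale (smul R) \<xi> (zero_modes q l1 R i e) \<odot> zero_modes q l1 R j e'"

text \<open>The factor \<open>z\<^sup>2\<close> in two of the terms shifts the index by \<open>2\<close>.\<close>
definition T ::
  "complex \<Rightarrow> complex \<Rightarrow> complex \<Rightarrow> ('v::ab_group_add) heisenberg_ops \<Rightarrow> nat \<Rightarrow> nat \<Rightarrow> complex \<Rightarrow>
   'v opser" where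
  "T q d l1 R i j \<xi> m v =
     smul R q (Lam_pair q l1 R \<xi> i 1 j 1 m v)
     + smul R (inverse q) (Lam_pair q l1 R \<xi> i (- 1) j (- 1) m v)
     + smul R (q * (1 - q1 q d * \<xi>) * (1 - q3 q d * \<xi>))
         (Lam_pair q l1 R \<xi> i 1 j (- 1) (m - 2) v)
     + smul R (inverse q * (1 - inverse (q1 q d) * \<xi>) * (1 - inverse (q3 q d) * \<xi>))
         (Lam_pair q l1 R \<xi> i (- 1) j 1 (m - 2) v)"


section \<open>Formal series in two variables\<close>

text \<open>The coefficient of \<open>z\<^sup>a w\<^sup>b\<close> in \<open>X\<close> is \<open>X a b\<close>.\<close>

type_synonym 'v opser2 = "int \<Rightarrow> int \<Rightarrow> 'v \<Rightarrow> 'v"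
type_synonym scser2 = "int \<Rightarrow> int \<Rightarrow> complex"

text \<open>\<open>A(z) B(w)\<close> and \<open>B(w) A(z)\<close>\<close>

definition prod_zw :: "'v opser \<Rightarrow> 'v opser \<Rightarrow> 'v opser2" where
  "prod_zw A B a b v = A a (B b v)"

definition prod_wz :: "'v opser \<Rightarrow> 'v opser \<Rightarrow> 'v opser2" where
  "prod_wz B A a b v = B b (A a v)"

text \<open>\<open>w\<^sup>-\<^sup>1 A(w)\<close>\<close>
definition winv_ser :: "('v::ab_group_add) opser \<Rightarrow> 'v opser2" where
  "winv_ser A a b v = (if a = 0 then A (b + 1) v else 0)"

definition smult2 ::
  "(complex \<Rightarrow> 'v \<Rightarrow> 'v) \<Rightarrow> scser2 \<Rightarrow> ('v::ab_group_add) opser2 \<Rightarrow> 'v opser2" where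
  "smult2 s g X a b v = Sum_any (\<lambda>(k, l). s (g k l) (X (a - k) (b - l) v))"

definition fser :: "complex \<Rightarrow> complex \<Rightarrow> complex \<Rightarrow> complex fps" where
  "fser q d \<xi> =
     fps_compose (fps_exp 1)
       (Abs_fps (\<lambda>n. if n = 0 then 0 else
          (\<xi> ^ n - (q1 q d ^ n + q3 q d ^ n) / (1 + q2 q d powi (- int n))) / of_nat n))"

text \<open>A power series evaluated at \<open>w / z\<close> and at \<open>z / w\<close>\<close>

definition at_w_over_z :: "complex fps \<Rightarrow> scser2" where
  "at_w_over_z g k l = (if l \<ge> 0 \<and> k = - l then fps_nth g (nat l) else 0)"

definition at_z_over_w :: "complex fps \<Rightarrow> scser2" where
  "at_z_over_w g k l = (if k \<ge> 0 \<and> l = - k then fps_nth g (nat k) else 0)"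

text \<open>\<open>\<delta>(\<xi> w / z)\<close>\<close>
definition delta_w_over_z :: "complex \<Rightarrow> scser2" where
  "delta_w_over_z \<xi> k l = (if k = - l then \<xi> powi l else 0)"

end

theory Submission
  imports Defs
begin

text \<open>
  Write \<open>\<Lambda>\<^sub>i\<^sup>e(z)\<close> for the half current with sign \<open>e\<close>, and let \<open>i \<noteq> j\<close>. The product
  \<open>\<Lambda>\<^sub>i\<^sup>e(z) \<Lambda>\<^sub>j\<^sup>e\<^sup>'(w)\<close> differs from the normally ordered product \<open>X(z, w)\<close> by scalar factors only.
  The zero mode of the first current passes the shift of the second one and leaves
  \<open>q\<^sup>e\<^sup>' z\<^bsup>-ee'\<^esup>\<close>; the annihilation part of the first passes the creation part of the second and
  leaves a power series in \<open>w/z\<close>. The function \<open>f(\<xi>; w/z)\<close> is made so that its product with the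
  latter series is rational. With \<open>x = w/z\<close> it is

    \<^item> \<open>1 / (1 - \<xi> x)\<close> if \<open>e' = e\<close>,
    \<^item> \<open>(1 - q\<^sub>1\<^bsup>-e\<^esup> x) (1 - q\<^sub>3\<^bsup>-e\<^esup> x) / (1 - \<xi> x)\<close> if \<open>e' = -e\<close>.

  The opposite order of the currents gives the same operator \<open>X(z, w)\<close>. Since
  \<open>q\<^sub>1 q\<^sub>3 = q\<^sup>-\<^sup>2\<close>, its scalar factor is the same rational function as \<open>\<xi>\<close> times the first one up to
  the sign, but expanded in \<open>z/w\<close>. The left side of the relation is therefore a difference of two
  expansions of one rational function, a Laurent polynomial divided by \<open>z - \<xi> w\<close>. Such a difference
  is \<open>\<delta>(\<xi> w/z)\<close> times a factor which may be evaluated at \<open>z = \<xi> w\<close>. There \<open>X(z, w)\<close> becomes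
  \<open>X(\<xi> w, w)\<close>, and adding the four choices of the signs gives \<open>w\<^sup>-\<^sup>1 \<T>\<^sub>i\<^sub>j(\<xi>; w)\<close>.

  To make this rigorous coefficient by coefficient, an exponential \<open>E = exp X\<close> of a series with
  commuting coefficients is handled through the recursion
  \<open>n E\<^sub>n = \<Sum>\<^sub>j j x\<^sub>j E\<^sub>n\<^sub>-\<^sub>j\<close> (lemma \<open>exp_recursion_ser_exp\<close>), from which the exchange of an
  annihilation exponential with a creation exponential follows by induction (lemma
  \<open>exp_recursion_exchange\<close>). Both sides of the relation are linear in the vector, and \<open>h\<^sub>i\<^sub>,\<^sub>0\<close> is
  diagonalizable, so it suffices to treat eigenvectors \<open>v\<close> of \<open>h\<^sub>i\<^sub>,\<^sub>0\<close>; on them the zero modes are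
  monomials in \<open>z\<close>. The finiteness axiom for the modes of positive degree turns all sums over
  annihilation coefficients into sums up to a bound \<open>N\<close> that depends on \<open>v\<close> only. This yields
  explicit formulas for the products of two currents (\<open>Lam_product\<close>) and for the normally ordered
  products (\<open>Lam_pair_eigenvector\<close>) in terms of the same coefficients \<open>normal_ordered\<close>. The
  cancellation of the two expansions is \<open>Sum_any_delta\<close>, and \<open>pair_identity\<close> is the relation for
  one choice of signs.
\<close>


section \<open>Linear operators and finitely supported sums\<close>

locale complex_space = vector_space s
  for s :: "complex \<Rightarrow> 'v \<Rightarrow> 'v::ab_group_add" (infixr \<open>*\<^sub>s\<close> 75)
begin

abbreviation lin :: "('v \<Rightarrow> 'v) \<Rightarrow> bool" where
  "lin \<equiv> Vector_Spaces.linear s s"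

lemma lin_iff:
  "lin f \<longleftrightarrow> (\<forall>u v. f (u + v) = f u + f v) \<and> (\<forall>c v. f (c *\<^sub>s v) = c *\<^sub>s f v)"
  by (simp add: Vector_Spaces.linear_iff vector_space_axioms)

lemma linI:
  assumes "\<And>u v. f (u + v) = f u + f v" and "\<And>c v. f (c *\<^sub>s v) = c *\<^sub>s f v"
  shows "lin f"
  using assms by (simp add: lin_iff)

lemma lin_add: "lin f \<Longrightarrow> f (u + v) = f u + f v"
  and lin_scale: "lin f \<Longrightarrow> f (c *\<^sub>s v) = c *\<^sub>s f v"
  by (simp_all add: lin_iff)

lemma lin_zero: "lin f \<Longrightarrow> f 0 = 0"
  by (metis lin_scale scale_zero_left)

lemma lin_diff: "lin f \<Longrightarrow> f (u - v) = f u - f v"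
  by (metis diff_eq_eq lin_add)

lemma lin_sum: "lin f \<Longrightarrow> f (sum g A) = (\<Sum>a\<in>A. f (g a))"
  by (induction A rule: infinite_finite_induct) (simp_all add: lin_zero lin_add)

lemma lin_Sum_any:
  assumes f: "lin f" and fin: "finite {a. g a \<noteq> 0}"
  shows "f (Sum_any g) = Sum_any (\<lambda>a. f (g a))"
proof -
  have "Sum_any (\<lambda>a. f (g a)) = (\<Sum>a\<in>{a. g a \<noteq> 0}. f (g a))"
    by (rule Sum_any.expand_superset[OF fin]) (use lin_zero[OF f] in auto)
  then show ?thesis
    by (simp add: Sum_any.expand_set lin_sum[OF f])
qed

lemma lin_const0: "lin (\<lambda>_. 0)"
  and lin_id: "lin (\<lambda>v. v)"
  and lin_smult: "lin f \<Longrightarrow> lin (\<lambda>v. c *\<^sub>s f v)"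
  and lin_comp: "lin f \<Longrightarrow> lin g \<Longrightarrow> lin (\<lambda>v. f (g v))"
  and lin_plus: "lin f \<Longrightarrow> lin g \<Longrightarrow> lin (\<lambda>v. f v + g v)"
  by (auto intro!: linI simp: lin_add lin_scale scale_right_distrib mult.commute algebra_simps)

lemma lin_sum_op: "(\<And>a. a \<in> A \<Longrightarrow> lin (f a)) \<Longrightarrow> lin (\<lambda>v. \<Sum>a\<in>A. f a v)"
  by (rule linI) (simp_all add: lin_add lin_scale sum.distrib scale_sum_right)

lemma lin_Sum_any_op:
  assumes f: "\<And>a. lin (f a)" and fin: "\<And>v. finite {a. f a v \<noteq> 0}"
  shows "lin (\<lambda>v. Sum_any (\<lambda>a. f a v))"
proof (rule linI)
  show "Sum_any (\<lambda>a. f a (u + v)) = Sum_any (\<lambda>a. f a u) + Sum_any (\<lambda>a. f a v)" for u v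
    by (simp add: lin_add[OF f] Sum_any.distrib[OF fin fin])
  show "Sum_any (\<lambda>a. f a (c *\<^sub>s v)) = c *\<^sub>s Sum_any (\<lambda>a. f a v)" for c v
    by (simp add: lin_scale[OF f] lin_Sum_any[OF lin_smult[OF lin_id] fin])
qed

end

lemma Sum_any_reindex_inj:
  assumes h: "inj h" and g: "\<And>x. x \<notin> range h \<Longrightarrow> g x = 0"
  shows "Sum_any g = Sum_any (\<lambda>y. g (h y))"
proof -
  have "x \<in> h ` {y. g (h y) \<noteq> 0}" if nz: "g x \<noteq> 0" for x
  proof -
    obtain y where "x = h y" using g[of x] nz by blast
    then show ?thesis using nz by simp
  qed
  then have supp: "{x. g x \<noteq> 0} = h ` {y. g (h y) \<noteq> 0}"
    by auto
  show ?thesis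
    unfolding Sum_any.expand_set supp
    by (subst sum.reindex) (use h in \<open>auto intro: inj_on_subset\<close>)
qed


section \<open>Recursion for exponentials\<close>

context complex_space
begin

text \<open>
  The equation is the coefficient form of \<open>z E' = (z X') E\<close>; together with \<open>E\<^sub>0 = 1\<close> it
  characterizes \<open>E = exp X\<close> for \<open>X = \<Sum>\<^sub>j x\<^sub>j z\<^sup>j\<close> without constant term and with commuting \<open>x\<^sub>j\<close>.
  It allows proofs about \<open>E\<close> by induction on the degree, without the powers of \<open>X\<close>.
\<close>
definition exp_recursion :: "(nat \<Rightarrow> 'v \<Rightarrow> 'v) \<Rightarrow> (nat \<Rightarrow> 'v \<Rightarrow> 'v) \<Rightarrow> bool" where
  "exp_recursion x E \<longleftrightarrow> (\<forall>v. E 0 v = v) \<and>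
     (\<forall>n v. of_nat n *\<^sub>s E n v = (\<Sum>j\<le>n. of_nat j *\<^sub>s x j (E (n - j) v)))"

lemma exp_recursion_induct [consumes 1, case_names Zero Step]:
  assumes "exp_recursion x E"
    and "P 0"
    and "\<And>n. n > 0 \<Longrightarrow> (\<And>j. 0 < j \<Longrightarrow> j \<le> n \<Longrightarrow> P (n - j)) \<Longrightarrow> P n"
  shows "P (n::nat)"
proof (induction n rule: less_induct)
  case (less n)
  show ?case using assms(2) assms(3)[of n] less.IH by (cases "n = 0") auto
qed

lemma exp_recursion_commute:
  assumes E: "exp_recursion x E" and t: "lin t"
    and comm: "\<And>j v. j > 0 \<Longrightarrow> t (x j v) = x j (t v)"
  shows "t (E n v) = E n (t v)"
  using E
proof (induction n rule: exp_recursion_induct)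
  case Zero
  show ?case using E by (simp add: exp_recursion_def)
next
  case (Step n)
  have "of_nat n *\<^sub>s t (E n v) = t (of_nat n *\<^sub>s E n v)"
    by (simp add: lin_scale[OF t])
  also have "\<dots> = (\<Sum>j\<le>n. of_nat j *\<^sub>s t (x j (E (n - j) v)))"
    using E by (simp add: exp_recursion_def lin_sum[OF t] lin_scale[OF t])
  also have "\<dots> = (\<Sum>j\<le>n. of_nat j *\<^sub>s x j (E (n - j) (t v)))"
  proof (rule sum.cong[OF refl])
    fix j assume "j \<in> {..n}"
    then show "of_nat j *\<^sub>s t (x j (E (n - j) v)) = of_nat j *\<^sub>s x j (E (n - j) (t v))"
      using Step(2)[of j] comm[of j] by (cases "j = 0") auto
  qed
  also have "\<dots> = of_nat n *\<^sub>s E n (t v)"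
    using E by (simp add: exp_recursion_def)
  finally show ?case
    using Step(1) by simp
qed

lemma exp_recursion_lin:
  assumes E: "exp_recursion x E" and x: "\<And>j. lin (x j)"
  shows "lin (E n)"
  using E
proof (induction n rule: exp_recursion_induct)
  case Zero
  show ?case using E lin_id by (simp add: exp_recursion_def lin_iff)
next
  case (Step n)
  have "E n = (\<lambda>v. (1 / of_nat n) *\<^sub>s (\<Sum>j\<in>{1..n}. of_nat j *\<^sub>s x j (E (n - j) v)))"
  proof (rule ext)
    fix v
    have "of_nat n *\<^sub>s E n v = (\<Sum>j\<le>n. of_nat j *\<^sub>s x j (E (n - j) v))"
      using E by (simp add: exp_recursion_def)
    also have "\<dots> = (\<Sum>j\<in>{1..n}. of_nat j *\<^sub>s x j (E (n - j) v))"
      by (rule sum.mono_neutral_right) (auto simp: Suc_le_eq)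
    finally have "(1 / of_nat n) *\<^sub>s of_nat n *\<^sub>s E n v
        = (1 / of_nat n) *\<^sub>s (\<Sum>j\<in>{1..n}. of_nat j *\<^sub>s x j (E (n - j) v))"
      by (rule arg_cong)
    moreover have "(1 / of_nat n) *\<^sub>s of_nat n *\<^sub>s E n v = E n v"
      using Step(1) by simp
    ultimately show "E n v = (1 / of_nat n) *\<^sub>s (\<Sum>j\<in>{1..n}. of_nat j *\<^sub>s x j (E (n - j) v))"
      by metis
  qed
  moreover have "lin (\<lambda>v. (1 / of_nat n) *\<^sub>s (\<Sum>j\<in>{1..n}. of_nat j *\<^sub>s x j (E (n - j) v)))"
    by (rule lin_smult, rule lin_sum_op, rule lin_smult, rule lin_comp[OF x]) (use Step(2) in auto)
  ultimately show ?case by (simp only:)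
qed

text \<open>
  With the value \<open>0\<close> at negative indices, the shifted coefficients \<open>E\<^sub>m\<^sub>-\<^sub>n\<close> that commutators
  produce need no case distinction.
\<close>
definition int_index :: "(nat \<Rightarrow> 'v \<Rightarrow> 'v) \<Rightarrow> int \<Rightarrow> 'v \<Rightarrow> 'v" where
  "int_index E m v = (if m < 0 then 0 else E (nat m) v)"

text \<open>
  The commutator with \<open>y\<close> is a derivation. As \<open>[y, x\<^sub>n] = c\<close> is a scalar and the other \<open>x\<^sub>j\<close>
  commute with \<open>y\<close>, it multiplies \<open>E = exp X\<close> by \<open>[y, X] = c z\<^sup>n\<close>.
\<close>
lemma exp_recursion_bracket:
  assumes E: "exp_recursion x E" and y: "lin y" and x: "\<And>j. lin (x j)" and n: "n > 0"
    and br: "\<And>j v. j > 0 \<Longrightarrow> y (x j v) = x j (y v) + (if j = n then c else 0) *\<^sub>s v"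
  shows "y (E m v) = E m (y v) + (if n \<le> m then c *\<^sub>s E (m - n) v else 0)"
  using E
proof (induction m rule: exp_recursion_induct)
  case Zero
  show ?case using E n by (simp add: exp_recursion_def)
next
  case (Step m)
  have rec: "of_nat m *\<^sub>s E m v = (\<Sum>j\<le>m. of_nat j *\<^sub>s x j (E (m - j) v))" for m v
    using E by (simp add: exp_recursion_def)
  have "of_nat m *\<^sub>s y (E m v) = (\<Sum>j\<le>m. of_nat j *\<^sub>s y (x j (E (m - j) v)))"
    using arg_cong[OF rec, of y m v] by (simp add: lin_scale[OF y] lin_sum[OF y])
  also have "\<dots> = (\<Sum>j\<le>m. of_nat j *\<^sub>s x j (E (m - j) (y v))
       + (if n \<le> m - j then c *\<^sub>s (of_nat j *\<^sub>s x j (E (m - n - j) v)) else 0)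
       + (if j = n then (of_nat n * c) *\<^sub>s E (m - n) v else 0))"
  proof (rule sum.cong[OF refl])
    fix j assume "j \<in> {..m}"
    then show "of_nat j *\<^sub>s y (x j (E (m - j) v)) = of_nat j *\<^sub>s x j (E (m - j) (y v))
       + (if n \<le> m - j then c *\<^sub>s (of_nat j *\<^sub>s x j (E (m - n - j) v)) else 0)
       + (if j = n then (of_nat n * c) *\<^sub>s E (m - n) v else 0)"
      using Step(2)[of j] br[of j "E (m - j) v"] n
      by (cases "j = 0") (auto simp: lin_add[OF x] lin_scale[OF x] scale_right_distrib lin_zero[OF x]
            mult.commute add.commute[of j n])
  qed
  also have "\<dots> = of_nat m *\<^sub>s E m (y v)
       + (\<Sum>j\<le>m. if n \<le> m - j then c *\<^sub>s (of_nat j *\<^sub>s x j (E (m - n - j) v)) else 0)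
       + (if n \<le> m then (of_nat n * c) *\<^sub>s E (m - n) v else 0)"
    by (simp add: sum.distrib rec)
  also have "(\<Sum>j\<le>m. if n \<le> m - j then c *\<^sub>s (of_nat j *\<^sub>s x j (E (m - n - j) v)) else 0)
     = (if n \<le> m then (of_nat (m - n) * c) *\<^sub>s E (m - n) v else 0)"
  proof (cases "n \<le> m")
    case True
    have "(\<Sum>j\<le>m. if n \<le> m - j then c *\<^sub>s (of_nat j *\<^sub>s x j (E (m - n - j) v)) else 0)
      = (\<Sum>j\<le>m - n. c *\<^sub>s (of_nat j *\<^sub>s x j (E (m - n - j) v)))"
      using True by (intro sum.mono_neutral_cong_right) auto
    also have "\<dots> = c *\<^sub>s (of_nat (m - n) *\<^sub>s E (m - n) v)"
      by (simp add: rec scale_sum_right)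
    finally show ?thesis using True by (simp add: mult.commute)
  qed (auto intro!: sum.neutral)
  also have "of_nat m *\<^sub>s E m (y v)
       + (if n \<le> m then (of_nat (m - n) * c) *\<^sub>s E (m - n) v else 0)
       + (if n \<le> m then (of_nat n * c) *\<^sub>s E (m - n) v else 0)
     = of_nat m *\<^sub>s (E m (y v) + (if n \<le> m then c *\<^sub>s E (m - n) v else 0))"
    by (auto simp: of_nat_diff algebra_simps)
  finally show ?case
    using Step(1) by simp
qed

lemma int_index_bracket:
  assumes "exp_recursion x E" and "lin y" and "\<And>j. lin (x j)" and "n > 0"
    and "\<And>j v. j > 0 \<Longrightarrow> y (x j v) = x j (y v) + (if j = n then c else 0) *\<^sub>s v"
  shows "y (int_index E m v) = int_index E m (y v) + c *\<^sub>s int_index E (m - int n) v"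
proof (cases "m < 0")
  case True
  then show ?thesis using lin_zero[OF assms(2)] by (simp add: int_index_def)
next
  case False
  have "nat m - n = nat (m - int n)" "n \<le> nat m \<longleftrightarrow> \<not> m - int n < 0" using False assms(4) by auto
  then show ?thesis
    using exp_recursion_bracket[OF assms, where m = "nat m" and v = v] False
    by (auto simp: int_index_def)
qed

text \<open>
  This is \<open>exp Y exp X = exp [Y, X] exp X exp Y\<close> for scalar \<open>[Y, X]\<close>, in coefficients;
  \<open>g\<close> is the scalar exponential. In the induction on \<open>a\<close>, the operator \<open>y\<^sub>k\<close> given by the recursion
  of \<open>F\<close> is moved to the right of \<open>E\<close>. The commuting terms reassemble to \<open>(a - l) F\<^sub>a\<^sub>-\<^sub>l\<close>, while the
  commutators contribute \<open>\<Sum>\<^sub>k k c\<^sub>k g\<^sub>l\<^sub>-\<^sub>k = l g\<^sub>l\<close>; both together give the factor \<open>a\<close>.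
\<close>
lemma exp_recursion_exchange:
  assumes F: "exp_recursion y F" and E: "exp_recursion x E"
    and x: "\<And>j. lin (x j)" and y: "\<And>j. lin (y j)"
    and br: "\<And>n j v. n > 0 \<Longrightarrow> j > 0 \<Longrightarrow>
        y n (x j v) = x j (y n v) + (if j = n then c n else 0) *\<^sub>s v"
    and g0: "g 0 = 1"
    and g: "\<And>n. of_nat n * g n = (\<Sum>j\<le>n. of_nat j * c j * g (n - j))"
  shows "F a (int_index E b v) = (\<Sum>l\<le>a. g l *\<^sub>s int_index E (b - int l) (F (a - l) v))"
  using F
proof (induction a arbitrary: b rule: exp_recursion_induct)
  case Zero
  show ?case using F g0 by (simp add: exp_recursion_def)
next
  case (Step a)
  let ?E = "int_index E"
  have linE: "lin (?E m)" for m
    using exp_recursion_lin[OF E x] lin_const0 by (cases "m < 0") (auto simp: int_index_def[abs_def])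
  have rec: "of_nat m *\<^sub>s F m v = (\<Sum>j\<le>m. of_nat j *\<^sub>s y j (F (m - j) v))" for m v
    using F by (simp add: exp_recursion_def)
  have rec_E: "(\<Sum>k\<le>m. g l *\<^sub>s ?E r (of_nat k *\<^sub>s y k (F (m - k) v)))
      = (of_nat m * g l) *\<^sub>s ?E r (F m v)" for m l r
  proof -
    have "(\<Sum>k\<le>m. g l *\<^sub>s ?E r (of_nat k *\<^sub>s y k (F (m - k) v)))
      = g l *\<^sub>s ?E r (of_nat m *\<^sub>s F m v)"
      by (simp only: rec lin_sum[OF linE] scale_sum_right)
    then show ?thesis by (simp add: lin_scale[OF linE] mult.commute)
  qed
  have expand: "of_nat k *\<^sub>s y k (F (a - k) (?E b v))
      = (\<Sum>l\<le>a - k. g l *\<^sub>s ?E (b - int l) (of_nat k *\<^sub>s y k (F (a - k - l) v)))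
      + (\<Sum>l\<le>a - k. (of_nat k * c k * g l) *\<^sub>s ?E (b - int (k + l)) (F (a - (k + l)) v))"
    if "k \<le> a" for k
  proof (cases "k = 0")
    case True
    then show ?thesis by (simp add: lin_zero[OF linE])
  next
    case False
    then have "of_nat k *\<^sub>s y k (F (a - k) (?E b v))
      = (\<Sum>l\<le>a - k. g l *\<^sub>s of_nat k *\<^sub>s y k (?E (b - int l) (F (a - k - l) v)))"
      using Step(2)[of k b] that
      by (simp add: lin_sum[OF y] lin_scale[OF y] scale_sum_right mult.commute)
    also have "\<dots> = (\<Sum>l\<le>a - k. g l *\<^sub>s ?E (b - int l) (of_nat k *\<^sub>s y k (F (a - k - l) v))
      + (of_nat k * c k * g l) *\<^sub>s ?E (b - int (k + l)) (F (a - (k + l)) v))"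
      using False
      by (intro sum.cong refl)
         (simp add: int_index_bracket[OF E y x _ br] lin_scale[OF linE] scale_right_distrib
            mult_ac algebra_simps)
    finally show ?thesis by (simp add: sum.distrib)
  qed
  have "of_nat a *\<^sub>s F a (?E b v) = (\<Sum>k\<le>a. of_nat k *\<^sub>s y k (F (a - k) (?E b v)))"
    by (rule rec)
  also have "\<dots> =
       (\<Sum>k\<le>a. \<Sum>l\<le>a - k. g l *\<^sub>s ?E (b - int l) (of_nat k *\<^sub>s y k (F (a - k - l) v)))
     + (\<Sum>k\<le>a. \<Sum>l\<le>a - k. (of_nat k * c k * g l) *\<^sub>s ?E (b - int (k + l)) (F (a - (k + l)) v))"
    by (simp add: expand sum.distrib)
  also have "(\<Sum>k\<le>a. \<Sum>l\<le>a - k. g l *\<^sub>s ?E (b - int l) (of_nat k *\<^sub>s y k (F (a - k - l) v)))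
     = (\<Sum>l\<le>a. \<Sum>k\<le>a - l. g l *\<^sub>s ?E (b - int l) (of_nat k *\<^sub>s y k (F (a - l - k) v)))"
    unfolding sum.Sigma[OF finite_atMost ballI[OF finite_atMost]]
    by (rule sum.reindex_bij_witness[of _ "\<lambda>(l, k). (k, l)" "\<lambda>(l, k). (k, l)"])
       (auto simp: add.commute)
  also have "\<dots> = (\<Sum>l\<le>a. (of_nat (a - l) * g l) *\<^sub>s ?E (b - int l) (F (a - l) v))"
    by (intro sum.cong refl)
       (simp only: rec_E)
  also have "(\<Sum>k\<le>a. \<Sum>l\<le>a - k. (of_nat k * c k * g l) *\<^sub>s ?E (b - int (k + l)) (F (a - (k + l)) v))
     = (\<Sum>l\<le>a. \<Sum>k\<le>l. (of_nat k * c k * g (l - k)) *\<^sub>s ?E (b - int l) (F (a - l) v))"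
    unfolding sum.Sigma[OF finite_atMost ballI[OF finite_atMost]]
    by (rule sum.reindex_bij_witness[of _ "\<lambda>(l, k). (k, l - k)" "\<lambda>(k, l). (k + l, k)"])
       auto
  also have "\<dots> = (\<Sum>l\<le>a. (of_nat l * g l) *\<^sub>s ?E (b - int l) (F (a - l) v))"
    by (simp add: g scale_sum_left)
  also have "(\<Sum>l\<le>a. (of_nat (a - l) * g l) *\<^sub>s ?E (b - int l) (F (a - l) v))
     + (\<Sum>l\<le>a. (of_nat l * g l) *\<^sub>s ?E (b - int l) (F (a - l) v))
     = of_nat a *\<^sub>s (\<Sum>l\<le>a. g l *\<^sub>s ?E (b - int l) (F (a - l) v))"
    unfolding sum.distrib[symmetric] scale_sum_right
    by (intro sum.cong refl) (auto simp: of_nat_diff algebra_simps)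
  finally show ?case
    using Step(1) by simp
qed

end


section \<open>Exponentials of operator-valued series\<close>

context complex_space
begin

lemma ser_mult_nonneg:
  assumes X: "\<And>m v. m < 0 \<Longrightarrow> X m v = 0" and linX: "\<And>m. lin (X m)"
    and B: "\<And>m v. m < 0 \<Longrightarrow> B m v = 0"
  shows "(X \<odot> B) (int n) v = (\<Sum>k\<le>n. X (int k) (B (int (n - k)) v))"
    and "m < 0 \<Longrightarrow> (X \<odot> B) m v = 0"
proof -
  have "(X \<odot> B) (int n) v = (\<Sum>k\<in>int ` {..n}. X k (B (int n - k) v))"
    unfolding ser_mult_def
  proof (rule Sum_any.expand_superset, simp, rule subsetI, rule ccontr)
    fix k assume k: "k \<in> {k. X k (B (int n - k) v) \<noteq> 0}" "k \<notin> int ` {..n}"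
    then have "0 \<le> k" "k \<le> int n"
      using X[of k] B[of "int n - k"] lin_zero[OF linX] by force+
    then have "k = int (nat k)" "nat k \<le> n" by auto
    then show False using k(2) by blast
  qed
  then show "(X \<odot> B) (int n) v = (\<Sum>k\<le>n. X (int k) (B (int (n - k)) v))"
    by (simp add: sum.reindex of_nat_diff)
  show "(X \<odot> B) m v = 0" if "m < 0"
  proof -
    have "X k (B (m - k) v) = 0" for k
      using X[of k] B[of "m - k"] lin_zero[OF linX] that by (cases "k < 0") auto
    then show ?thesis by (simp add: ser_mult_def)
  qed
qed

context
  fixes X :: "int \<Rightarrow> 'v \<Rightarrow> 'v"
  assumes X_nonpos: "\<And>m v. m \<le> 0 \<Longrightarrow> X m v = 0"
    and X_lin: "\<And>m. lin (X m)"
    and X_comm: "\<And>m n v. X m (X n v) = X n (X m v)"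
begin

lemma ser_pow_zero: "m < int k \<Longrightarrow> ser_pow X k m v = 0"
proof (induction k arbitrary: m)
  case 0
  then show ?case by (simp add: ser_const_def)
next
  case (Suc k)
  have "X j (ser_pow X k (m - j) v) = 0" for j
    using X_nonpos[of j] Suc lin_zero[OF X_lin] by (cases "j \<le> 0") auto
  then show ?case by (simp add: ser_mult_def)
qed

lemma ser_pow_Suc:
  "ser_pow X (Suc k) (int n) v = (\<Sum>j\<le>n. X (int j) (ser_pow X k (int (n - j)) v))"
  unfolding ser_pow.simps
  by (rule ser_mult_nonneg(1)) (auto simp: X_nonpos X_lin ser_pow_zero)

text \<open>
  The Leibniz rule \<open>z (X\<^bsup>k+1\<^esup>)' = (k + 1) (z X') X\<^sup>k\<close>. It needs that the coefficients of \<open>X\<close>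
  commute with each other.
\<close>
lemma ser_pow_derivation:
  "of_nat n *\<^sub>s ser_pow X (Suc k) (int n) v =
     of_nat (Suc k) *\<^sub>s (\<Sum>j\<le>n. of_nat j *\<^sub>s X (int j) (ser_pow X k (int (n - j)) v))"
proof (induction k arbitrary: n)
  case 0
  show ?case
  proof -
    have "of_nat n *\<^sub>s ser_pow X (Suc 0) (int n) v = (\<Sum>j\<le>n. of_nat n *\<^sub>s X (int j) (ser_pow X 0 (int (n - j)) v))"
      unfolding ser_pow_Suc by (simp add: scale_sum_right)
    also have "\<dots> = (\<Sum>j\<le>n. of_nat j *\<^sub>s X (int j) (ser_pow X 0 (int (n - j)) v))"
      by (rule sum.cong) (auto simp: ser_const_def lin_zero[OF X_lin])
    finally show ?thesis by simp
  qed
next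
  case (Suc k)
  let ?P = "ser_pow X"
  let ?D = "\<lambda>k n. \<Sum>j\<le>n. of_nat j *\<^sub>s X (int j) (?P k (int (n - j)) v)"
  have "of_nat n *\<^sub>s ?P (Suc (Suc k)) (int n) v
      = (\<Sum>j\<le>n. of_nat j *\<^sub>s X (int j) (?P (Suc k) (int (n - j)) v)
          + X (int j) (of_nat (n - j) *\<^sub>s ?P (Suc k) (int (n - j)) v))"
    unfolding ser_pow_Suc[of "Suc k"] scale_sum_right
    by (rule sum.cong) (auto simp: lin_scale[OF X_lin] of_nat_diff simp flip: scale_left_distrib)
  also have "\<dots> = ?D (Suc k) n + (\<Sum>j\<le>n. X (int j) (of_nat (Suc k) *\<^sub>s ?D k (n - j)))"
    unfolding sum.distrib Suc.IH ..
  also have "(\<Sum>j\<le>n. X (int j) (of_nat (Suc k) *\<^sub>s ?D k (n - j)))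
     = of_nat (Suc k) *\<^sub>s
        (\<Sum>j\<le>n. \<Sum>i\<le>n - j. of_nat i *\<^sub>s X (int i) (X (int j) (?P k (int (n - j - i)) v)))"
    by (simp only: lin_scale[OF X_lin] lin_sum[OF X_lin] scale_sum_right X_comm)
  also have "(\<Sum>j\<le>n. \<Sum>i\<le>n - j. of_nat i *\<^sub>s X (int i) (X (int j) (?P k (int (n - j - i)) v)))
     = (\<Sum>i\<le>n. \<Sum>j\<le>n - i. of_nat i *\<^sub>s X (int i) (X (int j) (?P k (int (n - i - j)) v)))"
    unfolding sum.Sigma[OF finite_atMost ballI[OF finite_atMost]]
    by (rule sum.reindex_bij_witness[of _ "\<lambda>(l, k). (k, l)" "\<lambda>(l, k). (k, l)"])
       (auto simp: add.commute)
  also have "\<dots> = ?D (Suc k) n"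
    unfolding ser_pow_Suc lin_sum[OF X_lin] scale_sum_right ..
  also have "?D (Suc k) n + of_nat (Suc k) *\<^sub>s ?D (Suc k) n = of_nat (Suc (Suc k)) *\<^sub>s ?D (Suc k) n"
    by (simp only: of_nat_Suc[of "Suc k"] scale_left_distrib scale_one)
  finally show ?case .
qed

text \<open>
  \<open>X\<close> has no constant term, so \<open>X\<^sup>k\<close> starts in degree \<open>k\<close> and the exponential series is finite in
  each degree. The freedom in \<open>K\<close> gives a common summation range in the recursion.
\<close>
lemma ser_exp_eq_sum:
  assumes "n \<le> K"
  shows "ser_exp s X (int n) v = (\<Sum>k\<le>K. (1 / fact k) *\<^sub>s ser_pow X k (int n) v)"
  unfolding ser_exp_def
proof (rule Sum_any.expand_superset, simp, rule subsetI, rule ccontr)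
  fix k assume k: "k \<in> {k. (1 / fact k) *\<^sub>s ser_pow X k (int n) v \<noteq> 0}" "k \<notin> {..K}"
  then have "int n < int k" using assms by auto
  from ser_pow_zero[OF this] show False using k by auto
qed

lemma ser_exp_neg: "m < 0 \<Longrightarrow> ser_exp s X m v = 0"
  by (simp add: ser_exp_def ser_pow_zero)

lemma exp_recursion_ser_exp: "exp_recursion (\<lambda>j. X (int j)) (\<lambda>n. ser_exp s X (int n))"
  unfolding exp_recursion_def
proof (intro conjI allI)
  show "ser_exp s X (int 0) v = v" for v
    using ser_exp_eq_sum[of 0 0 v] by (simp add: ser_const_def)
  fix n v
  show "of_nat n *\<^sub>s ser_exp s X (int n) v = (\<Sum>j\<le>n. of_nat j *\<^sub>s X (int j) (ser_exp s X (int (n - j)) v))"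
  proof (cases n)
    case 0
    then show ?thesis by simp
  next
    case (Suc n')
    have "of_nat n *\<^sub>s ser_exp s X (int n) v
       = (\<Sum>k\<le>Suc n'. (1 / fact k) *\<^sub>s of_nat n *\<^sub>s ser_pow X k (int n) v)"
    proof -
      have e: "ser_exp s X (int n) v = (\<Sum>k\<le>Suc n'. (1 / fact k) *\<^sub>s ser_pow X k (int n) v)"
        by (rule ser_exp_eq_sum) (simp add: Suc)
      show ?thesis
        by (simp only: e scale_sum_right scale_scale mult.commute)
    qed
    also have "\<dots> = (\<Sum>k\<le>n'. (1 / fact (Suc k)) *\<^sub>s of_nat n *\<^sub>s ser_pow X (Suc k) (int n) v)"
      unfolding sum.atMost_Suc_shift using Suc by (simp add: ser_const_def)
    also have "\<dots> = (\<Sum>k\<le>n'. (1 / fact k) *\<^sub>s (\<Sum>j\<le>n. of_nat j *\<^sub>s X (int j) (ser_pow X k (int (n - j)) v)))"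
    proof (rule sum.cong[OF refl])
      fix k
      have "(1 / fact (Suc k)) * of_nat (Suc k) = (1 / fact k :: complex)"
        by (simp add: field_simps del: of_nat_Suc)
      then show "(1 / fact (Suc k)) *\<^sub>s of_nat n *\<^sub>s ser_pow X (Suc k) (int n) v
        = (1 / fact k) *\<^sub>s (\<Sum>j\<le>n. of_nat j *\<^sub>s X (int j) (ser_pow X k (int (n - j)) v))"
        unfolding ser_pow_derivation scale_scale by simp
    qed
    also have "\<dots> = (\<Sum>j\<le>n. of_nat j *\<^sub>s X (int j) (\<Sum>k\<le>n'. (1 / fact k) *\<^sub>s ser_pow X k (int (n - j)) v))"
      unfolding scale_sum_right lin_sum[OF X_lin] lin_scale[OF X_lin]
      by (subst sum.swap) (simp only: scale_left_commute)
    also have "\<dots> = (\<Sum>j\<le>n. of_nat j *\<^sub>s X (int j) (ser_exp s X (int (n - j)) v))"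
    proof (rule sum.cong[OF refl])
      fix j
      show "of_nat j *\<^sub>s X (int j) (\<Sum>k\<le>n'. (1 / fact k) *\<^sub>s ser_pow X k (int (n - j)) v)
        = of_nat j *\<^sub>s X (int j) (ser_exp s X (int (n - j)) v)"
        using ser_exp_eq_sum[of "n - j" n' v] Suc by (cases "j = 0") auto
    qed
    finally show ?thesis .
  qed
qed

end

text \<open>
  The annihilation parts are series in \<open>z\<^sup>-\<^sup>1\<close>. The substitution of \<open>z\<^sup>-\<^sup>1\<close> for \<open>z\<close> is compatible with
  products, hence with exponentials, and reduces them to series in positive powers.
\<close>
lemma ser_mult_reflect: "((\<lambda>m. A (- m)) \<odot> (\<lambda>m. B (- m))) m v = (A \<odot> B) (- m) v"
  unfolding ser_mult_def
  by (rule Sum_any.reindex_cong[of uminus, symmetric]) (auto simp: fun_eq_iff bij_uminus)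

lemma ser_pow_reflect: "ser_pow (\<lambda>m. A (- m)) k m v = ser_pow A k (- m) v"
proof (induction k arbitrary: m v)
  case 0
  show ?case by (simp add: ser_const_def)
next
  case (Suc k)
  have "ser_pow (\<lambda>m. A (- m)) k = (\<lambda>m. ser_pow A k (- m))"
    using Suc by (simp add: fun_eq_iff)
  then show ?case by (simp add: ser_mult_reflect)
qed

lemma ser_exp_reflect: "ser_exp s (\<lambda>m. A (- m)) m v = ser_exp s A (- m) v"
  by (simp add: ser_exp_def ser_pow_reflect)

end


section \<open>Diagonalizable operators\<close>

context complex_space
begin

text \<open>
  Eigenvectors with distinct eigenvalues are independent: \<open>A - \<mu>0\<close> removes the component \<open>\<mu>0\<close> and
  multiplies the others by nonzero scalars.
\<close>
lemma eigen_sum_zero: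
  assumes "finite S" and A: "lin A"
    and "\<And>\<mu>. \<mu> \<in> S \<Longrightarrow> A (f \<mu>) = \<mu> *\<^sub>s f \<mu>" and "sum f S = 0"
  shows "\<forall>\<mu>\<in>S. f \<mu> = 0"
  using assms(1,3,4)
proof (induction S arbitrary: f rule: finite_induct)
  case empty
  then show ?case by simp
next
  case (insert \<mu>0 S)
  have "0 = A (sum f (insert \<mu>0 S)) - \<mu>0 *\<^sub>s sum f (insert \<mu>0 S)"
    using insert.prems by (simp add: lin_zero[OF A])
  also have "\<dots> = (\<Sum>\<mu>\<in>insert \<mu>0 S. A (f \<mu>) - \<mu>0 *\<^sub>s f \<mu>)"
    by (simp only: lin_sum[OF A] scale_sum_right sum_subtractf)
  also have "\<dots> = (\<Sum>\<mu>\<in>S. (\<mu> - \<mu>0) *\<^sub>s f \<mu>)"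
    using insert by (simp add: scale_left_diff_distrib)
  finally have "\<forall>\<mu>\<in>S. (\<mu> - \<mu>0) *\<^sub>s f \<mu> = 0"
    using insert.prems by (intro insert.IH) (auto simp: lin_scale[OF A] mult.commute)
  then have "\<forall>\<mu>\<in>S. f \<mu> = 0" using insert.hyps by auto
  then show ?case using insert by simp
qed

lemma eigen_decomp_unique:
  assumes A: "lin A" and f: "eigen_decomp s A v f" and g: "eigen_decomp s A v g"
  shows "f = g"
proof -
  let ?S = "{\<mu>. f \<mu> \<noteq> 0} \<union> {\<mu>. g \<mu> \<noteq> 0}"
  have fin: "finite ?S" using f g by (simp add: eigen_decomp_def)
  have sums: "Sum_any f = sum f ?S" "Sum_any g = sum g ?S"
    by (rule Sum_any.expand_superset[OF fin Un_upper1]) (rule Sum_any.expand_superset[OF fin Un_upper2])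
  have "Sum_any f = v" "Sum_any g = v"
    using f g by (simp_all only: eigen_decomp_def)
  with sums have "sum f ?S - sum g ?S = 0" by simp
  then have zero: "(\<Sum>\<mu>\<in>?S. f \<mu> - g \<mu>) = 0"
    by (simp only: sum_subtractf)
  have "A (f \<mu> - g \<mu>) = \<mu> *\<^sub>s (f \<mu> - g \<mu>)" for \<mu>
    using f g by (simp add: eigen_decomp_def lin_diff[OF A] scale_right_diff_distrib)
  from eigen_sum_zero[OF fin A this zero] have eq: "\<forall>\<mu>\<in>?S. f \<mu> - g \<mu> = 0" .
  show ?thesis
  proof (rule ext)
    fix \<mu>
    show "f \<mu> = g \<mu>"
    proof (cases "\<mu> \<in> ?S")
      case True
      from bspec[OF eq this] show ?thesis by simp
    qed simp
  qed
qed

lemma eigen_proj_eq: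
  assumes "lin A" and "eigen_decomp s A v f"
  shows "eigen_proj s A \<mu> v = f \<mu>"
proof -
  have "(THE f. eigen_decomp s A v f) = f"
    by (rule the_equality[where P = "eigen_decomp s A v", OF assms(2)])
       (rule eigen_decomp_unique[OF assms(1) _ assms(2)])
  then show ?thesis by (simp add: eigen_proj_def)
qed

lemma eigen_decomp_map:
  assumes B: "lin B" and comm: "\<And>v. A (B v) = B (A v)" and f: "eigen_decomp s A v f"
  shows "eigen_decomp s A (B v) (\<lambda>\<mu>. B (f \<mu>))"
proof -
  have fin: "finite {\<mu>. f \<mu> \<noteq> 0}" and ev: "\<And>\<mu>. A (f \<mu>) = \<mu> *\<^sub>s f \<mu>" and v: "v = Sum_any f"
    using f by (simp_all add: eigen_decomp_def)
  have "{\<mu>. B (f \<mu>) \<noteq> 0} \<subseteq> {\<mu>. f \<mu> \<noteq> 0}" using lin_zero[OF B] by auto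
  then show ?thesis
    using finite_subset[OF _ fin] lin_Sum_any[OF B fin] v
    by (simp add: eigen_decomp_def comm ev lin_scale[OF B])
qed

lemma eigen_decomp_add:
  assumes A: "lin A" and f: "eigen_decomp s A u f" and g: "eigen_decomp s A v g"
  shows "eigen_decomp s A (u + v) (\<lambda>\<mu>. f \<mu> + g \<mu>)"
proof -
  have fin: "finite {\<mu>. f \<mu> \<noteq> 0}" "finite {\<mu>. g \<mu> \<noteq> 0}" and uv: "u = Sum_any f" "v = Sum_any g"
    and ev: "\<And>\<mu>. A (f \<mu>) = \<mu> *\<^sub>s f \<mu>" "\<And>\<mu>. A (g \<mu>) = \<mu> *\<^sub>s g \<mu>"
    using f g by (simp_all add: eigen_decomp_def)
  have "{\<mu>. f \<mu> + g \<mu> \<noteq> 0} \<subseteq> {\<mu>. f \<mu> \<noteq> 0} \<union> {\<mu>. g \<mu> \<noteq> 0}" by auto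
  then have "finite {\<mu>. f \<mu> + g \<mu> \<noteq> 0}"
    by (rule finite_subset) (use fin in simp)
  moreover have "u + v = Sum_any (\<lambda>\<mu>. f \<mu> + g \<mu>)"
    unfolding uv by (rule Sum_any.distrib[OF fin, symmetric])
  ultimately show ?thesis
    by (simp add: eigen_decomp_def ev lin_add[OF A] scale_right_distrib)
qed

lemma eigen_decomp_eigenvector:
  assumes "lin A" and "A v = \<nu> *\<^sub>s v"
  shows "eigen_decomp s A v (\<lambda>\<mu>. if \<mu> = \<nu> then v else 0)"
  using assms lin_zero[OF assms(1)] by (simp add: eigen_decomp_def)

lemma eigen_decomp_uminus:
  assumes f: "eigen_decomp s A v f"
  shows "eigen_decomp s (\<lambda>v. (- 1) *\<^sub>s A v) v (\<lambda>\<mu>. f (- \<mu>))"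
proof -
  have fin: "finite {\<mu>. f \<mu> \<noteq> 0}" and ev: "\<And>\<mu>. A (f \<mu>) = \<mu> *\<^sub>s f \<mu>" and v: "v = Sum_any f"
    using f by (simp_all add: eigen_decomp_def)
  have "finite (uminus -` {\<mu>. f \<mu> \<noteq> 0})"
    using fin by (rule finite_vimageI) simp
  moreover have "Sum_any (\<lambda>\<mu>. f (- \<mu>)) = Sum_any f"
    by (rule Sum_any.reindex_cong[of uminus, symmetric]) (auto simp: fun_eq_iff bij_uminus)
  ultimately show ?thesis
    using v by (simp add: eigen_decomp_def ev vimage_def)
qed

context
  fixes A :: "'v \<Rightarrow> 'v"
  assumes A: "lin A" and diag: "\<And>v. \<exists>f. eigen_decomp s A v f"
begin

lemma eigen_proj_decomp: "eigen_decomp s A v (\<lambda>\<mu>. eigen_proj s A \<mu> v)"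
proof -
  obtain f where "eigen_decomp s A v f" using diag by blast
  then show ?thesis by (simp add: eigen_proj_eq[OF A])
qed

lemma eigen_proj_commute:
  assumes "lin B" and "\<And>v. A (B v) = B (A v)"
  shows "eigen_proj s A \<mu> (B v) = B (eigen_proj s A \<mu> v)"
  by (rule eigen_proj_eq[OF A eigen_decomp_map[OF assms eigen_proj_decomp]])

lemma lin_eigen_proj: "lin (eigen_proj s A \<mu>)"
proof (rule linI)
  show "eigen_proj s A \<mu> (u + v) = eigen_proj s A \<mu> u + eigen_proj s A \<mu> v" for u v
    by (rule eigen_proj_eq[OF A eigen_decomp_add[OF A eigen_proj_decomp eigen_proj_decomp]])
  show "eigen_proj s A \<mu> (c *\<^sub>s v) = c *\<^sub>s eigen_proj s A \<mu> v" for c v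
    by (rule eigen_proj_commute) (simp_all add: lin_scale[OF A] lin_smult[OF lin_id])
qed

lemma finite_eigen_proj: "finite {\<mu>. eigen_proj s A \<mu> v \<noteq> 0}"
  using eigen_proj_decomp[of v] by (simp add: eigen_decomp_def)

lemma finite_exp_eigen_proj: "finite {\<mu>. exp (l * \<mu>) *\<^sub>s eigen_proj s A \<mu> v \<noteq> 0}"
  by (rule finite_subset[OF _ finite_eigen_proj[of v]]) auto

lemma lin_exp_diag: "lin (exp_diag s l A)"
  unfolding exp_diag_def[abs_def]
  by (rule lin_Sum_any_op[OF lin_smult[OF lin_eigen_proj] finite_exp_eigen_proj])

lemma exp_diag_commute:
  assumes B: "lin B" and comm: "\<And>v. A (B v) = B (A v)"
  shows "exp_diag s l A (B v) = B (exp_diag s l A v)"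
  unfolding exp_diag_def
  by (simp add: eigen_proj_commute[OF B comm] lin_scale[OF B, symmetric]
      lin_Sum_any[OF B finite_exp_eigen_proj])

end

end

section \<open>Exponentials of power series\<close>

lemma fps_exp_compose_deriv:
  "fps_nth G 0 = 0 \<Longrightarrow> fps_deriv (fps_exp 1 oo G) = fps_deriv G * (fps_exp 1 oo (G :: complex fps))"
  by (simp add: fps_compose_deriv mult.commute)

lemma fps_nth_of_deriv_eq:
  assumes "fps_deriv f = fps_deriv G * (f :: complex fps)"
  shows "of_nat n * fps_nth f n = (\<Sum>j\<le>n. of_nat j * fps_nth G j * fps_nth f (n - j))"
proof (cases n)
  case 0
  then show ?thesis by simp
next
  case (Suc k)
  have "of_nat n * fps_nth f n = fps_nth (fps_deriv G * f) k"
    using arg_cong[OF assms, of "\<lambda>h. fps_nth h k"] Suc by simp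
  also have "\<dots> = (\<Sum>j\<le>k. of_nat (Suc j) * fps_nth G (Suc j) * fps_nth f (k - j))"
    by (simp add: fps_mult_nth atLeast0AtMost)
  also have "\<dots> = (\<Sum>j\<le>n. of_nat j * fps_nth G j * fps_nth f (n - j))"
    unfolding Suc sum.atMost_Suc_shift by simp
  finally show ?thesis .
qed

text \<open>
  In \<open>f' = H f\<close> the coefficient of degree \<open>n\<close> on the right only involves coefficients of \<open>f\<close> up to
  degree \<open>n\<close>, while on the left it is \<open>(n + 1) f\<^sub>n\<^sub>+\<^sub>1\<close>.
\<close>
lemma fps_log_deriv_unique:
  assumes f: "fps_deriv f = H * (f :: complex fps)" and g: "fps_deriv g = H * g"
    and 0: "fps_nth f 0 = fps_nth g 0"
  shows "f = g"
proof -
  have "fps_nth f n = fps_nth g n" for n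
  proof (induction n rule: less_induct)
    case (less n)
    show ?case
    proof (cases n)
      case 0
      with assms(3) show ?thesis by simp
    next
      case (Suc k)
      have "fps_nth (H * f) k = fps_nth (H * g) k"
        unfolding fps_mult_nth using less Suc by (intro sum.cong) auto
      then have "of_nat (Suc k) * fps_nth f n = of_nat (Suc k) * fps_nth g n"
        using arg_cong[OF f, of "\<lambda>h. fps_nth h k"] arg_cong[OF g, of "\<lambda>h. fps_nth h k"] Suc
        by simp
      then show ?thesis by (simp del: of_nat_Suc)
    qed
  qed
  then show ?thesis by (rule fps_ext)
qed

lemma fps_exp_compose_add:
  assumes "fps_nth G 0 = 0" "fps_nth H 0 = 0"
  shows "(fps_exp 1 oo G) * (fps_exp 1 oo H) = fps_exp 1 oo (G + H :: complex fps)"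
  by (rule fps_log_deriv_unique[of _ "fps_deriv (G + H)"])
     (use assms in \<open>simp_all add: fps_exp_compose_deriv algebra_simps\<close>)

text \<open>
  \<open>- log (1 - c x)\<close>
\<close>
definition log_series :: "complex \<Rightarrow> complex fps" where
  "log_series c = Abs_fps (\<lambda>n. if n = 0 then 0 else c ^ n / of_nat n)"

lemma exp_neg_log_series: "fps_exp 1 oo (- log_series c) = 1 - fps_const c * fps_X"
proof -
  have nth0: "fps_nth (log_series c) 0 = 0" by (simp add: log_series_def)
  have "fps_deriv (log_series c) * (1 - fps_const c * fps_X) = fps_const c"
  proof (rule fps_ext)
    fix n
    have d: "fps_nth (fps_deriv (log_series c)) n = c ^ Suc n" for n
      by (simp add: log_series_def del: of_nat_Suc)
    have "fps_deriv (log_series c) * (1 - fps_const c * fps_X)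
       = fps_deriv (log_series c) - fps_const c * (fps_X * fps_deriv (log_series c))"
      by (simp add: algebra_simps)
    then show "fps_nth (fps_deriv (log_series c) * (1 - fps_const c * fps_X)) n
       = fps_nth (fps_const c) n"
      by (cases n) (simp_all add: d del: fps_deriv_nth)
  qed
  then have d: "fps_deriv (1 - fps_const c * fps_X) = fps_deriv (- log_series c) * (1 - fps_const c * fps_X)"
    by simp
  show ?thesis
  proof (rule fps_log_deriv_unique)
    show "fps_deriv (fps_exp 1 oo (- log_series c)) = fps_deriv (- log_series c) * (fps_exp 1 oo (- log_series c))"
      by (rule fps_exp_compose_deriv) (simp add: nth0)
    show "fps_deriv (1 - fps_const c * fps_X) = fps_deriv (- log_series c) * (1 - fps_const c * fps_X)"
      by (rule d)
    show "fps_nth (fps_exp 1 oo (- log_series c)) 0 = fps_nth (1 - fps_const c * fps_X) 0"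
      by simp
  qed
qed

lemma exp_log_series: "fps_exp 1 oo log_series c = Abs_fps (\<lambda>n. c ^ n)"
proof -
  let ?E = "fps_exp 1 oo log_series c"
  have "?E * (1 - fps_const c * fps_X) = 1"
    unfolding exp_neg_log_series[symmetric]
    by (subst fps_exp_compose_add) (simp_all add: log_series_def)
  then have E: "?E = 1 + fps_const c * (fps_X * ?E)"
    unfolding right_diff_distrib mult_1_right diff_eq_eq by (simp only: mult_ac)
  have "fps_nth ?E n = c ^ n" for n
  proof (induction n)
    case 0
    show ?case by simp
  next
    case (Suc n)
    have "fps_nth ?E (Suc n) = fps_nth (1 + fps_const c * (fps_X * ?E)) (Suc n)"
      using E by (rule arg_cong)
    then have "fps_nth ?E (Suc n) = c * fps_nth ?E n"
      by (simp del: fps_compose_nth_0)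
    then show ?case using Suc by simp
  qed
  then show ?thesis by (intro fps_ext) simp
qed


section \<open>Well-defined products of series\<close>

context complex_space
begin

text \<open>
  Two classes of series, both considered vector by vector: Laurent polynomials, and series with
  only finitely many negative powers. A product with a Laurent polynomial on the right is always
  a finite sum in each coefficient; a product with a series that is bounded below on the right is
  so if the left factor has no negative powers.
\<close>
definition laurent :: "'v opser \<Rightarrow> bool" where
  "laurent B \<longleftrightarrow> (\<forall>m. lin (B m)) \<and> (\<forall>v. finite {m. B m v \<noteq> 0})"

definition bounded_below :: "'v opser \<Rightarrow> bool" where
  "bounded_below B \<longleftrightarrow> (\<forall>m. lin (B m)) \<and> (\<forall>v. \<exists>N. \<forall>m<N. B m v = 0)"

lemma laurentD: "laurent B \<Longrightarrow> lin (B m)" "laurent B \<Longrightarrow> finite {m. B m v \<noteq> 0}"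
  by (simp_all add: laurent_def)

lemma bounded_belowD: "bounded_below B \<Longrightarrow> lin (B m)"
  by (simp add: bounded_below_def)

lemma bounded_belowE:
  assumes "bounded_below B"
  obtains N where "\<And>m. m < N \<Longrightarrow> B m v = 0"
  using assms unfolding bounded_below_def by blast

lemma laurent_imp_bounded_below:
  assumes B: "laurent B"
  shows "bounded_below B"
proof -
  have "\<exists>N. \<forall>m<N. B m v = 0" for v
  proof -
    let ?S = "{m. B m v \<noteq> 0}"
    have "finite ?S" using laurentD(2)[OF B] .
    then obtain N where "\<forall>m\<in>?S. N \<le> m"
      by (meson bdd_below_finite bdd_below.E)
    then show ?thesis by (intro exI[of _ N]) force
  qed
  then show ?thesis using laurentD(1)[OF B] by (simp add: bounded_below_def)
qed

lemma finite_ser_mult_support: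
  fixes A B :: "'v opser"
  assumes A: "\<And>m. lin (A m)" and B: "finite {m. B m v \<noteq> 0}"
  shows "finite {k. A k (B (m - k) v) \<noteq> 0}"
proof (rule finite_subset)
  show "{k. A k (B (m - k) v) \<noteq> 0} \<subseteq> (\<lambda>n. m - n) ` {n. B n v \<noteq> 0}"
  proof
    fix k assume "k \<in> {k. A k (B (m - k) v) \<noteq> 0}"
    then have "B (m - k) v \<noteq> 0" using lin_zero[OF A] by auto
    then show "k \<in> (\<lambda>n. m - n) ` {n. B n v \<noteq> 0}"
      by (intro image_eqI[of _ _ "m - k"]) (auto simp: algebra_simps)
  qed
qed (use B in simp)

lemma ser_mult_lin:
  assumes "\<And>m. lin (A m)" and "\<And>m. lin (B m)"
    and "\<And>v. finite {k. A k (B (m - k) v) \<noteq> 0}"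
  shows "lin ((A \<odot> B) m)"
  unfolding ser_mult_def[abs_def] by (rule lin_Sum_any_op[OF lin_comp]) (use assms in auto)

lemma laurent_mult:
  assumes A: "laurent A" and B: "laurent B"
  shows "laurent (A \<odot> B)"
  unfolding laurent_def
proof (intro conjI allI)
  show "lin ((A \<odot> B) m)" for m
    by (rule ser_mult_lin) (simp_all add: laurentD[OF A] laurentD[OF B] finite_ser_mult_support)
  fix v
  show "finite {m. (A \<odot> B) m v \<noteq> 0}"
  proof (rule finite_subset)
    show "{m. (A \<odot> B) m v \<noteq> 0}
        \<subseteq> (\<Union>n\<in>{n. B n v \<noteq> 0}. (\<lambda>k. k + n) ` {k. A k (B n v) \<noteq> 0})"
    proof
      fix m assume "m \<in> {m. (A \<odot> B) m v \<noteq> 0}"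
      then obtain k where k: "A k (B (m - k) v) \<noteq> 0"
        unfolding ser_mult_def mem_Collect_eq by (rule Sum_any.not_neutral_obtains_not_neutral)
      then have "B (m - k) v \<noteq> 0" using lin_zero[OF laurentD(1)[OF A]] by auto
      moreover have "m \<in> (\<lambda>k'. k' + (m - k)) ` {k'. A k' (B (m - k) v) \<noteq> 0}"
        using k by (intro image_eqI[of _ _ k]) auto
      ultimately show "m \<in> (\<Union>n\<in>{n. B n v \<noteq> 0}. (\<lambda>k. k + n) ` {k. A k (B n v) \<noteq> 0})"
        by (intro UN_I[of "m - k"]) auto
    qed
  qed (simp add: laurentD(2)[OF A] laurentD(2)[OF B])
qed

lemma bounded_below_mult:
  assumes A: "\<And>m. lin (A m)" "\<And>m v. m < 0 \<Longrightarrow> A m v = 0" and B: "bounded_below B"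
  shows "bounded_below (A \<odot> B)"
proof -
  have fin: "finite {k. A k (B (m - k) v) \<noteq> 0}" for m v
  proof -
    obtain N where N: "\<And>m. m < N \<Longrightarrow> B m v = 0" using bounded_belowE[OF B, of v] by blast
    have "{k. A k (B (m - k) v) \<noteq> 0} \<subseteq> {0..m - N}"
    proof
      fix k assume k: "k \<in> {k. A k (B (m - k) v) \<noteq> 0}"
      then have "\<not> k < 0" "\<not> m - k < N"
        using A(2)[of k] N[of "m - k"] lin_zero[OF A(1)] by auto
      then show "k \<in> {0..m - N}" by auto
    qed
    then show ?thesis by (rule finite_subset) simp
  qed
  have "\<exists>N. \<forall>m<N. (A \<odot> B) m v = 0" for v
  proof -
    obtain N where N: "\<And>m. m < N \<Longrightarrow> B m v = 0" using bounded_belowE[OF B, of v] by blast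
    have "A k (B (m - k) v) = 0" if "m < N" for m k
      using A(2)[of k] N[of "m - k"] lin_zero[OF A(1)] that by (cases "k < 0") auto
    then show ?thesis unfolding ser_mult_def by (intro exI[of _ N]) simp
  qed
  moreover have "lin ((A \<odot> B) m)" for m
    by (rule ser_mult_lin) (simp_all add: A(1) bounded_belowD[OF B] fin)
  ultimately show ?thesis by (simp add: bounded_below_def)
qed

lemma laurent_const:
  assumes A: "lin A" shows "laurent (ser_const A)"
proof -
  have "{m. ser_const A m v \<noteq> 0} \<subseteq> {0}" for v by (auto simp: ser_const_def)
  then have "finite {m. ser_const A m v \<noteq> 0}" for v by (rule finite_subset) simp
  then show ?thesis using A lin_const0 by (simp add: laurent_def ser_const_def)
qed

lemma rescale_lin: "lin (A m) \<Longrightarrow> lin (ser_rescale s \<xi> A m)"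
  unfolding ser_rescale_def[abs_def] by (rule lin_smult)

lemma laurent_rescale:
  assumes "laurent A"
  shows "laurent (ser_rescale s \<xi> A)"
proof -
  have "{m. ser_rescale s \<xi> A m v \<noteq> 0} \<subseteq> {m. A m v \<noteq> 0}" for v
    by (auto simp: ser_rescale_def)
  then have "finite {m. ser_rescale s \<xi> A m v \<noteq> 0}" for v
    using laurentD(2)[OF assms] finite_subset by blast
  then show ?thesis
    unfolding laurent_def by (blast intro: rescale_lin laurentD(1)[OF assms])
qed

lemma ser_const_mult: "(ser_const A \<odot> B) m v = A (B m v)"
proof -
  have "(ser_const A \<odot> B) m v = Sum_any (\<lambda>k. if k = 0 then A (B (m - k) v) else 0)"
    unfolding ser_mult_def by (rule Sum_any.cong) (simp add: ser_const_def)
  then show ?thesis by simp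
qed

lemma ser_mult_const:
  assumes "\<And>m. lin (A m)"
  shows "(A \<odot> ser_const B) m v = A m (B v)"
proof -
  have "(A \<odot> ser_const B) m v = Sum_any (\<lambda>k. if k = m then A k (B v) else 0)"
    unfolding ser_mult_def
    by (rule Sum_any.cong) (auto simp: ser_const_def lin_zero[OF assms])
  then show ?thesis by simp
qed

text \<open>
  On an eigenvector the zero modes are a monomial; this and the next lemma remove a monomial from
  the right end of a product.
\<close>
lemma ser_mult_monomial:
  assumes "\<And>m. B m v = (if m = m0 then w else 0)" and "\<And>m. lin (A m)"
  shows "(A \<odot> B) m v = A (m - m0) w"
proof -
  have "(A \<odot> B) m v = Sum_any (\<lambda>k. if k = m - m0 then A k w else 0)"
    unfolding ser_mult_def assms(1)
    by (rule Sum_any.cong) (auto simp: lin_zero[OF assms(2)])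
  then show ?thesis by simp
qed

lemma ser_mult_translate:
  assumes "\<And>m. B m v = B' (m - m0) w"
  shows "(A \<odot> B) m v = (A \<odot> B') (m - m0) w"
  unfolding ser_mult_def assms by (simp add: algebra_simps)

lemma ser_mult_polynomial:
  assumes lin: "\<And>m. lin (C m)" and "\<And>m. m > 0 \<Longrightarrow> A m v = 0" and "\<And>m. m < - int N \<Longrightarrow> A m v = 0"
  shows "(C \<odot> A) m v = (\<Sum>l\<le>N. C (m + int l) (A (- int l) v))"
proof -
  have "(C \<odot> A) m v = (\<Sum>k\<in>(\<lambda>l. m + int l) ` {..N}. C k (A (m - k) v))"
    unfolding ser_mult_def
  proof (rule Sum_any.expand_superset, simp, rule subsetI)
    fix k assume "k \<in> {k. C k (A (m - k) v) \<noteq> 0}"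
    then have "A (m - k) v \<noteq> 0" using lin_zero[OF lin] by auto
    then have "\<not> m - k > 0" "\<not> m - k < - int N" using assms(2,3) by auto
    then show "k \<in> (\<lambda>l. m + int l) ` {..N}"
      by (intro image_eqI[of _ _ "nat (k - m)"]) auto
  qed
  then show ?thesis by (simp add: sum.reindex inj_on_def)
qed

text \<open>
  The shift operators stand between creation and annihilation parts; they are moved to the right
  end of the product by means of this lemma.
\<close>
lemma ser_mult_commute_op:
  assumes t: "lin t" and A: "\<And>m v. t (A m v) = A m (t v)" "\<And>m. lin (A m)"
    and B: "\<And>m v. t (B m v) = B m (t v)" "laurent B"
  shows "t ((A \<odot> B) m v) = (A \<odot> B) m (t v)"
  unfolding ser_mult_def
  by (simp only: lin_Sum_any[OF t finite_ser_mult_support[of A B, OF A(2) laurentD(2)[OF B(2)]]] A(1) B(1))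

end


section \<open>The building blocks of the currents\<close>

context heisenberg_module
begin

sublocale complex_space "smul R"
  unfolding complex_space_def by (rule vs)

abbreviation scal (infixr \<open>\<cdot>\<close> 75) where "scal \<equiv> smul R"

abbreviation cre where "cre \<equiv> creation q R"

text \<open>
  The coefficient of \<open>z\<^bsup>-n\<^esup>\<close>: annihilation coefficients are indexed by the degree that they remove.
\<close>
definition ann :: "nat \<Rightarrow> int \<Rightarrow> nat \<Rightarrow> 'v \<Rightarrow> 'v" where
  "ann i e n = annihilation q R i e (- int n)"

definition creation_mode :: "nat \<Rightarrow> int \<Rightarrow> nat \<Rightarrow> 'v \<Rightarrow> 'v" where
  "creation_mode i e n = (\<lambda>v. if n = 0 then 0 else exponent q R i e (int n) v)"

definition annihilation_mode :: "nat \<Rightarrow> int \<Rightarrow> nat \<Rightarrow> 'v \<Rightarrow> 'v" where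
  "annihilation_mode i e n = (\<lambda>v. if n = 0 then 0 else exponent q R i e (- int n) v)"

lemma exponent_lin: "i \<in> {1, 2} \<Longrightarrow> lin (exponent q R i e m)"
  unfolding exponent_def[abs_def] by (rule lin_smult[OF linear_h])

lemma hop_commute:
  assumes "i \<in> {1, 2}" "j \<in> {1, 2}" "n + m \<noteq> 0"
  shows "hop R i n (hop R j m v) = hop R j m (hop R i n v)"
proof (cases "i = j")
  case True
  then show ?thesis using h_comm_same[of i n m v] assms by simp
next
  case False
  then show ?thesis using h_comm_distinct[of i j n m v] assms by simp
qed

lemma hop0_commute:
  assumes "i \<in> {1, 2}" "j \<in> {1, 2}"
  shows "hop R i 0 (hop R j m v) = hop R j m (hop R i 0 v)"
proof (cases "i = j")
  case True
  then show ?thesis using h_comm_same[of i 0 m v] assms by (simp split: if_splits)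
next
  case False
  then show ?thesis using h_comm_distinct[of i j 0 m v] assms by (simp split: if_splits)
qed

lemma exponent_commute_op:
  assumes "lin t" and "\<And>v. t (hop R i (- m) v) = hop R i (- m) (t v)"
  shows "t (exponent q R i e m v) = exponent q R i e m (t v)"
  using assms by (simp add: exponent_def lin_scale)

lemma exponent_commute:
  assumes "i \<in> {1, 2}" "j \<in> {1, 2}" "m + n \<noteq> 0"
  shows "exponent q R i e m (exponent q R j e' n v) = exponent q R j e' n (exponent q R i e m v)"
  using hop_commute[OF assms(1,2), of "- m" "- n"] assms
  by (intro exponent_commute_op exponent_lin)
     (auto simp: exponent_def lin_scale[OF linear_h])

lemma lin_if: "(b \<Longrightarrow> lin f) \<Longrightarrow> (\<not> b \<Longrightarrow> lin g) \<Longrightarrow> lin (\<lambda>v. if b then f v else g v)"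
  by (cases b) simp_all

lemma creation_mode_lin: "i \<in> {1, 2} \<Longrightarrow> lin (creation_mode i e n)"
  and annihilation_mode_lin: "i \<in> {1, 2} \<Longrightarrow> lin (annihilation_mode i e n)"
  by (cases "n = 0"; simp add: creation_mode_def annihilation_mode_def exponent_lin lin_const0 del: insert_iff)+

lemma exp_recursion_cre: "i \<in> {1, 2} \<Longrightarrow> exp_recursion (creation_mode i e) (\<lambda>n. cre i e (int n))"
  and cre_neg: "i \<in> {1, 2} \<Longrightarrow> m < 0 \<Longrightarrow> cre i e m v = 0"
proof -
  assume i: "i \<in> {1, 2}"
  let ?X = "\<lambda>m v. if m > 0 then exponent q R i e m v else 0"
  have X: "\<And>m v. m \<le> 0 \<Longrightarrow> ?X m v = 0" "\<And>m. lin (?X m)"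
    "\<And>m n v. ?X m (?X n v) = ?X n (?X m v)"
    using lin_zero[OF exponent_lin[OF i]] exponent_commute[OF i i]
    by (auto intro: lin_if lin_const0 exponent_lin[OF i])
  have "creation_mode i e = (\<lambda>j. ?X (int j))"
    by (auto simp: creation_mode_def fun_eq_iff)
  then show "exp_recursion (creation_mode i e) (\<lambda>n. cre i e (int n))"
    unfolding creation_def using exp_recursion_ser_exp[of ?X, OF X] by simp
  show "m < 0 \<Longrightarrow> cre i e m v = 0"
    unfolding creation_def by (rule ser_exp_neg[of ?X, OF X])
qed

lemma exp_recursion_ann: "i \<in> {1, 2} \<Longrightarrow> exp_recursion (annihilation_mode i e) (ann i e)"
  and annihilation_pos: "i \<in> {1, 2} \<Longrightarrow> m > 0 \<Longrightarrow> annihilation q R i e m v = 0"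
proof -
  assume i: "i \<in> {1, 2}"
  let ?X = "\<lambda>m v. if m > 0 then exponent q R i e (- m) v else 0"
  have X: "\<And>m v. m \<le> 0 \<Longrightarrow> ?X m v = 0" "\<And>m. lin (?X m)"
    "\<And>m n v. ?X m (?X n v) = ?X n (?X m v)"
    using lin_zero[OF exponent_lin[OF i]] exponent_commute[OF i i]
    by (auto intro: lin_if lin_const0 exponent_lin[OF i])
  have refl: "annihilation q R i e (- m) v = ser_exp scal ?X m v" for m v
    using ser_exp_reflect[of "\<lambda>m v. if m < 0 then exponent q R i e m v else 0" m v]
    by (simp add: annihilation_def)
  have "annihilation_mode i e = (\<lambda>j. ?X (int j))"
    by (auto simp: annihilation_mode_def fun_eq_iff)
  moreover have "ann i e = (\<lambda>n. ser_exp scal ?X (int n))"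
    by (simp add: ann_def fun_eq_iff refl)
  ultimately show "exp_recursion (annihilation_mode i e) (ann i e)"
    using exp_recursion_ser_exp[of ?X, OF X] by simp
  show "annihilation q R i e m v = 0" if "m > 0"
    using refl[of "- m" v] ser_exp_neg[of ?X, OF X, of "- m" v] that by simp
qed

lemma cre_lin: "i \<in> {1, 2} \<Longrightarrow> lin (cre i e m)"
  using exp_recursion_lin[OF exp_recursion_cre creation_mode_lin, of i e "nat m"] lin_const0 cre_neg[of i m e]
  by (cases "m < 0") (simp_all add: lin_iff)

lemma ann_lin: "i \<in> {1, 2} \<Longrightarrow> lin (ann i e n)"
  by (rule exp_recursion_lin[OF exp_recursion_ann annihilation_mode_lin])

lemma annihilation_lin: "i \<in> {1, 2} \<Longrightarrow> lin (annihilation q R i e m)"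
  using ann_lin[of i e "nat (- m)"] lin_const0 annihilation_pos[of i m e]
  by (cases "m > 0") (simp_all add: lin_iff ann_def)

lemma cre_int_index: "i \<in> {1, 2} \<Longrightarrow> cre i e = int_index (\<lambda>n. cre i e (int n))"
  by (auto simp: int_index_def fun_eq_iff cre_neg)

text \<open>
  By \<open>exp_recursion_commute\<close>, an operator that commutes with the modes in the exponent commutes
  with the coefficients of the exponential. This is applied to modes, to other exponentials and
  to the zero mode operators.
\<close>
lemma cre_commute_op:
  assumes i: "i \<in> {1, 2}" and t: "lin t"
    and comm: "\<And>n v. n < 0 \<Longrightarrow> t (hop R i n v) = hop R i n (t v)"
  shows "t (cre i e m v) = cre i e m (t v)"
proof (cases "m < 0")
  case True
  then show ?thesis using cre_neg[OF i] lin_zero[OF t] by simp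
next
  case False
  have "t (cre i e (int (nat m)) v) = cre i e (int (nat m)) (t v)"
    by (rule exp_recursion_commute[OF exp_recursion_cre[OF i] t])
       (use comm in \<open>simp add: creation_mode_def exponent_commute_op[OF t]\<close>)
  then show ?thesis using False by simp
qed

lemma ann_commute_op:
  assumes i: "i \<in> {1, 2}" and t: "lin t"
    and comm: "\<And>n v. n > 0 \<Longrightarrow> t (hop R i n v) = hop R i n (t v)"
  shows "t (ann i e n v) = ann i e n (t v)"
  by (rule exp_recursion_commute[OF exp_recursion_ann[OF i] t])
     (use comm in \<open>simp add: annihilation_mode_def exponent_commute_op[OF t]\<close>)

lemma cre_commute:
  assumes i: "i \<in> {1, 2}" and j: "j \<in> {1, 2}"
  shows "cre i e m (cre j e' n v) = cre j e' n (cre i e m v)"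
proof (rule cre_commute_op[OF j cre_lin[OF i]])
  fix n' :: int and v assume n': "n' < 0"
  have "hop R j n' (cre i e m v) = cre i e m (hop R j n' v)"
    by (rule cre_commute_op[OF i linear_h[OF j]]) (use n' in \<open>simp add: hop_commute[OF j i]\<close>)
  then show "cre i e m (hop R j n' v) = hop R j n' (cre i e m v)" ..
qed

lemma ann_commute:
  assumes i: "i \<in> {1, 2}" and j: "j \<in> {1, 2}"
  shows "ann i e m (ann j e' n v) = ann j e' n (ann i e m v)"
proof (rule ann_commute_op[OF j ann_lin[OF i]])
  fix n' :: int and v assume n': "n' > 0"
  have "hop R j n' (ann i e m v) = ann i e m (hop R j n' v)"
    by (rule ann_commute_op[OF i linear_h[OF j]]) (use n' in \<open>simp add: hop_commute[OF j i]\<close>)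
  then show "ann i e m (hop R j n' v) = hop R j n' (ann i e m v)" ..
qed

text \<open>
  The quantitative form of local finiteness, which tracks how the bound drops when modes act.
  Negative values of \<open>M\<close> are allowed on purpose: then the empty word shows that \<open>v = 0\<close>, so that
  bounds on degrees give vanishing of annihilation coefficients.
\<close>
definition killed_above :: "int \<Rightarrow> 'v \<Rightarrow> bool" where
  "killed_above M v \<longleftrightarrow> (\<forall>xs. (\<forall>(i, n)\<in>set xs. i \<in> {1, 2} \<and> n > 0) \<and> sum_list (map snd xs) > M \<longrightarrow>
      foldr (\<lambda>(i, n). hop R i n) xs v = 0)"

lemma foldr_hop_lin:
  "(\<forall>(i, n)\<in>set xs. i \<in> {1, 2} \<and> n > 0) \<Longrightarrow> lin (foldr (\<lambda>(i, n). hop R i n) xs)"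
proof (induction xs)
  case Nil
  show ?case using lin_id by (simp add: lin_iff)
next
  case (Cons x xs)
  obtain i n where x: "x = (i, n)" by (cases x)
  have "lin (\<lambda>v. hop R i n (foldr (\<lambda>(i, n). hop R i n) xs v))"
    by (rule lin_comp[OF linear_h]) (use Cons x in auto)
  then show ?case by (simp add: x comp_def)
qed

lemma killed_above_exists: "\<exists>N :: nat. killed_above (int N) v"
proof -
  obtain N where N: "killed_above N v" using h_pos_finite[of v] unfolding killed_above_def by blast
  have "killed_above (int (nat N)) v" unfolding killed_above_def
  proof (intro allI impI)
    fix xs :: "(nat \<times> int) list"
    assume xs: "(\<forall>(i, n)\<in>set xs. i \<in> {1, 2} \<and> n > 0) \<and> sum_list (map snd xs) > int (nat N)"
    then have "sum_list (map snd xs) > N" by linarith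
    then show "foldr (\<lambda>(i, n). hop R i n) xs v = 0"
      using N[unfolded killed_above_def, rule_format, of xs] xs by blast
  qed
  then show ?thesis ..
qed

lemma killed_above_mono: "killed_above M v \<Longrightarrow> M \<le> N \<Longrightarrow> killed_above N v"
  unfolding killed_above_def by (meson order.strict_trans1)

lemma killed_above_neg: "killed_above M v \<Longrightarrow> M < 0 \<Longrightarrow> v = 0"
  unfolding killed_above_def by (elim allE[of _ "[]"]) simp

lemma killed_above_sum:
  assumes "\<And>a. a \<in> S \<Longrightarrow> killed_above M (f a)"
  shows "killed_above M (\<Sum>a\<in>S. f a)"
  unfolding killed_above_def
proof (intro allI impI)
  fix xs :: "(nat \<times> int) list"
  assume xs: "(\<forall>(i, n)\<in>set xs. i \<in> {1, 2} \<and> n > 0) \<and> sum_list (map snd xs) > M"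
  then have "lin (foldr (\<lambda>(i, n). hop R i n) xs)" by (intro foldr_hop_lin) simp
  then show "foldr (\<lambda>(i, n). hop R i n) xs (\<Sum>a\<in>S. f a) = 0"
    using assms xs by (simp add: lin_sum killed_above_def)
qed

lemma killed_above_smult: "killed_above M v \<Longrightarrow> killed_above M (c \<cdot> v)"
  unfolding killed_above_def
proof (intro allI impI)
  fix xs :: "(nat \<times> int) list"
  assume v: "\<forall>xs. (\<forall>(i, n)\<in>set xs. i \<in> {1, 2} \<and> n > 0) \<and> sum_list (map snd xs) > M \<longrightarrow>
      foldr (\<lambda>(i, n). hop R i n) xs v = 0"
    and xs: "(\<forall>(i, n)\<in>set xs. i \<in> {1, 2} \<and> n > 0) \<and> sum_list (map snd xs) > M"
  then have "lin (foldr (\<lambda>(i, n). hop R i n) xs)" by (intro foldr_hop_lin) simp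
  moreover have "foldr (\<lambda>(i, n). hop R i n) xs v = 0" using v xs by blast
  ultimately show "foldr (\<lambda>(i, n). hop R i n) xs (c \<cdot> v) = 0"
    by (simp add: lin_scale)
qed

lemma killed_above_hop:
  assumes v: "killed_above M v" and i: "i \<in> {1, 2}" and n: "n > 0"
  shows "killed_above (M - n) (hop R i n v)"
  unfolding killed_above_def
proof (intro allI impI)
  fix xs :: "(nat \<times> int) list"
  assume "(\<forall>(i, n)\<in>set xs. i \<in> {1, 2} \<and> n > 0) \<and> sum_list (map snd xs) > M - n"
  then have "foldr (\<lambda>(i, n). hop R i n) (xs @ [(i, n)]) v = 0"
    using v[unfolded killed_above_def, rule_format, of "xs @ [(i, n)]"] i n by auto
  then show "foldr (\<lambda>(i, n). hop R i n) xs (hop R i n v) = 0" by simp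
qed

lemma killed_above_commute_op:
  assumes v: "killed_above M v" and t: "lin t"
    and comm: "\<And>i n v. i \<in> {1, 2} \<Longrightarrow> n > 0 \<Longrightarrow> t (hop R i n v) = hop R i n (t v)"
  shows "killed_above M (t v)"
  unfolding killed_above_def
proof (intro allI impI)
  fix xs :: "(nat \<times> int) list"
  assume xs: "(\<forall>(i, n)\<in>set xs. i \<in> {1, 2} \<and> n > 0) \<and> sum_list (map snd xs) > M"
  have "\<forall>(i, n)\<in>set xs. i \<in> {1, 2} \<and> n > 0 \<Longrightarrow>
      foldr (\<lambda>(i, n). hop R i n) xs (t v) = t (foldr (\<lambda>(i, n). hop R i n) xs v)"
    by (induction xs) (auto simp: comm)
  moreover have "foldr (\<lambda>(i, n). hop R i n) xs v = 0"
    using v xs unfolding killed_above_def by blast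
  ultimately show "foldr (\<lambda>(i, n). hop R i n) xs (t v) = 0"
    using xs lin_zero[OF t] by simp
qed

text \<open>
  An annihilation coefficient of degree \<open>n\<close> is a combination of words of degree \<open>n\<close>; the recursion
  for the exponential replaces an explicit expansion.
\<close>
lemma killed_above_ann:
  assumes v: "killed_above M v" and i: "i \<in> {1, 2}"
  shows "killed_above (M - int n) (ann i e n v)"
  using exp_recursion_ann[OF i]
proof (induction n rule: exp_recursion_induct)
  case Zero
  show ?case using exp_recursion_ann[OF i, of e] v by (simp add: exp_recursion_def)
next
  case (Step n)
  have "killed_above (M - int n) (of_nat j \<cdot> annihilation_mode i e j (ann i e (n - j) v))" if "j \<le> n" for j
  proof (cases "j = 0")
    case True
    then show ?thesis using killed_above_smult[OF killed_above_hop] by (simp add: killed_above_def foldr_hop_lin lin_zero)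
  next
    case False
    have "killed_above (M - int (n - j) - int j) (hop R i (int j) (ann i e (n - j) v))"
      by (rule killed_above_hop[OF Step(2) i]) (use False that in auto)
    then have "killed_above (M - int n) (hop R i (int j) (ann i e (n - j) v))"
      using that by (simp add: of_nat_diff)
    then show ?thesis
      using False unfolding annihilation_mode_def exponent_def
      by (simp only: if_False minus_minus) (intro killed_above_smult)
  qed
  then have "killed_above (M - int n) (\<Sum>j\<le>n. of_nat j \<cdot> annihilation_mode i e j (ann i e (n - j) v))"
    by (intro killed_above_sum) auto
  then have "killed_above (M - int n) (of_nat n \<cdot> ann i e n v)"
    using exp_recursion_ann[OF i, of e] by (simp add: exp_recursion_def)
  from killed_above_smult[OF this, of "1 / of_nat n"] show ?case
    using Step(1) by simp
qed

lemma ann_zero: "killed_above (int N) v \<Longrightarrow> i \<in> {1, 2} \<Longrightarrow> n > N \<Longrightarrow> ann i e n v = 0"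
  by (rule killed_above_neg[OF killed_above_ann]) auto

lemma ann_ann_zero:
  assumes "killed_above (int N) v" "i \<in> {1, 2}" "j \<in> {1, 2}" "n > N"
  shows "ann i e n (ann j e' m v) = 0"
  by (rule ann_zero[OF killed_above_mono[OF killed_above_ann]]) (use assms in auto)

lemma annihilation_laurent:
  assumes i: "i \<in> {1, 2}"
  shows "laurent (annihilation q R i e)"
  unfolding laurent_def
proof (intro conjI allI)
  show "lin (annihilation q R i e m)" for m by (rule annihilation_lin[OF i])
  fix v
  obtain N where N: "killed_above (int N) v" using killed_above_exists by blast
  have "{m. annihilation q R i e m v \<noteq> 0} \<subseteq> {- int N..0}"
  proof
    fix m assume m: "m \<in> {m. annihilation q R i e m v \<noteq> 0}"
    then have "\<not> m > 0" using annihilation_pos[OF i, of m e v] by auto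
    moreover have "\<not> nat (- m) > N"
      using ann_zero[OF N i, of "nat (- m)" e] m calculation by (auto simp: ann_def)
    ultimately show "m \<in> {- int N..0}" by auto
  qed
  then show "finite {m. annihilation q R i e m v \<noteq> 0}" by (rule finite_subset) simp
qed

subsection \<open>Zero modes and shifts\<close>

text \<open>
  \<open>e\<^bsup>e Q\<^sub>i\<^esup>\<close>
\<close>
definition shift_op :: "nat \<Rightarrow> int \<Rightarrow> 'v \<Rightarrow> 'v" where
  "shift_op i e = (if e = 1 then expQ R i else inv (expQ R i))"

text \<open>
  \<open>q\<^sub>1\<close> to the power \<open>e a\<^sub>0\<close>
\<close>
definition a0_exp :: "int \<Rightarrow> 'v \<Rightarrow> 'v" where
  "a0_exp e = exp_diag scal l1 (\<lambda>v. of_int e \<cdot> a0 R v)"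

text \<open>
  \<open>e\<^bsup>Q\<^sub>1\<^esup>\<close> and \<open>e\<^bsup>Q\<^sub>2\<^esup>\<close> are inverse to each other, so each inverse shift is again a shift of the module.
\<close>
lemma shift_op_eq:
  assumes i: "i \<in> {1, 2}" and e: "e \<in> {1, - 1}"
  shows "shift_op i e = expQ R (if e = 1 then i else if i = 1 then 2 else 1)"
proof -
  have "inv (expQ R 1) = expQ R 2"
    by (rule inv_unique_comp) (simp_all add: fun_eq_iff expQ_12 expQ_21 del: One_nat_def)
  moreover have "inv (expQ R 2) = expQ R 1"
    by (rule inv_unique_comp) (simp_all add: fun_eq_iff expQ_12 expQ_21 del: One_nat_def)
  moreover have "i = 1 \<or> i = 2" using i by simp
  ultimately show ?thesis using e by (auto simp: shift_op_def simp del: One_nat_def)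
qed

lemma expQ_commute:
  assumes "i \<in> {1, 2}" "j \<in> {1, 2}"
  shows "expQ R i (expQ R j v) = expQ R j (expQ R i v)"
  using assms by (auto simp: expQ_12 expQ_21 simp del: One_nat_def)

lemma shift_op_lin: "i \<in> {1, 2} \<Longrightarrow> e \<in> {1, - 1} \<Longrightarrow> lin (shift_op i e)"
  by (subst shift_op_eq) (auto intro!: linear_expQ)

lemma shift_op_commute:
  assumes "i \<in> {1, 2}" "j \<in> {1, 2}" "e \<in> {1, - 1}" "e' \<in> {1, - 1}"
  shows "shift_op i e (shift_op j e' v) = shift_op j e' (shift_op i e v)"
  using assms(1,2) by (simp only: shift_op_eq[OF assms(1,3)] shift_op_eq[OF assms(2,4)], intro expQ_commute) auto

lemma shift_op_hop:
  assumes "i \<in> {1, 2}" "j \<in> {1, 2}" "e \<in> {1, - 1}" "n \<noteq> 0"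
  shows "shift_op i e (hop R j n v) = hop R j n (shift_op i e v)"
  using assms(1) by (simp only: shift_op_eq[OF assms(1,3)], intro h_expQ[symmetric] assms) auto

lemma hop0_shift_op:
  assumes "i \<in> {1, 2}" "j \<in> {1, 2}" "e \<in> {1, - 1}"
  shows "hop R j 0 (shift_op i e v) = shift_op i e (hop R j 0 v + of_int (if i = j then e else - e) \<cdot> v)"
  using assms h0_expQ_same[of 1] h0_expQ_same[of 2] h0_expQ_distinct[of 1 2] h0_expQ_distinct[of 2 1]
  by (auto simp: shift_op_eq[OF assms(1,3)] simp del: One_nat_def)

lemma diag_sign:
  assumes "\<And>v. \<exists>f. eigen_decomp scal A v f" and e: "e \<in> {1, - 1 :: int}"
  shows "\<exists>f. eigen_decomp scal (\<lambda>v. of_int e \<cdot> A v) v f"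
proof -
  obtain f where f: "eigen_decomp scal A v f" using assms(1) by blast
  show ?thesis
    using e f eigen_decomp_uminus[OF f] by (cases "e = 1") auto
qed

lemma a0_exp_lin: "e \<in> {1, - 1} \<Longrightarrow> lin (a0_exp e)"
  unfolding a0_exp_def by (rule lin_exp_diag[OF lin_smult[OF linear_a0] diag_sign[OF a0_diag]])

lemma a0_exp_commute_op:
  assumes "e \<in> {1, - 1}" and t: "lin t" and "\<And>v. a0 R (t v) = t (a0 R v)"
  shows "a0_exp e (t v) = t (a0_exp e v)"
  unfolding a0_exp_def
  by (rule exp_diag_commute[OF lin_smult[OF linear_a0] diag_sign[OF a0_diag]])
     (use assms in \<open>simp_all add: lin_scale[OF t]\<close>)

lemma a0_exp_hop: "e \<in> {1, - 1} \<Longrightarrow> i \<in> {1, 2} \<Longrightarrow> a0_exp e (hop R i n v) = hop R i n (a0_exp e v)"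
  by (rule a0_exp_commute_op) (simp_all add: linear_h a0_h)

lemma a0_exp_shift_op:
  assumes "e \<in> {1, - 1}" "i \<in> {1, 2}" "e' \<in> {1, - 1}"
  shows "a0_exp e (shift_op i e' v) = shift_op i e' (a0_exp e v)"
proof (rule a0_exp_commute_op[OF assms(1) shift_op_lin[OF assms(2,3)]])
  show "a0 R (shift_op i e' v) = shift_op i e' (a0 R v)" for v
    unfolding shift_op_eq[OF assms(2,3)] by (rule a0_expQ) (use assms in auto)
qed

lemma a0_exp_a0_exp: "e \<in> {1, - 1} \<Longrightarrow> e' \<in> {1, - 1} \<Longrightarrow> a0_exp e (a0_exp e' v) = a0_exp e' (a0_exp e v)"
  by (rule a0_exp_commute_op, assumption, rule a0_exp_lin, assumption)
     (rule a0_exp_commute_op[symmetric], auto simp: linear_a0)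

text \<open>
  The part of a half current that does not depend on \<open>z\<close>. It commutes with all modes of nonzero
  degree and shifts the eigenvalues of the zero modes.
\<close>
definition shift_a0 :: "nat \<Rightarrow> int \<Rightarrow> 'v \<Rightarrow> 'v" where
  "shift_a0 i e v = shift_op i e (a0_exp e v)"

lemma shift_a0_lin: "i \<in> {1, 2} \<Longrightarrow> e \<in> {1, - 1} \<Longrightarrow> lin (shift_a0 i e)"
  unfolding shift_a0_def[abs_def] by (rule lin_comp[OF shift_op_lin a0_exp_lin])

lemma shift_a0_hop:
  "i \<in> {1, 2} \<Longrightarrow> e \<in> {1, - 1} \<Longrightarrow> j \<in> {1, 2} \<Longrightarrow> n \<noteq> 0 \<Longrightarrow> shift_a0 i e (hop R j n v) = hop R j n (shift_a0 i e v)"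
  by (simp add: shift_a0_def a0_exp_hop shift_op_hop)

lemma shift_a0_commute:
  "i \<in> {1, 2} \<Longrightarrow> j \<in> {1, 2} \<Longrightarrow> e \<in> {1, - 1} \<Longrightarrow> e' \<in> {1, - 1} \<Longrightarrow>
     shift_a0 i e (shift_a0 j e' v) = shift_a0 j e' (shift_a0 i e v)"
  by (simp add: shift_a0_def a0_exp_shift_op a0_exp_a0_exp shift_op_commute)

lemma hop0_shift_a0:
  "i \<in> {1, 2} \<Longrightarrow> j \<in> {1, 2} \<Longrightarrow> e \<in> {1, - 1} \<Longrightarrow> hop R j 0 v = of_int \<mu> \<cdot> v \<Longrightarrow>
     hop R j 0 (shift_a0 i e v) = of_int (\<mu> + (if i = j then e else - e)) \<cdot> shift_a0 i e v"
  unfolding shift_a0_def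
  by (subst hop0_shift_op)
     (auto simp: a0_exp_hop[symmetric] lin_scale[OF a0_exp_lin] lin_scale[OF shift_op_lin] scale_left_distrib[symmetric]
        lin_add[OF shift_op_lin] scale_left_diff_distrib)

lemma zero_modes_eq:
  assumes i: "i \<in> {1, 2}" and e: "e \<in> {1, - 1}"
  shows "zero_modes q l1 R i e m v
     = (q powi (- e)) powi m \<cdot> eigen_proj scal (\<lambda>v. of_int e \<cdot> hop R i 0 v) (of_int m) (a0_exp e v)"
proof -
  have "lin (ser_zpow scal c (\<lambda>v. of_int e \<cdot> hop R i 0 v) m)" for c m
    unfolding ser_zpow_def[abs_def]
    by (rule lin_smult[OF lin_eigen_proj[OF lin_smult[OF linear_h[OF i]] diag_sign[OF h0_diag[OF i] e]]])
  then show ?thesis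
    unfolding zero_modes_def by (subst ser_mult_const) (simp_all add: ser_zpow_def a0_exp_def)
qed

lemma zero_modes_laurent:
  assumes i: "i \<in> {1, 2}" and e: "e \<in> {1, - 1}"
  shows "laurent (zero_modes q l1 R i e)"
  unfolding laurent_def
proof (intro conjI allI)
  note ep = lin_smult[OF linear_h[OF i]] diag_sign[OF h0_diag[OF i] e]
  have "zero_modes q l1 R i e m = (\<lambda>v. (q powi (- e)) powi m \<cdot>
      eigen_proj scal (\<lambda>v. of_int e \<cdot> hop R i 0 v) (of_int m) (a0_exp e v))" for m
    by (simp add: fun_eq_iff zero_modes_eq[OF i e])
  then show "lin (zero_modes q l1 R i e m)" for m
    using lin_smult[OF lin_comp[OF lin_eigen_proj[OF ep] a0_exp_lin[OF e]]] by simp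
  fix v
  let ?p = "\<lambda>\<mu>. eigen_proj scal (\<lambda>v. of_int e \<cdot> hop R i 0 v) \<mu> (a0_exp e v)"
  have "finite (of_int -` {\<mu>. ?p \<mu> \<noteq> 0} :: int set)"
    by (rule finite_vimageI[OF finite_eigen_proj[OF ep]]) (simp add: inj_def)
  moreover have "{m. zero_modes q l1 R i e m v \<noteq> 0} \<subseteq> of_int -` {\<mu>. ?p \<mu> \<noteq> 0}"
    by (auto simp: zero_modes_eq[OF i e])
  ultimately show "finite {m. zero_modes q l1 R i e m v \<noteq> 0}" by (rule finite_subset[rotated])
qed

lemma zero_modes_eigenvector:
  assumes i: "i \<in> {1, 2}" and e: "e \<in> {1, - 1}" and v: "hop R i 0 v = of_int \<mu> \<cdot> v"
  shows "zero_modes q l1 R i e m v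
     = (if m = e * \<mu> then (q powi (- e)) powi (e * \<mu>) \<cdot> a0_exp e v else 0)"
proof -
  have "hop R i 0 (a0_exp e v) = of_int \<mu> \<cdot> a0_exp e v"
    using v by (simp add: a0_exp_hop[OF e i, symmetric] lin_scale[OF a0_exp_lin[OF e]])
  then have "of_int e \<cdot> hop R i 0 (a0_exp e v) = of_int (e * \<mu>) \<cdot> a0_exp e v" by simp
  from eigen_proj_eq[OF lin_smult[OF linear_h[OF i]] eigen_decomp_eigenvector[OF lin_smult[OF linear_h[OF i]] this]]
  show ?thesis by (simp add: zero_modes_eq[OF i e] del: of_int_mult)
qed

lemma shift_eq: "shift R i e = ser_const (shift_op i e)"
  by (simp add: shift_def shift_op_def)

text \<open>
  Reduction of additive statements to eigenvectors of a zero mode. The eigenvalues are integers,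
  hence \<open>z\<close> to the power \<open>h\<^sub>i\<^sub>,\<^sub>0\<close> is a single integral power of \<open>z\<close> on such a vector.
\<close>
lemma h0_eigen_induct:
  assumes i: "i \<in> {1, 2}"
    and add: "\<And>u v. P u \<Longrightarrow> P v \<Longrightarrow> P (u + v)"
    and eigen: "\<And>\<mu> v. hop R i 0 v = of_int \<mu> \<cdot> v \<Longrightarrow> P v"
  shows "P v"
proof -
  obtain f where f: "finite {\<mu>. f \<mu> \<noteq> 0}" "\<And>\<mu>. hop R i 0 (f \<mu>) = \<mu> \<cdot> f \<mu>" "v = Sum_any f"
    using h0_diag[OF i, of v] unfolding eigen_decomp_def by blast
  have P0: "P 0" using eigen[of 0 0] lin_zero[OF linear_h[OF i]] by simp
  have Pf: "P (f \<mu>)" for \<mu>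
  proof (cases "f \<mu> = 0")
    case False
    then obtain k where "\<mu> = of_int k" using h0_integral[OF i f(2)] by (auto elim: Ints_cases)
    then show ?thesis using eigen f(2)[of \<mu>] by simp
  qed (simp add: P0)
  have "P (sum f A)" if "finite A" for A
    using that by (induction A rule: finite_induct) (simp_all add: P0 Pf add)
  then show ?thesis using f by (simp add: Sum_any.expand_set)
qed

end


section \<open>Rearranging sums\<close>

lemma Sum_any_upto: "(\<And>n. n > M \<Longrightarrow> h n = 0) \<Longrightarrow> Sum_any h = (\<Sum>n\<le>M. h (n :: nat))"
  by (rule Sum_any.expand_superset) (auto simp: not_less[symmetric])

lemma Sum_any_sum:
  assumes "finite L" and "\<And>l. l \<in> L \<Longrightarrow> finite {k. h k l \<noteq> 0}"
  shows "Sum_any (\<lambda>k. \<Sum>l\<in>L. h k l) = (\<Sum>l\<in>L. Sum_any (\<lambda>k. h k l))"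
  using assms
proof (induction L rule: finite_induct)
  case empty
  then show ?case by simp
next
  case (insert l L)
  have "finite {k. (\<Sum>l\<in>L. h k l) \<noteq> 0}"
  proof (rule finite_subset)
    show "{k. (\<Sum>l\<in>L. h k l) \<noteq> 0} \<subseteq> (\<Union>l\<in>L. {k. h k l \<noteq> 0})"
      by (auto elim: sum.not_neutral_contains_not_neutral)
  qed (use insert in auto)
  then show ?case using insert by (simp add: Sum_any.distrib)
qed

lemma Sum_any_int_split:
  assumes fin: "finite {k. h k \<noteq> 0}"
  shows "Sum_any h = Sum_any (\<lambda>n. h (int n)) + Sum_any (\<lambda>n. h (- 1 - int n))"
proof -
  let ?p = "\<lambda>k. if k \<ge> 0 then h k else 0" and ?n = "\<lambda>k. if k < 0 then h k else 0"
  have "Sum_any h = Sum_any (\<lambda>k. ?p k + ?n k)"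
    by (rule Sum_any.cong) auto
  also have "\<dots> = Sum_any ?p + Sum_any ?n"
    by (rule Sum_any.distrib; rule finite_subset[OF _ fin]) auto
  also have "Sum_any ?p = Sum_any (\<lambda>n. ?p (int n))"
  proof (rule Sum_any_reindex_inj)
    fix k assume "k \<notin> range int"
    then have "\<not> k \<ge> 0" by (metis int_nat_eq rangeI)
    then show "?p k = 0" by simp
  qed (simp add: inj_def)
  also have "Sum_any ?n = Sum_any (\<lambda>n. ?n (- 1 - int n))"
  proof (rule Sum_any_reindex_inj)
    fix k assume k: "k \<notin> range (\<lambda>n. - 1 - int n)"
    have "k = - 1 - int (nat (- 1 - k))" if "k < 0" using that by simp
    then have "\<not> k < 0" using k by blast
    then show "?n k = 0" by simp
  qed (simp add: inj_def)
  finally show ?thesis by simp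
qed

context complex_space
begin

text \<open>
  Multiplication by two power series in the same variable, one after the other, is multiplication
  by their product. Here \<open>\<Phi> n\<close> is the coefficient that the power \<open>n\<close> of the variable reaches.
\<close>
lemma Sum_any_convolution:
  assumes \<Phi>: "\<And>n. n > M \<Longrightarrow> \<Phi> n = 0"
  shows "Sum_any (\<lambda>t. fps_nth f t *\<^sub>s Sum_any (\<lambda>s. fps_nth g s *\<^sub>s \<Phi> (t + s)))
    = Sum_any (\<lambda>n. fps_nth (f * g) n *\<^sub>s \<Phi> n)"
proof -
  have "Sum_any (\<lambda>t. fps_nth f t *\<^sub>s Sum_any (\<lambda>s. fps_nth g s *\<^sub>s \<Phi> (t + s)))
    = Sum_any (\<lambda>t. fps_nth f t *\<^sub>s (\<Sum>s\<le>M. fps_nth g s *\<^sub>s \<Phi> (t + s)))"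
    by (rule Sum_any.cong, subst Sum_any_upto[of M]) (simp_all add: \<Phi>)
  also have "\<dots> = (\<Sum>t\<le>M. \<Sum>s\<le>M. (fps_nth f t * fps_nth g s) *\<^sub>s \<Phi> (t + s))"
    by (subst Sum_any_upto[of M]) (simp_all add: \<Phi> scale_sum_right)
  also have "\<dots> = (\<Sum>(t, s)\<in>{..M} \<times> {..M}. (fps_nth f t * fps_nth g s) *\<^sub>s \<Phi> (t + s))"
    by (rule sum.cartesian_product)
  also have "\<dots> = (\<Sum>(t, s)\<in>{(t, s). t + s \<le> M}. (fps_nth f t * fps_nth g s) *\<^sub>s \<Phi> (t + s))"
    by (rule sum.mono_neutral_right) (auto intro!: \<Phi>)
  also have "\<dots> = (\<Sum>n\<le>M. \<Sum>t\<le>n. (fps_nth f t * fps_nth g (n - t)) *\<^sub>s \<Phi> (t + (n - t)))"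
    by (rule sum.triangle_reindex_eq)
  also have "\<dots> = (\<Sum>n\<le>M. fps_nth (f * g) n *\<^sub>s \<Phi> n)"
    by (simp add: fps_mult_nth scale_sum_left atLeast0AtMost)
  also have "\<dots> = Sum_any (\<lambda>n. fps_nth (f * g) n *\<^sub>s \<Phi> n)"
    by (rule Sum_any_upto[symmetric]) (simp add: \<Phi>)
  finally show ?thesis .
qed

lemma Sum_any_geometric_quadratic:
  assumes \<Phi>: "\<And>n. n > M \<Longrightarrow> \<Phi> n = 0"
  shows "Sum_any (\<lambda>n. fps_nth ((1 - fps_const \<alpha> * fps_X) * (1 - fps_const \<beta> * fps_X) * Abs_fps (\<lambda>n. \<xi> ^ n)) n *\<^sub>s \<Phi> n)
    = Sum_any (\<lambda>n. \<xi> ^ n *\<^sub>s \<Phi> n) - (\<alpha> + \<beta>) *\<^sub>s Sum_any (\<lambda>n. \<xi> ^ n *\<^sub>s \<Phi> (1 + n))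
      + (\<alpha> * \<beta>) *\<^sub>s Sum_any (\<lambda>n. \<xi> ^ n *\<^sub>s \<Phi> (2 + n))"
proof -
  let ?P = "(1 - fps_const \<alpha> * fps_X) * (1 - fps_const \<beta> * fps_X)"
  have P: "?P = 1 - fps_const (\<alpha> + \<beta>) * fps_X + fps_const (\<alpha> * \<beta>) * fps_X ^ 2"
    by (simp add: algebra_simps power2_eq_square flip: fps_const_add fps_const_mult)
  have nth: "fps_nth ?P 0 = 1" "fps_nth ?P 1 = - (\<alpha> + \<beta>)" "fps_nth ?P 2 = \<alpha> * \<beta>" "\<And>t. t > 2 \<Longrightarrow> fps_nth ?P t = 0"
    unfolding P by (simp_all add: fps_X_power_iff)
  have "Sum_any (\<lambda>n. fps_nth (?P * Abs_fps (\<lambda>n. \<xi> ^ n)) n *\<^sub>s \<Phi> n)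
    = Sum_any (\<lambda>t. fps_nth ?P t *\<^sub>s Sum_any (\<lambda>n. \<xi> ^ n *\<^sub>s \<Phi> (t + n)))"
    using Sum_any_convolution[of M \<Phi> ?P "Abs_fps (\<lambda>n. \<xi> ^ n)"] \<Phi> by simp
  also have "\<dots> = (\<Sum>t\<le>2. fps_nth ?P t *\<^sub>s Sum_any (\<lambda>n. \<xi> ^ n *\<^sub>s \<Phi> (t + n)))"
    by (rule Sum_any_upto) (simp add: nth)
  also have "{..2::nat} = {0, 1, 2}" by auto
  finally show ?thesis
    by (simp add: nth[unfolded One_nat_def] scale_left_diff_distrib scale_left_distrib)
qed

text \<open>
  The coefficients of \<open>(w/z)\<^sup>n\<close> for all integers \<open>n\<close> make up \<open>\<delta>(\<xi> w/z)\<close>. Those with \<open>n > k\<close> come from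
  the expansion of \<open>\<xi> x / (1 - \<xi> x)\<close> in \<open>x = w/z\<close>, shifted by \<open>k\<close>, and those with \<open>n \<le> k\<close> from the expansion
  of \<open>1 / (1 - (\<xi> x)\<^sup>-\<^sup>1)\<close> in \<open>x\<^sup>-\<^sup>1\<close>. The function \<open>F\<close> lists the coefficients of an operator series
  along an antidiagonal.
\<close>
lemma Sum_any_delta:
  assumes fin: "finite {n. F n \<noteq> 0}" and \<xi>: "\<xi> \<noteq> 0"
  shows "\<xi> *\<^sub>s Sum_any (\<lambda>t. \<xi> ^ t *\<^sub>s F (int t + k + 1)) + Sum_any (\<lambda>t. inverse \<xi> ^ t *\<^sub>s F (k - int t))
    = \<xi> powi (- k) *\<^sub>s Sum_any (\<lambda>n. \<xi> powi n *\<^sub>s F n)"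
proof -
  let ?G = "\<lambda>n. \<xi> powi n *\<^sub>s F n"
  have finG: "finite {n. ?G n \<noteq> 0}" by (rule finite_subset[OF _ fin]) auto
  have bij: "bij (\<lambda>m. m + 1 + k)" for k :: int
    by (rule bij_betw_byWitness[of _ "\<lambda>n. n - 1 - k"]) auto
  let ?H = "\<lambda>m. \<xi> powi (- k) *\<^sub>s ?G (m + 1 + k)"
  have finH: "finite {m. ?H m \<noteq> 0}"
  proof (rule finite_subset)
    show "{m. ?H m \<noteq> 0} \<subseteq> (\<lambda>m. m + 1 + k) -` {n. ?G n \<noteq> 0}" by auto
    show "finite ((\<lambda>m. m + 1 + k) -` {n. ?G n \<noteq> 0})"
      by (rule finite_vimageI[OF finG]) (simp add: inj_def)
  qed
  have H: "?H m = \<xi> powi (m + 1) *\<^sub>s F (m + 1 + k)" for m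
    using \<xi> by (simp add: power_int_add[symmetric])
  have "\<xi> powi (- k) *\<^sub>s Sum_any ?G = Sum_any (\<lambda>n. \<xi> powi (- k) *\<^sub>s ?G n)"
    by (rule lin_Sum_any[OF lin_smult[OF lin_id] finG])
  also have "\<dots> = Sum_any ?H"
    by (rule Sum_any.reindex_cong[OF bij[of k]]) (simp add: comp_def)
  also have "\<dots> = Sum_any (\<lambda>n. ?H (int n)) + Sum_any (\<lambda>n. ?H (- 1 - int n))"
    by (rule Sum_any_int_split[OF finH])
  also have "Sum_any (\<lambda>n. ?H (- 1 - int n)) = Sum_any (\<lambda>t. inverse \<xi> ^ t *\<^sub>s F (k - int t))"
    unfolding H by (rule Sum_any.cong) (simp add: power_int_minus power_inverse)
  also have "Sum_any (\<lambda>n. ?H (int n)) = Sum_any (\<lambda>t. \<xi> *\<^sub>s \<xi> ^ t *\<^sub>s F (int t + k + 1))"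
    unfolding H using \<xi> by (intro Sum_any.cong) (simp add: power_int_add algebra_simps)
  also have "\<dots> = \<xi> *\<^sub>s Sum_any (\<lambda>t. \<xi> ^ t *\<^sub>s F (int t + k + 1))"
  proof (rule lin_Sum_any[OF lin_smult[OF lin_id], symmetric])
    have "finite ((\<lambda>t. int t + k + 1) -` {n. F n \<noteq> 0})"
      by (rule finite_vimageI[OF fin]) (simp add: inj_def)
    then show "finite {t. \<xi> ^ t *\<^sub>s F (int t + k + 1) \<noteq> 0}"
      by (rule rev_finite_subset) auto
  qed
  finally show ?thesis ..
qed

lemma ser_mult_sum_right:
  fixes A B C :: "'v opser"
  assumes C: "\<And>m. lin (C m)" and "finite L"
    and B: "\<And>m. B m v = (\<Sum>l\<in>L. A (m + h l) (y l))"
    and fin: "\<And>m l. finite {k. C k (A (m - k) (y l)) \<noteq> 0}"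
  shows "(C \<odot> B) m v = (\<Sum>l\<in>L. (C \<odot> A) (m + h l) (y l))"
proof -
  have "(C \<odot> B) m v = Sum_any (\<lambda>k. \<Sum>l\<in>L. C k (A (m + h l - k) (y l)))"
    unfolding ser_mult_def B
    by (rule Sum_any.cong) (simp add: lin_sum[OF C] algebra_simps)
  also have "\<dots> = (\<Sum>l\<in>L. (C \<odot> A) (m + h l) (y l))"
    unfolding ser_mult_def by (rule Sum_any_sum[OF \<open>finite L\<close> fin])
  finally show ?thesis .
qed

end

lemma smult2_at_w_over_z:
  assumes "\<And>v. s 0 v = 0"
  shows "smult2 s (at_w_over_z g) X a b v
     = Sum_any (\<lambda>t. s (fps_nth g t) (X (a + int t) (b - int t) v))"
proof -
  have "smult2 s (at_w_over_z g) X a b v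
    = Sum_any (\<lambda>t. (case (- int t, int t) of (k, l) \<Rightarrow> s (at_w_over_z g k l) (X (a - k) (b - l) v)))"
    unfolding smult2_def
  proof (rule Sum_any_reindex_inj)
    fix kl :: "int \<times> int"
    assume kl: "kl \<notin> range (\<lambda>t. (- int t, int t))"
    obtain k l where "kl = (k, l)" by (cases kl)
    moreover have "(k, l) = (- int (nat l), int (nat l))" if "l \<ge> 0" "k = - l" using that by simp
    ultimately have "\<not> (l \<ge> 0 \<and> k = - l)" using kl by blast
    then show "(case kl of (k, l) \<Rightarrow> s (at_w_over_z g k l) (X (a - k) (b - l) v)) = 0"
      using assms \<open>kl = (k, l)\<close> by (auto simp: at_w_over_z_def)
  qed (simp add: inj_def)
  then show ?thesis by (simp add: at_w_over_z_def)
qed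

lemma smult2_at_z_over_w:
  assumes "\<And>v. s 0 v = 0"
  shows "smult2 s (at_z_over_w g) X a b v
     = Sum_any (\<lambda>t. s (fps_nth g t) (X (a - int t) (b + int t) v))"
proof -
  have "smult2 s (at_z_over_w g) X a b v
    = Sum_any (\<lambda>t. (case (int t, - int t) of (k, l) \<Rightarrow> s (at_z_over_w g k l) (X (a - k) (b - l) v)))"
    unfolding smult2_def
  proof (rule Sum_any_reindex_inj)
    fix kl :: "int \<times> int"
    assume kl: "kl \<notin> range (\<lambda>t. (int t, - int t))"
    obtain k l where "kl = (k, l)" by (cases kl)
    moreover have "(k, l) = (int (nat k), - int (nat k))" if "k \<ge> 0" "l = - k" using that by simp
    ultimately have "\<not> (k \<ge> 0 \<and> l = - k)" using kl by blast
    then show "(case kl of (k, l) \<Rightarrow> s (at_z_over_w g k l) (X (a - k) (b - l) v)) = 0"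
      using assms \<open>kl = (k, l)\<close> by (auto simp: at_z_over_w_def)
  qed (simp add: inj_def)
  then show ?thesis by (simp add: at_z_over_w_def)
qed

text \<open>
  The series \<open>w\<^sup>-\<^sup>1 A(w)\<close> has no powers of \<open>z\<close>, so only one coefficient of \<open>\<delta>(\<xi> w/z)\<close> contributes to
  \<open>z\<^sup>a w\<^sup>b\<close>.
\<close>
lemma smult2_delta:
  assumes "\<And>v. s 0 v = 0" "\<And>c. s c 0 = 0"
  shows "smult2 s (delta_w_over_z \<xi>) (winv_ser A) a b v = s (\<xi> powi (- a)) (A (a + b + 1) v)"
proof -
  have "smult2 s (delta_w_over_z \<xi>) (winv_ser A) a b v
    = Sum_any (\<lambda>kl. if kl = (a, - a) then s (\<xi> powi (- a)) (A (a + b + 1) v) else 0)"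
    unfolding smult2_def
    by (rule Sum_any.cong)
       (auto simp: delta_w_over_z_def winv_ser_def assms algebra_simps split: if_splits prod.splits)
  then show ?thesis by simp
qed


section \<open>Products of currents\<close>

context heisenberg_module
begin

lemma Lam_tail_laurent:
  assumes "i \<in> {1, 2}" "e \<in> {1, - 1}"
  shows "laurent (annihilation q R i e \<odot> shift R i e \<odot> zero_modes q l1 R i e)"
  unfolding shift_eq
  by (intro laurent_mult annihilation_laurent laurent_const shift_op_lin zero_modes_laurent assms)

lemma Lam_bounded_below:
  assumes "i \<in> {1, 2}" "e \<in> {1, - 1}"
  shows "bounded_below (Lam q l1 R i e)"
  unfolding Lam_def
  by (intro bounded_below_mult laurent_imp_bounded_below Lam_tail_laurent cre_lin cre_neg assms)

lemma Lam_lin: "i \<in> {1, 2} \<Longrightarrow> e \<in> {1, - 1} \<Longrightarrow> lin (Lam q l1 R i e m)"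
  by (rule bounded_belowD[OF Lam_bounded_below])

lemma Lam_pair_lin:
  assumes "i \<in> {1, 2}" "e \<in> {1, - 1}" "j \<in> {1, 2}" "e' \<in> {1, - 1}"
  shows "lin (Lam_pair q l1 R \<xi> i e j e' m)"
  unfolding Lam_pair_def shift_eq
  by (intro bounded_belowD[OF bounded_below_mult] bounded_below_mult laurent_imp_bounded_below
      laurent_mult laurent_rescale annihilation_laurent laurent_const shift_op_lin zero_modes_laurent
      cre_lin cre_neg rescale_lin assms) (simp_all add: ser_rescale_def cre_neg[OF assms(1)])

lemma shift_a0_ann: "i \<in> {1, 2} \<Longrightarrow> e \<in> {1, - 1} \<Longrightarrow> j \<in> {1, 2} \<Longrightarrow>
    shift_a0 i e (ann j e' n v) = ann j e' n (shift_a0 i e v)"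
  by (rule ann_commute_op) (simp_all add: shift_a0_lin shift_a0_hop del: insert_iff)

lemma shift_a0_cre: "i \<in> {1, 2} \<Longrightarrow> e \<in> {1, - 1} \<Longrightarrow> j \<in> {1, 2} \<Longrightarrow>
    shift_a0 i e (cre j e' n v) = cre j e' n (shift_a0 i e v)"
  by (rule cre_commute_op) (simp_all add: shift_a0_lin shift_a0_hop del: insert_iff)

lemma killed_above_shift_a0: "killed_above M v \<Longrightarrow> i \<in> {1, 2} \<Longrightarrow> e \<in> {1, - 1} \<Longrightarrow> killed_above M (shift_a0 i e v)"
  by (rule killed_above_commute_op) (simp_all add: shift_a0_lin shift_a0_hop del: insert_iff)

lemma hop0_ann: "i \<in> {1, 2} \<Longrightarrow> j \<in> {1, 2} \<Longrightarrow> hop R i 0 (ann j e n v) = ann j e n (hop R i 0 v)"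
  by (rule ann_commute_op) (simp_all add: linear_h hop0_commute del: insert_iff)

lemma hop0_cre: "i \<in> {1, 2} \<Longrightarrow> j \<in> {1, 2} \<Longrightarrow> hop R i 0 (cre j e n v) = cre j e n (hop R i 0 v)"
  by (rule cre_commute_op) (simp_all add: linear_h hop0_commute del: insert_iff)

text \<open>
  On an eigenvector the zero modes contribute the monomial \<open>(q\<^bsup>-e\<^esup> z)\<^bsup>e \<mu>\<^esup>\<close>, which shifts the degree by
  \<open>e \<mu>\<close>. What remains is a creation series times a polynomial in \<open>z\<^sup>-\<^sup>1\<close>.
\<close>
lemma Lam_eigenvector:
  assumes i: "i \<in> {1, 2}" and e: "e \<in> {1, - 1}" and v: "hop R i 0 v = of_int \<mu> \<cdot> v"
    and N: "killed_above (int N) (shift_a0 i e v)"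
  shows "Lam q l1 R i e m v = (q powi (- e)) powi (e * \<mu>) \<cdot>
     (\<Sum>l\<le>N. cre i e (m - e * \<mu> + int l) (ann i e l (shift_a0 i e v)))"
proof -
  let ?c = "(q powi (- e)) powi (e * \<mu>)"
  have "(annihilation q R i e \<odot> shift R i e \<odot> zero_modes q l1 R i e) m' v
      = annihilation q R i e (m' - e * \<mu>) (?c \<cdot> shift_a0 i e v)" for m'
    by (rule ser_mult_monomial)
       (simp_all add: shift_eq ser_const_mult zero_modes_eigenvector[OF i e v] shift_a0_def
          lin_zero[OF shift_op_lin[OF i e]] lin_scale[OF shift_op_lin[OF i e]] annihilation_lin[OF i])
  then have "Lam q l1 R i e m v = (cre i e \<odot> annihilation q R i e) (m - e * \<mu>) (?c \<cdot> shift_a0 i e v)"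
    unfolding Lam_def by (rule ser_mult_translate)
  also have "\<dots> = (\<Sum>l\<le>N. cre i e (m - e * \<mu> + int l) (annihilation q R i e (- int l) (?c \<cdot> shift_a0 i e v)))"
  proof (rule ser_mult_polynomial[where A = "annihilation q R i e", OF cre_lin[OF i] annihilation_pos[OF i]])
    fix m assume m: "m < - int N"
    have "ann i e (nat (- m)) (?c \<cdot> shift_a0 i e v) = 0"
      by (rule ann_zero[OF killed_above_smult[OF N] i]) (use m in auto)
    then show "annihilation q R i e m (?c \<cdot> shift_a0 i e v) = 0" using m by (simp add: ann_def)
  qed
  finally show ?thesis
    by (simp add: lin_scale[OF annihilation_lin[OF i]] lin_scale[OF cre_lin[OF i]] scale_sum_right ann_def)
qed

text \<open>
  The coefficient of \<open>z\<^sup>p w\<^sup>r\<close> in \<open>C\<^sub>i(z) C\<^sub>j(w) A\<^sub>i(z) A\<^sub>j(w) u\<close>, with the creation parts \<open>C\<close> and the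
  annihilation parts \<open>A\<close>. The truncation at \<open>N\<close> is exact if \<open>killed_above (int N) u\<close>. Because it is
  a finite sum, it may be shifted and rearranged freely.
\<close>
definition normal_ordered :: "nat \<Rightarrow> nat \<Rightarrow> int \<Rightarrow> nat \<Rightarrow> int \<Rightarrow> 'v \<Rightarrow> int \<Rightarrow> int \<Rightarrow> 'v" where
  "normal_ordered N i e j e' u p r = (\<Sum>l\<le>N. \<Sum>l'\<le>N.
     cre i e (p + int l) (cre j e' (r + int l') (ann i e l (ann j e' l' u))))"

lemma normal_ordered_zero:
  assumes "i \<in> {1, 2}" "j \<in> {1, 2}" "p < - int N \<or> r < - int N"
  shows "normal_ordered N i e j e' u p r = 0"
  using assms(3) unfolding normal_ordered_def
  by (intro sum.neutral ballI)
     (auto simp: cre_neg[OF assms(1)] cre_neg[OF assms(2)] lin_zero[OF cre_lin[OF assms(1)]])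

text \<open>
  Modes of the same sign of the degree commute, so the order of the two currents does not matter
  in a normally ordered product.
\<close>
lemma normal_ordered_swap:
  assumes "i \<in> {1, 2}" "j \<in> {1, 2}"
  shows "normal_ordered N i e j e' u p r = normal_ordered N j e' i e u r p"
  unfolding normal_ordered_def by (subst sum.swap)
    (intro sum.cong refl, metis cre_commute[OF assms] ann_commute[OF assms])

lemma normal_ordered_finite_support:
  assumes "i \<in> {1, 2}" "j \<in> {1, 2}"
  shows "finite {n. normal_ordered N i e j e' u (p + n) (r - n) \<noteq> 0}"
proof (rule finite_subset)
  show "{n. normal_ordered N i e j e' u (p + n) (r - n) \<noteq> 0} \<subseteq> {- int N - p..r + int N}"
  proof
    fix n assume "n \<in> {n. normal_ordered N i e j e' u (p + n) (r - n) \<noteq> 0}"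
    then have "\<not> (p + n < - int N \<or> r - n < - int N)"
      using normal_ordered_zero[OF assms] by blast
    then show "n \<in> {- int N - p..r + int N}" by auto
  qed
qed simp

text \<open>
  The specialization \<open>z = \<xi> w\<close>: the coefficient of \<open>w\<^sup>m\<close> collects the coefficients of all \<open>z\<^sup>p w\<^bsup>m-p\<^esup>\<close>,
  with weight \<open>\<xi>\<^sup>p\<close>. The proof expands the products from the right, where the annihilation parts
  give polynomials.
\<close>
lemma Lam_pair_tail:
  assumes i: "i \<in> {1, 2}" and j: "j \<in> {1, 2}" and \<xi>: "\<xi> \<noteq> 0" and N: "killed_above (int N) u"
  shows "(ser_rescale scal \<xi> (cre i e) \<odot> cre j e'
      \<odot> ser_rescale scal \<xi> (annihilation q R i e) \<odot> annihilation q R j e') m u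
    = Sum_any (\<lambda>p. \<xi> powi p \<cdot> normal_ordered N i e j e' u p (m - p))"
proof -
  let ?rC = "ser_rescale scal \<xi> (cre i e)" and ?C = "cre j e'"
  let ?rA = "ser_rescale scal \<xi> (annihilation q R i e)" and ?A = "annihilation q R j e'"
  note rA = laurent_rescale[OF annihilation_laurent[OF i, of e], of \<xi>]
  have AA: "(?rA \<odot> ?A) m u = (\<Sum>l'\<le>N. ?rA (m + int l') (ann j e' l' u))" for m
    unfolding ann_def
  proof (rule ser_mult_polynomial[where A = ?A, OF laurentD(1)[OF rA] annihilation_pos[OF j]])
    fix m assume m: "m < - int N"
    have "ann j e' (nat (- m)) u = 0"
      by (rule ann_zero[OF N j]) (use m in auto)
    then show "?A m u = 0" using m by (simp add: ann_def)
  qed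
  have CA: "(?C \<odot> ?rA \<odot> ?A) m u = (\<Sum>l'\<le>N. (?C \<odot> ?rA) (m + int l') (ann j e' l' u))" for m
    by (rule ser_mult_sum_right[where C = ?C and A = ?rA and B = "?rA \<odot> ?A" and h = int
          and y = "\<lambda>l'. ann j e' l' u" and L = "{..N}"])
       (simp_all add: AA cre_lin[OF j] finite_ser_mult_support[of ?C ?rA, OF cre_lin[OF j] laurentD(2)[OF rA]])
  have CrA: "(?C \<odot> ?rA) m (ann j e' l' u) = (\<Sum>l\<le>N. ?C (m + int l) (\<xi> powi (- int l) \<cdot> ann i e l (ann j e' l' u)))" for m l'
  proof -
    have "(?C \<odot> ?rA) m (ann j e' l' u) = (\<Sum>l\<le>N. ?C (m + int l) (?rA (- int l) (ann j e' l' u)))"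
    proof (rule ser_mult_polynomial[OF cre_lin[OF j]])
      fix m
      show "?rA m (ann j e' l' u) = 0" if "m > 0"
        using that by (simp add: ser_rescale_def annihilation_pos[OF i])
      show "?rA m (ann j e' l' u) = 0" if "m < - int N"
        using that ann_ann_zero[OF N i j, of "nat (- m)" e e' l'] by (simp add: ser_rescale_def ann_def)
    qed
    then show ?thesis by (simp add: ser_rescale_def ann_def)
  qed
  let ?w = "\<lambda>l l'. ann i e l (ann j e' l' u)"
  let ?y = "\<lambda>(l, l'). \<xi> powi (- int l) \<cdot> ?w l l'"
  let ?L = "{..N} \<times> {..N}"
  have "(?C \<odot> ?rA \<odot> ?A) m u = (\<Sum>l'\<le>N. \<Sum>l\<le>N. ?C (m + int l' + int l) (\<xi> powi (- int l) \<cdot> ?w l l'))" for m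
    unfolding CA CrA ..
  also have "\<dots> m = (\<Sum>ll\<in>?L. ?C (m + int (fst ll + snd ll)) (?y ll))" for m
    by (subst sum.swap) (simp add: sum.cartesian_product split_def algebra_simps)
  finally have tail: "\<And>m. (?C \<odot> ?rA \<odot> ?A) m u = (\<Sum>ll\<in>?L. ?C (m + int (fst ll + snd ll)) (?y ll))" .
  have fin: "finite {k. ?rC k (?C (m - k) y) \<noteq> 0}" for m y
  proof (rule finite_subset)
    show "{k. ?rC k (?C (m - k) y) \<noteq> 0} \<subseteq> {0..m}"
    proof
      fix k assume k: "k \<in> {k. ?rC k (?C (m - k) y) \<noteq> 0}"
      have "\<not> k < 0" using k cre_neg[OF i] by (auto simp: ser_rescale_def)
      moreover have "\<not> m - k < 0"
        using k cre_neg[OF j, of "m - k" e' y] lin_zero[OF cre_lin[OF i]] by (auto simp: ser_rescale_def)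
      ultimately show "k \<in> {0..m}" by auto
    qed
  qed simp
  have "(?rC \<odot> ?C \<odot> ?rA \<odot> ?A) m u = (\<Sum>ll\<in>?L. (?rC \<odot> ?C) (m + int (fst ll + snd ll)) (?y ll))"
    by (rule ser_mult_sum_right[where C = ?rC and A = ?C and B = "?C \<odot> ?rA \<odot> ?A"
          and h = "\<lambda>ll. int (fst ll + snd ll)" and y = ?y and L = ?L])
       (use tail fin rescale_lin[OF cre_lin[OF i]] in simp_all)
  also have "\<dots> = (\<Sum>ll\<in>?L. Sum_any (\<lambda>p. \<xi> powi p \<cdot>
      (case ll of (l, l') \<Rightarrow> cre i e (p + int l) (cre j e' (m - p + int l') (?w l l')))))"
  proof (rule sum.cong[OF refl])
    fix ll :: "nat \<times> nat"
    obtain l l' where ll: "ll = (l, l')" by (cases ll)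
    have bij: "bij (\<lambda>p. p + int l)"
      by (rule bij_betw_byWitness[of _ "\<lambda>n. n - int l"]) auto
    have "(?rC \<odot> ?C) (m + int (l + l')) (?y (l, l'))
      = Sum_any (\<lambda>p. ?rC (p + int l) (?C (m + int (l + l') - (p + int l)) (?y (l, l'))))"
      unfolding ser_mult_def by (rule Sum_any.reindex_cong[OF bij]) (simp add: comp_def)
    also have "\<dots> = Sum_any (\<lambda>p. \<xi> powi p \<cdot>
      cre i e (p + int l) (cre j e' (m - p + int l') (?w l l')))"
      by (rule Sum_any.cong)
         (simp add: ser_rescale_def lin_scale[OF cre_lin[OF i]] lin_scale[OF cre_lin[OF j]]
            power_int_add power_int_minus \<xi> algebra_simps)
    finally show "(?rC \<odot> ?C) (m + int (fst ll + snd ll)) (?y ll) = Sum_any (\<lambda>p. \<xi> powi p \<cdot>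
      (case ll of (l, l') \<Rightarrow> cre i e (p + int l) (cre j e' (m - p + int l') (?w l l'))))"
      by (simp only: ll fst_conv snd_conv prod.case)
  qed
  also have "\<dots> = Sum_any (\<lambda>p. \<Sum>ll\<in>?L. \<xi> powi p \<cdot>
      (case ll of (l, l') \<Rightarrow> cre i e (p + int l) (cre j e' (m - p + int l') (?w l l'))))"
  proof (rule Sum_any_sum[symmetric])
    show "finite ?L" by simp
    fix ll :: "nat \<times> nat"
    obtain l l' where ll: "ll = (l, l')" by (cases ll)
    have "finite {p. \<xi> powi p \<cdot> cre i e (p + int l) (cre j e' (m - p + int l') (?w l l')) \<noteq> 0}"
    proof (rule finite_subset)
      show "{p. \<xi> powi p \<cdot> cre i e (p + int l) (cre j e' (m - p + int l') (?w l l')) \<noteq> 0} \<subseteq> {- int l..m + int l'}"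
      proof
        fix p assume p: "p \<in> {p. \<xi> powi p \<cdot> cre i e (p + int l) (cre j e' (m - p + int l') (?w l l')) \<noteq> 0}"
        have "\<not> p + int l < 0" using p cre_neg[OF i] by auto
        moreover have "\<not> m - p + int l' < 0"
          using p cre_neg[OF j, of "m - p + int l'" e'] lin_zero[OF cre_lin[OF i]] by auto
        ultimately show "p \<in> {- int l..m + int l'}" by auto
      qed
    qed simp
    then show "finite {p. \<xi> powi p \<cdot>
        (case ll of (l, l') \<Rightarrow> cre i e (p + int l) (cre j e' (m - p + int l') (?w l l'))) \<noteq> 0}"
      by (simp add: ll)
  qed
  also have "\<dots> = Sum_any (\<lambda>p. \<xi> powi p \<cdot> normal_ordered N i e j e' u p (m - p))"
    by (rule Sum_any.cong) (simp add: normal_ordered_def sum.cartesian_product scale_sum_right split_def)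
  finally show ?thesis .
qed

text \<open>
  Of the eight factors of \<open>Lam_pair\<close>, the zero modes contribute a monomial and the shifts move to
  the right of the annihilation parts; then \<open>Lam_pair_tail\<close> applies.
\<close>
lemma Lam_pair_eigenvector:
  assumes i: "i \<in> {1, 2}" and j: "j \<in> {1, 2}" and e: "e \<in> {1, - 1}" and e': "e' \<in> {1, - 1}"
    and \<xi>: "\<xi> \<noteq> 0" and v: "hop R i 0 v = of_int \<mu> \<cdot> v" "hop R j 0 v = of_int \<nu> \<cdot> v"
    and N: "killed_above (int N) v"
  shows "Lam_pair q l1 R \<xi> i e j e' m v
    = (\<xi> powi (e * \<mu>) * (q powi (- e)) powi (e * \<mu>) * (q powi (- e')) powi (e' * \<nu>)) \<cdot>
      Sum_any (\<lambda>p. \<xi> powi p \<cdot> normal_ordered N i e j e' (shift_a0 i e (shift_a0 j e' v)) p (m - e * \<mu> - e' * \<nu> - p))"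
proof -
  let ?rC = "ser_rescale scal \<xi> (cre i e)" and ?C = "cre j e'"
  let ?rA = "ser_rescale scal \<xi> (annihilation q R i e)" and ?A = "annihilation q R j e'"
  let ?rZ = "ser_rescale scal \<xi> (zero_modes q l1 R i e)" and ?Z = "zero_modes q l1 R j e'"
  let ?ci = "(q powi (- e)) powi (e * \<mu>)" and ?cj = "(q powi (- e')) powi (e' * \<nu>)"
  let ?m0 = "e * \<mu> + e' * \<nu>" and ?c = "\<xi> powi (e * \<mu>) * ?ci * ?cj"
  let ?u = "shift_a0 i e (shift_a0 j e' v)"
  note rA = laurent_rescale[OF annihilation_laurent[OF i, of e], of \<xi>]
  note rZ = laurent_rescale[OF zero_modes_laurent[OF i e], of \<xi>]
  note A = annihilation_laurent[OF j, of e'] and Z = zero_modes_laurent[OF j e']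
  have "hop R i 0 (?cj \<cdot> a0_exp e' v) = of_int \<mu> \<cdot> (?cj \<cdot> a0_exp e' v)"
    using v(1) by (simp add: lin_scale[OF linear_h[OF i]] lin_scale[OF a0_exp_lin[OF e']] flip: a0_exp_hop[OF e' i])
  note zi = zero_modes_eigenvector[OF i e this]
  have "(?rZ \<odot> ?Z) m v = ?rZ (m - e' * \<nu>) (?cj \<cdot> a0_exp e' v)" for m
    by (rule ser_mult_monomial) (simp_all add: zero_modes_eigenvector[OF j e' v(2)] laurentD(1)[OF rZ])
  then have rZZ: "(?rZ \<odot> ?Z) m v = \<xi> powi (m - e' * \<nu>) \<cdot>
      (if m - e' * \<nu> = e * \<mu> then ?ci \<cdot> a0_exp e (?cj \<cdot> a0_exp e' v) else 0)" for m
    by (simp only: ser_rescale_def zi)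
  have ZZ: "(?rZ \<odot> ?Z) m v = (if m = ?m0 then ?c \<cdot> a0_exp e (a0_exp e' v) else 0)" for m
  proof (cases "m = ?m0")
    case True
    then have "m - e' * \<nu> = e * \<mu>" by simp
    then show ?thesis
      using True by (simp only: rZZ if_True simp_thms lin_scale[OF a0_exp_lin[OF e]] scale_scale mult.assoc)
  next
    case False
    then have "m - e' * \<nu> \<noteq> e * \<mu>" by linarith
    then show ?thesis using False by (simp only: rZZ if_False simp_thms scale_zero_right)
  qed
  have "(?A \<odot> ?rZ \<odot> ?Z) m v = ?A (m - ?m0) (?c \<cdot> a0_exp e (a0_exp e' v))" for m
    by (rule ser_mult_monomial[where B = "?rZ \<odot> ?Z" and A = ?A and ?m0.0 = ?m0
          and w = "?c \<cdot> a0_exp e (a0_exp e' v)"]) (simp_all only: ZZ laurentD(1)[OF A])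
  then have AZ: "(?rA \<odot> ?A \<odot> ?rZ \<odot> ?Z) m v = (?rA \<odot> ?A) (m - ?m0) (?c \<cdot> a0_exp e (a0_exp e' v))" for m
    by (rule ser_mult_translate)
  have "shift_op i e (shift_op j e' ((?rA \<odot> ?A) m w)) = (?rA \<odot> ?A) m (shift_op i e (shift_op j e' w))" for m w
  proof (rule ser_mult_commute_op[of "\<lambda>w. shift_op i e (shift_op j e' w)", OF lin_comp[OF shift_op_lin[OF i e] shift_op_lin[OF j e']]])
    have S_ann: "shift_op i e (shift_op j e' (ann k e'' n w)) = ann k e'' n (shift_op i e (shift_op j e' w))" if "k \<in> {1, 2}" for k e'' n w
      by (rule ann_commute_op[of k "\<lambda>w. shift_op i e (shift_op j e' w)", OF that lin_comp[OF shift_op_lin[OF i e] shift_op_lin[OF j e']]])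
         (simp add: shift_op_hop[OF j that e'] shift_op_hop[OF i that e])
    have S_annihilation: "shift_op i e (shift_op j e' (annihilation q R k e'' n w)) = annihilation q R k e'' n (shift_op i e (shift_op j e' w))"
      if "k \<in> {1, 2}" for k e'' n w
    proof (cases "n > 0")
      case True
      then show ?thesis
        by (simp add: annihilation_pos[OF that] lin_zero[OF shift_op_lin[OF i e]] lin_zero[OF shift_op_lin[OF j e']])
    next
      case False
      then show ?thesis using S_ann[OF that, of e'' "nat (- n)" w] by (simp add: ann_def)
    qed
    show "shift_op i e (shift_op j e' (?rA m w)) = ?rA m (shift_op i e (shift_op j e' w))" for m w
      by (simp add: ser_rescale_def lin_scale[OF shift_op_lin[OF i e]] lin_scale[OF shift_op_lin[OF j e']] S_annihilation[OF i])
    show "shift_op i e (shift_op j e' (?A m w)) = ?A m (shift_op i e (shift_op j e' w))" for m w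
      by (rule S_annihilation[OF j])
  qed (simp_all add: laurentD(1)[OF rA] A)
  then have SAZ: "(shift R i e \<odot> shift R j e' \<odot> ?rA \<odot> ?A \<odot> ?rZ \<odot> ?Z) m v
      = (?rA \<odot> ?A) (m - ?m0) (?c \<cdot> ?u)" for m
    unfolding shift_eq ser_const_mult AZ
    by (simp add: shift_a0_def lin_scale[OF shift_op_lin[OF i e]] lin_scale[OF shift_op_lin[OF j e']] a0_exp_shift_op[OF e j e'])
  have "(?C \<odot> shift R i e \<odot> shift R j e' \<odot> ?rA \<odot> ?A \<odot> ?rZ \<odot> ?Z) m v
      = (?C \<odot> ?rA \<odot> ?A) (m - ?m0) (?c \<cdot> ?u)" for m
    by (rule ser_mult_translate[where B' = "?rA \<odot> ?A"]) (rule SAZ)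
  then have "Lam_pair q l1 R \<xi> i e j e' m v = (?rC \<odot> ?C \<odot> ?rA \<odot> ?A) (m - ?m0) (?c \<cdot> ?u)"
    unfolding Lam_pair_def by (rule ser_mult_translate[where B' = "?C \<odot> ?rA \<odot> ?A"])
  also have "\<dots> = ?c \<cdot> (?rC \<odot> ?C \<odot> ?rA \<odot> ?A) (m - ?m0) ?u"
  proof (rule lin_scale, rule bounded_belowD)
    have "bounded_below (?C \<odot> ?rA \<odot> ?A)"
      by (rule bounded_below_mult[OF cre_lin[OF j] cre_neg[OF j]
            laurent_imp_bounded_below[OF laurent_mult[OF rA A]]])
    then show "bounded_below (?rC \<odot> ?C \<odot> ?rA \<odot> ?A)"
      by (rule bounded_below_mult[OF rescale_lin[OF cre_lin[OF i]], rotated])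
         (simp add: ser_rescale_def cre_neg[OF i])
  qed
  also have "(?rC \<odot> ?C \<odot> ?rA \<odot> ?A) (m - ?m0) ?u
    = Sum_any (\<lambda>p. \<xi> powi p \<cdot> normal_ordered N i e j e' ?u p (m - ?m0 - p))"
    by (rule Lam_pair_tail[OF i j \<xi> killed_above_shift_a0[OF killed_above_shift_a0[OF N j e'] i e]])
  finally show ?thesis by (simp only: diff_diff_eq)
qed

end


section \<open>Structure functions\<close>

text \<open>
  For \<open>i \<noteq> j\<close>, the commutator of \<open>h\<^sub>i\<^sub>,\<^sub>n\<close> and \<open>h\<^sub>j\<^sub>,\<^sub>-\<^sub>n\<close> is \<open>- n\<close> times this number.
\<close>
definition kappa :: "complex \<Rightarrow> complex \<Rightarrow> nat \<Rightarrow> complex" where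
  "kappa q d n = (q1 q d ^ n + q3 q d ^ n) / (1 + q2 q d powi (- int n))"

text \<open>
  The commutator of the annihilation exponent of \<open>\<Lambda>\<^sub>i\<^sup>e(z)\<close> with the creation exponent of
  \<open>\<Lambda>\<^sub>j\<^sup>e\<^sup>'(w)\<close>, \<open>i \<noteq> j\<close>, as a power series in \<open>w/z\<close>.
\<close>
definition contraction :: "complex \<Rightarrow> complex \<Rightarrow> int \<Rightarrow> int \<Rightarrow> complex fps" where
  "contraction q d e e' = Abs_fps (\<lambda>n. if n = 0 then 0 else
     of_int (e * e') * q powi ((e - e') * int n) * kappa q d n / of_nat n)"

lemma generic_nonzero: "generic q d \<Longrightarrow> q \<noteq> 0" "generic q d \<Longrightarrow> d \<noteq> 0"
  by (simp_all add: generic_def)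

text \<open>
  If \<open>q\<^bsup>2n\<^esup> = - 1\<close>, then \<open>q\<^bsup>4n\<^esup> = 1\<close>.
\<close>
lemma generic_denominator:
  assumes "generic q d" "n > 0"
  shows "1 + q2 q d powi (- int n) \<noteq> 0"
proof
  assume "1 + q2 q d powi (- int n) = 0"
  then have "inverse ((q ^ 2) ^ n) = - 1"
    by (simp only: q2_def power_int_minus power_int_of_nat eq_neg_iff_add_eq_0 add.commute)
  then have "(q ^ 2) ^ n = - 1"
    using inverse_inverse_eq[of "(q ^ 2) ^ n"] by simp
  then have "((q ^ 2) ^ n) ^ 2 = 1" by simp
  then have "q powi int (4 * n) * d powi 0 = 1"
    by (simp only: power_int_of_nat power_mult[symmetric]) (simp add: mult.commute)
  moreover have "(int (4 * n), 0 :: int) \<noteq> (0, 0)" using assms(2) by simp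
  ultimately show False using assms(1) unfolding generic_def by blast
qed

text \<open>
  The factor on the left is the denominator of \<open>kappa\<close> for \<open>e = - 1\<close>, and \<open>q\<^bsup>2n\<^esup>\<close> times it for
  \<open>e = 1\<close>. In the second case the relation \<open>q\<^sub>1 q\<^sub>3 = q\<^sup>-\<^sup>2\<close> turns \<open>q\<^bsup>2n\<^esup> (q\<^sub>1\<^sup>n + q\<^sub>3\<^sup>n)\<close> into
  \<open>q\<^sub>3\<^bsup>-n\<^esup> + q\<^sub>1\<^bsup>-n\<^esup>\<close>.
\<close>
lemma kappa_opposite:
  assumes "generic q d" "n > 0" and e: "e \<in> {1, - 1}"
  shows "kappa q d n * (1 + q powi (2 * e * int n)) = (q1 q d powi (- e)) ^ n + (q3 q d powi (- e)) ^ n"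
proof -
  have q: "q \<noteq> 0" "d \<noteq> 0" using generic_nonzero[OF assms(1)] by simp_all
  have den: "1 + q2 q d powi (- int n) = 1 + inverse (q ^ (2 * n))"
    by (simp add: q2_def power_int_minus power_mult)
  then have nz: "1 + inverse (q ^ (2 * n)) \<noteq> 0" using generic_denominator[OF assms(1,2)] by simp
  show ?thesis
  proof (cases "e = 1")
    case True
    have "1 + q powi (2 * int n) = q ^ (2 * n) * (1 + inverse (q ^ (2 * n)))"
      using q by (simp add: algebra_simps flip: power_int_of_nat)
    then have "kappa q d n * (1 + q powi (2 * int n)) = (q1 q d ^ n + q3 q d ^ n) * q ^ (2 * n)"
      using nz by (simp add: kappa_def den)
    also have "\<dots> = inverse (q1 q d) ^ n + inverse (q3 q d) ^ n"
      using q by (simp add: q1_def q3_def power_mult_distrib power_inverse field_simps power_mult power2_eq_square)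
    finally show ?thesis using True by (simp add: power_int_minus)
  next
    case False
    then have "e = - 1" using e by simp
    moreover have "q powi (- 2 * int n) = inverse (q ^ (2 * n))"
      by (simp add: power_int_minus flip: power_int_of_nat)
    ultimately show ?thesis using nz by (simp add: kappa_def den)
  qed
qed

text \<open>
  For equal signs the contraction contributes \<open>kappa\<close> to the exponent, which is just what the
  structure function subtracts.
\<close>
lemma fser_contraction_same:
  assumes "e \<in> {1, - 1}"
  shows "fser q d \<xi> * (fps_exp 1 oo contraction q d e e) = Abs_fps (\<lambda>n. \<xi> ^ n)"
proof -
  let ?F = "Abs_fps (\<lambda>n. if n = 0 then 0 else
     (\<xi> ^ n - (q1 q d ^ n + q3 q d ^ n) / (1 + q2 q d powi (- int n))) / of_nat n)"
  have "?F + contraction q d e e = log_series \<xi>"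
    using assms by (intro fps_ext) (auto simp: contraction_def log_series_def kappa_def diff_divide_distrib)
  then have "fser q d \<xi> * (fps_exp 1 oo contraction q d e e) = fps_exp 1 oo log_series \<xi>"
    unfolding fser_def by (subst fps_exp_compose_add) (simp_all add: contraction_def)
  then show ?thesis by (simp add: exp_log_series)
qed

text \<open>
  For opposite signs the coefficients of the two exponents add up to \<open>\<xi>\<^sup>n - kappa\<^sub>n (1 + q\<^bsup>2en\<^esup>)\<close>, and by
  \<open>kappa_opposite\<close> the exponent is a sum of three logarithms.
\<close>
lemma fser_contraction_opposite:
  assumes g: "generic q d" and e: "e \<in> {1, - 1}" "e' = - e"
  shows "fser q d \<xi> * (fps_exp 1 oo contraction q d e e')
    = (1 - fps_const (q1 q d powi (- e)) * fps_X) * (1 - fps_const (q3 q d powi (- e)) * fps_X)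
      * Abs_fps (\<lambda>n. \<xi> ^ n)"
proof -
  let ?F = "Abs_fps (\<lambda>n. if n = 0 then 0 else
     (\<xi> ^ n - (q1 q d ^ n + q3 q d ^ n) / (1 + q2 q d powi (- int n))) / of_nat n)"
  let ?\<alpha> = "q1 q d powi (- e)" and ?\<beta> = "q3 q d powi (- e)"
  have L: "?F + contraction q d e e' = - log_series ?\<alpha> + (- log_series ?\<beta> + log_series \<xi>)"
  proof (rule fps_ext)
    fix n
    show "fps_nth (?F + contraction q d e e') n = fps_nth (- log_series ?\<alpha> + (- log_series ?\<beta> + log_series \<xi>)) n"
    proof (cases "n = 0")
      case True
      then show ?thesis by (simp add: contraction_def log_series_def)
    next
      case False
      have ee: "of_int (e * e') = (- 1 :: complex)" "(e - e') * int n = 2 * e * int n" using e by auto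
      have "fps_nth (?F + contraction q d e e') n
        = (\<xi> ^ n - kappa q d n) / of_nat n + (- 1) * q powi (2 * e * int n) * kappa q d n / of_nat n"
        using False
        by (simp only: contraction_def ee kappa_def[symmetric] fps_add_nth fps_nth_Abs_fps if_False)
      also have "\<dots> = (\<xi> ^ n - kappa q d n * (1 + q powi (2 * e * int n))) / of_nat n"
        using False by (simp add: field_simps)
      also have "\<dots> = (\<xi> ^ n - (?\<alpha> ^ n + ?\<beta> ^ n)) / of_nat n"
        using kappa_opposite[OF g _ e(1), of n] False by simp
      finally show ?thesis using False by (simp add: log_series_def diff_divide_distrib add_divide_distrib)
    qed
  qed
  have 0: "fps_nth (log_series c) 0 = 0" for c by (simp add: log_series_def)
  have "fser q d \<xi> * (fps_exp 1 oo contraction q d e e') = fps_exp 1 oo (?F + contraction q d e e')"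
    unfolding fser_def by (rule fps_exp_compose_add) (simp_all add: contraction_def)
  also have "\<dots> = (fps_exp 1 oo (- log_series ?\<alpha>)) * ((fps_exp 1 oo (- log_series ?\<beta>)) * (fps_exp 1 oo log_series \<xi>))"
    unfolding L by (simp add: fps_exp_compose_add 0)
  finally show ?thesis by (simp only: exp_log_series exp_neg_log_series mult.assoc)
qed

locale generic_heisenberg_module = heisenberg_module q d l1 l3 R
  for q d l1 l3 :: complex and R :: "('v::ab_group_add) heisenberg_ops" +
  assumes gen: "generic q d"
begin

lemma q_nonzero: "q \<noteq> 0" and d_nonzero: "d \<noteq> 0"
  using generic_nonzero[OF gen] by simp_all

lemma mode_bracket:
  assumes i: "i \<in> {1, 2}" and j: "j \<in> {1, 2}" and ij: "i \<noteq> j" and n: "n > 0" and m: "m > 0"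
  shows "annihilation_mode i e n (creation_mode j e' m v) = creation_mode j e' m (annihilation_mode i e n v)
     + (if m = n then fps_nth (contraction q d e e') n else 0) \<cdot> v"
proof -
  let ?\<alpha> = "- of_int e * q powi (e * int n) / of_nat n"
  let ?\<gamma> = "of_int e' * q powi (- e' * int m) / of_nat m"
  have a: "annihilation_mode i e n w = ?\<alpha> \<cdot> hop R i (int n) w" for w
    using n by (simp add: annihilation_mode_def exponent_def)
  have c: "creation_mode j e' m w = ?\<gamma> \<cdot> hop R j (- int m) w" for w
    using m by (simp add: creation_mode_def exponent_def)
  have "hop R i (int n) (hop R j (- int m) v) = hop R j (- int m) (hop R i (int n) v)
     + (if m = n then - of_nat n * kappa q d n else 0) \<cdot> v"
    using h_comm_distinct[OF i j ij, of "int n" "- int m" v]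
    by (simp add: kappa_def algebra_simps split: if_splits)
  then have "annihilation_mode i e n (creation_mode j e' m v) = creation_mode j e' m (annihilation_mode i e n v)
     + (?\<alpha> * ?\<gamma> * (if m = n then - of_nat n * kappa q d n else 0)) \<cdot> v"
    by (simp only: a c lin_scale[OF linear_h[OF i]] lin_scale[OF linear_h[OF j]] scale_right_distrib
        scale_scale mult.commute[of ?\<gamma> ?\<alpha>] mult.assoc)
  moreover have "?\<alpha> * ?\<gamma> * (if m = n then - of_nat n * kappa q d n else 0)
     = (if m = n then fps_nth (contraction q d e e') n else 0)"
  proof (cases "m = n")
    case True
    have "q powi ((e - e') * int n) = q powi (e * int n) * q powi (- e' * int n)"
      using q_nonzero by (simp add: algebra_simps flip: power_int_add)
    then show ?thesis using True n by (simp add: contraction_def)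
  qed simp
  ultimately show ?thesis by (simp only:)
qed

abbreviation contraction_exp :: "int \<Rightarrow> int \<Rightarrow> complex fps" where
  "contraction_exp e e' \<equiv> fps_exp 1 oo contraction q d e e'"

lemma ann_cre:
  assumes i: "i \<in> {1, 2}" and j: "j \<in> {1, 2}" and ij: "i \<noteq> j"
  shows "ann i e l (cre j e' r w)
     = (\<Sum>s\<le>l. fps_nth (contraction_exp e e') s \<cdot> cre j e' (r - int s) (ann i e (l - s) w))"
proof -
  have c0: "fps_nth (contraction q d e e') 0 = 0" by (simp add: contraction_def)
  have "ann i e l (int_index (\<lambda>n. cre j e' (int n)) r w)
     = (\<Sum>s\<le>l. fps_nth (contraction_exp e e') s \<cdot> int_index (\<lambda>n. cre j e' (int n)) (r - int s) (ann i e (l - s) w))"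
    by (rule exp_recursion_exchange[OF exp_recursion_ann[OF i] exp_recursion_cre[OF j] creation_mode_lin[OF j] annihilation_mode_lin[OF i]
          mode_bracket[OF i j ij] _ fps_nth_of_deriv_eq[OF fps_exp_compose_deriv[OF c0]]]) simp_all
  then show ?thesis using cre_int_index[OF j, of e'] by simp
qed

text \<open>
  The scalar \<open>q\<^sup>e\<^sup>'\<close> and the degree shift \<open>e e'\<close> come from the zero mode of the first current: the
  second current changes the eigenvalue \<open>\<mu>\<close> of \<open>h\<^sub>i\<^sub>,\<^sub>0\<close> to \<open>\<mu> - e'\<close>, and \<open>(q\<^bsup>-e\<^esup> z)\<^bsup>-ee'\<^esup> = q\<^sup>e\<^sup>' z\<^bsup>-ee'\<^esup>\<close>
  because \<open>e\<^sup>2 = 1\<close>. The series \<open>contraction_exp\<close> comes from moving annihilation past creation.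
\<close>
lemma Lam_product:
  assumes i: "i \<in> {1, 2}" and j: "j \<in> {1, 2}" and ij: "i \<noteq> j" and e: "e \<in> {1, - 1}" and e': "e' \<in> {1, - 1}"
    and v: "hop R i 0 v = of_int \<mu> \<cdot> v" "hop R j 0 v = of_int \<nu> \<cdot> v" and N: "killed_above (int N) v"
  shows "Lam q l1 R i e a (Lam q l1 R j e' b v)
    = (q powi e' * (q powi (- e)) powi (e * \<mu>) * (q powi (- e')) powi (e' * \<nu>)) \<cdot>
      Sum_any (\<lambda>s. fps_nth (contraction_exp e e') s \<cdot>
        normal_ordered N i e j e' (shift_a0 i e (shift_a0 j e' v)) (a - e * \<mu> + e * e' + int s) (b - e' * \<nu> - int s))"
proof -
  let ?ci = "(q powi (- e)) powi (e * \<mu>)" and ?cj = "(q powi (- e')) powi (e' * \<nu>)"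
  let ?P = "a - e * \<mu> + e * e'" and ?Q = "b - e' * \<nu>" and ?u = "shift_a0 i e (shift_a0 j e' v)"
  let ?g = "fps_nth (contraction_exp e e')"
  define Y where "Y = (\<Sum>l'\<le>N. cre j e' (?Q + int l') (ann j e' l' (shift_a0 j e' v)))"
  have LY: "Lam q l1 R j e' b v = ?cj \<cdot> Y"
    unfolding Y_def by (rule Lam_eigenvector[OF j e' v(2) killed_above_shift_a0[OF N j e']])
  have w: "hop R i 0 (shift_a0 j e' v) = of_int (\<mu> - e') \<cdot> shift_a0 j e' v"
    using hop0_shift_a0[OF j i e' v(1)] ij by simp
  have hY: "hop R i 0 Y = of_int (\<mu> - e') \<cdot> Y"
    unfolding Y_def
    by (simp only: lin_sum[OF linear_h[OF i]] hop0_cre[OF i j] hop0_ann[OF i j] w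
        lin_scale[OF ann_lin[OF j]] lin_scale[OF cre_lin[OF j]] scale_sum_right)
  obtain N' where N': "killed_above (int N') Y" using killed_above_exists by blast
  (* The annihilation part of the first current acts on Y, which has no bound related to N. The cut-off
     N + D is large enough for Y, and D also bounds the number s of degrees that the creation
     coefficient of the second current can lose before its index becomes negative. *)
  define D where "D = nat (?Q + int N) + N'"
  have kY: "killed_above (int (N + D)) (shift_a0 i e Y)"
    by (rule killed_above_shift_a0[OF killed_above_mono[OF N'] i e]) (simp add: D_def)
  have image_Y: "shift_a0 i e Y = (\<Sum>l'\<le>N. cre j e' (?Q + int l') (ann j e' l' ?u))"
    unfolding Y_def by (simp only: lin_sum[OF shift_a0_lin[OF i e]] shift_a0_cre[OF i e j] shift_a0_ann[OF i e j])
  (* A term of annihilation degree l = s + t, of which the degree s is used up by contractions. *)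
  define G where "G s t = ?g s \<cdot> (\<Sum>l'\<le>N. cre i e (?P + int s + int t)
      (cre j e' (?Q - int s + int l') (ann i e t (ann j e' l' ?u))))" for s t
  have G0: "G s t = 0" if "s > D \<or> t > N" for s t
    using that
  proof
    assume "s > D"
    then have "?Q - int s + int l' < 0" if "l' \<le> N" for l' using that by (simp add: D_def)
    then have "cre i e (?P + int s + int t) (cre j e' (?Q - int s + int l') (ann i e t (ann j e' l' ?u))) = 0"
      if "l' \<le> N" for l'
      using that by (simp only: cre_neg[OF j] lin_zero[OF cre_lin[OF i]])
    then show ?thesis unfolding G_def by simp
  next
    assume "t > N"
    then have "ann i e t (ann j e' l' ?u) = 0" for l'
      by (rule ann_ann_zero[OF killed_above_shift_a0[OF killed_above_shift_a0[OF N j e'] i e] i j])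
    then show ?thesis
      unfolding G_def by (simp only: lin_zero[OF cre_lin[OF i]] lin_zero[OF cre_lin[OF j]]) simp
  qed
  have term_l: "cre i e (?P + int l) (ann i e l (shift_a0 i e Y)) = (\<Sum>s\<le>l. G s (l - s))" for l
  proof -
    have "cre i e (?P + int l) (ann i e l (shift_a0 i e Y))
      = (\<Sum>l'\<le>N. \<Sum>s\<le>l. ?g s \<cdot> cre i e (?P + int l)
          (cre j e' (?Q + int l' - int s) (ann i e (l - s) (ann j e' l' ?u))))"
      by (simp only: image_Y lin_sum[OF ann_lin[OF i]] ann_cre[OF i j ij] lin_sum[OF cre_lin[OF i]]
          lin_scale[OF cre_lin[OF i]])
    also have "\<dots> = (\<Sum>s\<le>l. \<Sum>l'\<le>N. ?g s \<cdot> cre i e (?P + int l)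
          (cre j e' (?Q + int l' - int s) (ann i e (l - s) (ann j e' l' ?u))))"
      by (rule sum.swap)
    also have "\<dots> = (\<Sum>s\<le>l. G s (l - s))"
    proof (rule sum.cong[OF refl])
      fix s assume "s \<in> {..l}"
      then have "?P + int s + int (l - s) = ?P + int l" by simp
      moreover have "?Q + int l' - int s = ?Q - int s + int l'" for l' by simp
      ultimately show "(\<Sum>l'\<le>N. ?g s \<cdot> cre i e (?P + int l)
          (cre j e' (?Q + int l' - int s) (ann i e (l - s) (ann j e' l' ?u)))) = G s (l - s)"
        unfolding G_def by (simp only: scale_sum_right)
    qed
    finally show ?thesis .
  qed
  have row: "(\<Sum>t\<le>N. G s t) = ?g s \<cdot> normal_ordered N i e j e' ?u (?P + int s) (?Q - int s)" for s
    unfolding G_def normal_ordered_def scale_sum_right ..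
  have "Lam q l1 R i e a Y = (q powi (- e)) powi (e * (\<mu> - e')) \<cdot>
      (\<Sum>l\<le>N + D. cre i e (a - e * (\<mu> - e') + int l) (ann i e l (shift_a0 i e Y)))"
    by (rule Lam_eigenvector[OF i e hY kY])
  also have "a - e * (\<mu> - e') = ?P" by (simp add: algebra_simps)
  also have "(\<Sum>l\<le>N + D. cre i e (?P + int l) (ann i e l (shift_a0 i e Y)))
     = (\<Sum>(s, t)\<in>{(s, t). s + t \<le> N + D}. G s t)"
    unfolding term_l by (rule sum.triangle_reindex_eq[symmetric])
  (* The triangle contains the box, and G vanishes outside of the box. *)
  also have "\<dots> = (\<Sum>(s, t)\<in>{..D} \<times> {..N}. G s t)"
  proof (rule sum.mono_neutral_right)
    have "{(s, t). s + t \<le> N + D} \<subseteq> {..N + D} \<times> {..N + D}" by auto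
    then show "finite {(s, t). s + t \<le> N + D}" by (rule finite_subset) simp
    show "\<forall>st\<in>{(s, t). s + t \<le> N + D} - {..D} \<times> {..N}. (case st of (s, t) \<Rightarrow> G s t) = 0"
    proof
      fix st assume st: "st \<in> {(s, t). s + t \<le> N + D} - {..D} \<times> {..N}"
      obtain s t where "st = (s, t)" by (cases st)
      moreover from this st have "s > D \<or> t > N" by auto
      ultimately show "(case st of (s, t) \<Rightarrow> G s t) = 0" by (simp only: prod.case G0)
    qed
  qed auto
  also have "\<dots> = (\<Sum>s\<le>D. ?g s \<cdot> normal_ordered N i e j e' ?u (?P + int s) (?Q - int s))"
    unfolding sum.cartesian_product[symmetric] row ..
  also have "\<dots> = Sum_any (\<lambda>s. ?g s \<cdot> normal_ordered N i e j e' ?u (?P + int s) (?Q - int s))"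
  proof (rule Sum_any_upto[symmetric])
    fix s assume "s > D"
    then have "?Q - int s < - int N" by (simp add: D_def)
    then show "?g s \<cdot> normal_ordered N i e j e' ?u (?P + int s) (?Q - int s) = 0"
      by (simp only: normal_ordered_zero[OF i j] simp_thms scale_zero_right)
  qed
  also have "(q powi (- e)) powi (e * (\<mu> - e')) = q powi e' * ?ci"
  proof -
    have "- e * (e * (\<mu> - e')) = e' + - e * (e * \<mu>)"
      using e by (auto simp: algebra_simps)
    then show ?thesis using q_nonzero by (simp only: power_int_mult[symmetric] power_int_add simp_thms)
  qed
  finally have "Lam q l1 R i e a Y = (q powi e' * ?ci) \<cdot>
     Sum_any (\<lambda>s. ?g s \<cdot> normal_ordered N i e j e' ?u (?P + int s) (?Q - int s))" .
  then show ?thesis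
    unfolding LY lin_scale[OF Lam_lin[OF i e]] by (simp only: scale_scale mult_ac)
qed

end


section \<open>The quadratic relation\<close>

context generic_heisenberg_module
begin

text \<open>
  Since the scalar series of \<open>Lam_product\<close> is a series in \<open>w/z\<close>, the multiplication by another
  power series \<open>f(w/z)\<close> only multiplies it by \<open>f\<close>.
\<close>
lemma Lam_product_smeared:
  assumes i: "i \<in> {1, 2}" and j: "j \<in> {1, 2}" and ij: "i \<noteq> j" and e: "e \<in> {1, - 1}" and e': "e' \<in> {1, - 1}"
    and v: "hop R i 0 v = of_int \<mu> \<cdot> v" "hop R j 0 v = of_int \<nu> \<cdot> v" and N: "killed_above (int N) v"
  shows "Sum_any (\<lambda>t. fps_nth f t \<cdot> Lam q l1 R i e (a + int t) (Lam q l1 R j e' (b - int t) v))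
    = (q powi e' * (q powi (- e)) powi (e * \<mu>) * (q powi (- e')) powi (e' * \<nu>)) \<cdot>
      Sum_any (\<lambda>n. fps_nth (f * contraction_exp e e') n \<cdot>
        normal_ordered N i e j e' (shift_a0 i e (shift_a0 j e' v)) (a - e * \<mu> + e * e' + int n) (b - e' * \<nu> - int n))"
proof -
  let ?c = "q powi e' * (q powi (- e)) powi (e * \<mu>) * (q powi (- e')) powi (e' * \<nu>)"
  define F where "F n = normal_ordered N i e j e' (shift_a0 i e (shift_a0 j e' v)) (a - e * \<mu> + e * e' + int n) (b - e' * \<nu> - int n)" for n
  define M where "M = nat (b - e' * \<nu> + int N)"
  define X where "X t = Sum_any (\<lambda>s. fps_nth (contraction_exp e e') s \<cdot> F (t + s))" for t
  have F0: "F n = 0" if "n > M" for n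
  proof -
    have "b - e' * \<nu> - int n < - int N" using that by (simp add: M_def)
    then show ?thesis unfolding F_def by (simp only: normal_ordered_zero[OF i j] simp_thms)
  qed
  have X0: "X t = 0" if "t > M" for t
    unfolding X_def using F0 that by simp
  have "Lam q l1 R i e (a + int t) (Lam q l1 R j e' (b - int t) v) = ?c \<cdot> X t" for t
  proof -
    have F: "normal_ordered N i e j e' (shift_a0 i e (shift_a0 j e' v)) (a + int t - e * \<mu> + e * e' + int s) (b - int t - e' * \<nu> - int s)
        = F (t + s)" for s
      unfolding F_def by (rule arg_cong2[where f = "normal_ordered N i e j e' (shift_a0 i e (shift_a0 j e' v))"]) simp_all
    show ?thesis
      unfolding Lam_product[OF i j ij e e' v N] X_def F ..
  qed
  then have "Sum_any (\<lambda>t. fps_nth f t \<cdot> Lam q l1 R i e (a + int t) (Lam q l1 R j e' (b - int t) v))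
    = Sum_any (\<lambda>t. ?c \<cdot> (fps_nth f t \<cdot> X t))"
    by (simp only: scale_left_commute)
  also have "\<dots> = ?c \<cdot> Sum_any (\<lambda>t. fps_nth f t \<cdot> X t)"
  proof (rule lin_Sum_any[OF lin_smult[OF lin_id], symmetric])
    have "{t. fps_nth f t \<cdot> X t \<noteq> 0} \<subseteq> {..M}" using X0 by (auto simp: not_le[symmetric])
    then show "finite {t. fps_nth f t \<cdot> X t \<noteq> 0}" by (rule finite_subset) simp
  qed
  also have "Sum_any (\<lambda>t. fps_nth f t \<cdot> X t) = Sum_any (\<lambda>n. fps_nth (f * contraction_exp e e') n \<cdot> F n)"
    unfolding X_def by (rule Sum_any_convolution[of M F, OF F0])
  finally show ?thesis unfolding F_def .
qed

text \<open>
  The scalar factor of the term \<open>:\<Lambda>\<^sub>i\<^sup>e(\<xi>z) \<Lambda>\<^sub>j\<^sup>e\<^sup>'(z):\<close> in \<open>\<T>\<^sub>i\<^sub>j(\<xi>; z)\<close>, without the power of \<open>z\<close>.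
\<close>
definition pair_coeff :: "complex \<Rightarrow> int \<Rightarrow> int \<Rightarrow> complex" where
  "pair_coeff \<xi> e e' = q powi e *
     (if e = e' then 1 else (1 - q1 q d powi e * \<xi>) * (1 - q3 q d powi e * \<xi>))"

text \<open>
  Comparison of the numerators for opposite signs in the two orders of the currents,
  \<open>q\<^bsup>-e\<^esup> (z/w) (1 - q\<^sub>1\<^bsup>-e\<^esup> w/z) (1 - q\<^sub>3\<^bsup>-e\<^esup> w/z) = q\<^sup>e (w/z) (1 - q\<^sub>1\<^sup>e z/w) (1 - q\<^sub>3\<^sup>e z/w)\<close>, coefficient by
  coefficient. It rests on \<open>q\<^sub>1 q\<^sub>3 = q\<^sup>-\<^sup>2\<close>.
\<close>
lemma opposite_coeffs:
  assumes "e \<in> {1, - 1}"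
  shows "q powi (- e) * (q1 q d powi (- e) * q3 q d powi (- e)) = q powi e"
    and "q powi (- e) * (q1 q d powi (- e) + q3 q d powi (- e)) = q powi e * (q1 q d powi e + q3 q d powi e)"
    and "q powi (- e) = q powi e * (q1 q d powi e * q3 q d powi e)"
  using assms q_nonzero d_nonzero
  by (auto simp: q1_def q3_def power_int_minus field_simps)

text \<open>
  Everything takes place on one antidiagonal: all terms are sums over the same family \<open>F n\<close> of
  normally ordered coefficients, in which \<open>z\<close> has gained and \<open>w\<close> has lost the power \<open>n\<close>. For equal
  signs the claim is \<open>Sum_any_delta\<close> with \<open>k = - 1\<close>. For opposite signs each of the three coefficients of
  the quadratic numerator leads to one instance, with \<open>k = 1, 0, - 1\<close>; the three powers of \<open>\<xi>\<close> that
  they produce add up to the numerator at \<open>z = \<xi> w\<close>.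
\<close>
lemma pair_identity_eigenvector:
  assumes i: "i \<in> {1, 2}" and j: "j \<in> {1, 2}" and ij: "i \<noteq> j" and e: "e \<in> {1, - 1}" and e': "e' \<in> {1, - 1}"
    and \<xi>: "\<xi> \<noteq> 0" and v: "hop R i 0 v = of_int \<mu> \<cdot> v"
  shows "\<xi> \<cdot> Sum_any (\<lambda>t. fps_nth (fser q d \<xi>) t \<cdot> Lam q l1 R i e (a + int t) (Lam q l1 R j e' (b - int t) v))
     + Sum_any (\<lambda>t. fps_nth (fser q d (inverse \<xi>)) t \<cdot> Lam q l1 R j e' (b + int t) (Lam q l1 R i e (a - int t) v))
     = \<xi> powi (- a) \<cdot> pair_coeff \<xi> e e' \<cdot> Lam_pair q l1 R \<xi> i e j e' (a + b + e * e') v"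
proof -
  obtain N where N: "killed_above (int N) v" using killed_above_exists by blast
  let ?\<nu> = "- \<mu>"
  have "hop R j 0 v = - hop R i 0 v"
    using i j ij h0_sum[of v] by (auto simp del: One_nat_def)
  then have v': "hop R j 0 v = of_int ?\<nu> \<cdot> v" using v by simp
  let ?P = "a - e * \<mu> + e * e'" and ?Q = "b - e' * ?\<nu>" and ?u = "shift_a0 i e (shift_a0 j e' v)"
  define F where "F n = normal_ordered N i e j e' ?u (?P + n) (?Q - n)" for n
  define k0 where "k0 = (q powi (- e)) powi (e * \<mu>) * (q powi (- e')) powi (e' * ?\<nu>)"
  define D where "D = Sum_any (\<lambda>n. \<xi> powi n \<cdot> F n)"
  have finF: "finite {n. F n \<noteq> 0}" unfolding F_def by (rule normal_ordered_finite_support[OF i j])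
  have finG: "finite {n. \<xi> powi n \<cdot> F n \<noteq> 0}" by (rule finite_subset[OF _ finF]) auto
  have delta: "\<xi> \<cdot> Sum_any (\<lambda>t. \<xi> ^ t \<cdot> F (int t + k + 1)) + Sum_any (\<lambda>t. inverse \<xi> ^ t \<cdot> F (k - int t))
    = \<xi> powi (- k) \<cdot> D" for k
    unfolding D_def by (rule Sum_any_delta[OF finF \<xi>])

  have first: "Sum_any (\<lambda>t. fps_nth (fser q d \<xi>) t \<cdot> Lam q l1 R i e (a + int t) (Lam q l1 R j e' (b - int t) v))
    = (q powi e' * k0) \<cdot> Sum_any (\<lambda>n. fps_nth (fser q d \<xi> * contraction_exp e e') n \<cdot> F (int n))"
    unfolding Lam_product_smeared[OF i j ij e e' v v' N] F_def k0_def by (simp only: mult.assoc)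
  have second: "Sum_any (\<lambda>t. fps_nth (fser q d (inverse \<xi>)) t \<cdot> Lam q l1 R j e' (b + int t) (Lam q l1 R i e (a - int t) v))
    = (q powi e * k0) \<cdot> Sum_any (\<lambda>n. fps_nth (fser q d (inverse \<xi>) * contraction_exp e' e) n \<cdot> F (- e * e' - int n))"
  proof -
    have "normal_ordered N j e' i e (shift_a0 j e' (shift_a0 i e v)) (b - e' * ?\<nu> + e' * e + int n) (a - e * \<mu> - int n)
        = F (- e * e' - int n)" for n
      unfolding F_def shift_a0_commute[OF i j e e'] normal_ordered_swap[OF j i]
      by (rule arg_cong2[where f = "normal_ordered N i e j e' (shift_a0 j e' (shift_a0 i e v))"]) (simp_all add: algebra_simps)
    then show ?thesis
      unfolding Lam_product_smeared[OF j i ij[symmetric] e' e v' v N] k0_def by (simp only: mult_ac)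
  qed

  (* The substitution p = ?P + n moves the sum over all p to the antidiagonal family F. *)
  have pair: "\<xi> powi (- a) \<cdot> Lam_pair q l1 R \<xi> i e j e' (a + b + e * e') v = (k0 * \<xi> powi (e * e')) \<cdot> D"
  proof -
    let ?H = "\<lambda>p. \<xi> powi p \<cdot> normal_ordered N i e j e' ?u p (a + b + e * e' - e * \<mu> - e' * ?\<nu> - p)"
    have bij: "bij (\<lambda>n. ?P + n)"
      by (rule bij_betw_byWitness[of _ "\<lambda>n. n - ?P"]) auto
    have "Sum_any ?H = Sum_any (\<lambda>n. ?H (?P + n))"
      by (rule Sum_any.reindex_cong[OF bij]) (simp add: comp_def)
    also have "\<dots> = Sum_any (\<lambda>n. \<xi> powi ?P \<cdot> (\<xi> powi n \<cdot> F n))"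
    proof (rule Sum_any.cong)
      fix n
      have "a + b + e * e' - e * \<mu> - e' * ?\<nu> - (?P + n) = ?Q - n" by simp
      then show "?H (?P + n) = \<xi> powi ?P \<cdot> (\<xi> powi n \<cdot> F n)"
        unfolding F_def using \<xi> by (simp only: scale_scale power_int_add simp_thms)
    qed
    also have "\<dots> = \<xi> powi ?P \<cdot> D"
      unfolding D_def by (rule lin_Sum_any[OF lin_smult[OF lin_id] finG, symmetric])
    finally have "\<xi> powi (- a) \<cdot> Lam_pair q l1 R \<xi> i e j e' (a + b + e * e') v
      = (\<xi> powi (- a) * (\<xi> powi (e * \<mu>) * k0 * \<xi> powi ?P)) \<cdot> D"
      unfolding Lam_pair_eigenvector[OF i j e e' \<xi> v v' N] k0_def by (simp only: scale_scale mult.assoc)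
    also have "\<xi> powi (- a) * (\<xi> powi (e * \<mu>) * k0 * \<xi> powi ?P) = k0 * (\<xi> powi (- a) * \<xi> powi (e * \<mu>) * \<xi> powi ?P)"
      by (simp only: mult_ac)
    also have "\<xi> powi (- a) * \<xi> powi (e * \<mu>) * \<xi> powi ?P = \<xi> powi (e * e')"
      using \<xi> by (simp flip: power_int_add)
    finally show ?thesis .
  qed

  have rhs: "\<xi> powi (- a) \<cdot> pair_coeff \<xi> e e' \<cdot> Lam_pair q l1 R \<xi> i e j e' (a + b + e * e') v
      = (pair_coeff \<xi> e e' * (k0 * \<xi> powi (e * e'))) \<cdot> D"
    by (subst scale_left_commute, subst pair) (simp only: scale_scale)
  show ?thesis
  proof (cases "e' = e")
    case True
    have ee: "e * e = 1" using e by auto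
    have "\<xi> \<cdot> (q powi e * k0) \<cdot> Sum_any (\<lambda>n. \<xi> ^ n \<cdot> F (int n))
        + (q powi e * k0) \<cdot> Sum_any (\<lambda>n. inverse \<xi> ^ n \<cdot> F (- 1 - int n))
        = (q powi e * k0) \<cdot> (\<xi> \<cdot> D)"
    proof -
      have "\<xi> \<cdot> Sum_any (\<lambda>n. \<xi> ^ n \<cdot> F (int n)) + Sum_any (\<lambda>n. inverse \<xi> ^ n \<cdot> F (- 1 - int n)) = \<xi> \<cdot> D"
        using delta[of "- 1"] by simp
      from arg_cong[OF this, of "scal (q powi e * k0)"] show ?thesis
        by (simp only: scale_right_distrib scale_left_commute[of \<xi>])
    qed
    then show ?thesis
      unfolding first second rhs unfolding True fser_contraction_same[OF e]
      by (simp add: ee pair_coeff_def mult_ac)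
  next
    case False
    then have e'e: "e' = - e" "e = - e'" using e e' by auto
    then have ee: "e * e' = - 1" using e by auto
    define \<alpha> \<beta> \<alpha>' \<beta>' where "\<alpha> = q1 q d powi (- e)" and "\<beta> = q3 q d powi (- e)"
      and "\<alpha>' = q1 q d powi e" and "\<beta>' = q3 q d powi e"
    have \<alpha>'_eq: "\<alpha>' = q1 q d powi (- e')" and \<beta>'_eq: "\<beta>' = q3 q d powi (- e')"
      by (simp_all add: \<alpha>'_def \<beta>'_def e'e(1))
    define A B where "A = q powi (- e)" and "B = q powi e"
    (* A and B are the scalars of the two orders; U and V are the two halves of the delta function,
       shifted by the powers that occur in the numerators. *)
    have coeffs: "A * (\<alpha> * \<beta>) = B" "A * (\<alpha> + \<beta>) = B * (\<alpha>' + \<beta>')" "A = B * (\<alpha>' * \<beta>')"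
      unfolding A_def B_def \<alpha>_def \<beta>_def \<alpha>'_def \<beta>'_def by (rule opposite_coeffs[OF e])+
    define U where "U k = Sum_any (\<lambda>t. \<xi> ^ t \<cdot> F (int t + k))" for k
    define V where "V k = Sum_any (\<lambda>t. inverse \<xi> ^ t \<cdot> F (k - int t))" for k
    obtain M where M: "\<And>n. \<bar>n\<bar> > int M \<Longrightarrow> F n = 0"
    proof -
      have "finite ((\<lambda>n. nat \<bar>n\<bar>) ` {n. F n \<noteq> 0})" using finF by simp
      then obtain M where "\<forall>x\<in>(\<lambda>n. nat \<bar>n\<bar>) ` {n. F n \<noteq> 0}. x \<le> M"
        using finite_nat_set_iff_bounded_le by blast
      then have "F n = 0" if "\<bar>n\<bar> > int M" for n using that by force
      then show thesis by (rule that)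
    qed
    have s1: "Sum_any (\<lambda>n. fps_nth (fser q d \<xi> * contraction_exp e e') n \<cdot> F (int n))
       = U 0 - (\<alpha> + \<beta>) \<cdot> U 1 + (\<alpha> * \<beta>) \<cdot> U 2"
      unfolding fser_contraction_opposite[OF gen e e'e(1)] \<alpha>_def[symmetric] \<beta>_def[symmetric]
      by (subst Sum_any_geometric_quadratic[of M]) (simp_all add: M U_def add.commute)
    have s2: "Sum_any (\<lambda>n. fps_nth (fser q d (inverse \<xi>) * contraction_exp e' e) n \<cdot> F (1 - int n))
       = V 1 - (\<alpha>' + \<beta>') \<cdot> V 0 + (\<alpha>' * \<beta>') \<cdot> V (- 1)"
    proof -
      have F0: "F (1 - int n) = 0" if "n > M + 1" for n
        by (rule M) (use that in simp)
      have "1 - int (1 + n) = 0 - int n" "1 - int (2 + n) = - 1 - int n" for n by simp_all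
      then show ?thesis
        unfolding fser_contraction_opposite[OF gen e' e'e(2)] V_def \<alpha>'_eq \<beta>'_eq
        by (simp only: Sum_any_geometric_quadratic[of "M + 1" "\<lambda>n. F (1 - int n)", OF F0])
    qed
    (* Each U is traded for a V and a multiple of D; all V then cancel. *)
    have U: "\<xi> \<cdot> U 0 = \<xi> \<cdot> D - V (- 1)" "\<xi> \<cdot> U 1 = D - V 0" "\<xi> \<cdot> U 2 = inverse \<xi> \<cdot> D - V 1"
      using delta[of "- 1"] delta[of 0] delta[of 1]
      by (simp_all add: U_def V_def power_int_minus add.assoc eq_diff_eq)
    have "(A * k0) \<cdot> (\<xi> \<cdot> U 0) - (A * (\<alpha> + \<beta>) * k0) \<cdot> (\<xi> \<cdot> U 1) + (A * (\<alpha> * \<beta>) * k0) \<cdot> (\<xi> \<cdot> U 2)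
       = \<xi> \<cdot> (A * k0) \<cdot> (U 0 - (\<alpha> + \<beta>) \<cdot> U 1 + (\<alpha> * \<beta>) \<cdot> U 2)"
      by (simp add: scale_right_distrib scale_right_diff_distrib mult_ac)
    then have "\<xi> \<cdot> (A * k0) \<cdot> (U 0 - (\<alpha> + \<beta>) \<cdot> U 1 + (\<alpha> * \<beta>) \<cdot> U 2)
      = (A * k0) \<cdot> (\<xi> \<cdot> D - V (- 1)) - (B * (\<alpha>' + \<beta>') * k0) \<cdot> (D - V 0)
        + (B * k0) \<cdot> (inverse \<xi> \<cdot> D - V 1)"
      unfolding U coeffs(1,2) by (rule sym)
    then have "\<xi> \<cdot> (A * k0) \<cdot> Sum_any (\<lambda>n. fps_nth (fser q d \<xi> * contraction_exp e e') n \<cdot> F (int n))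
      + (B * k0) \<cdot> Sum_any (\<lambda>n. fps_nth (fser q d (inverse \<xi>) * contraction_exp e' e) n \<cdot> F (1 - int n))
      = (B * (\<alpha>' * \<beta>') * k0) \<cdot> (\<xi> \<cdot> D - V (- 1)) - (B * (\<alpha>' + \<beta>') * k0) \<cdot> (D - V 0)
        + (B * k0) \<cdot> (inverse \<xi> \<cdot> D - V 1)
        + (B * k0) \<cdot> (V 1 - (\<alpha>' + \<beta>') \<cdot> V 0 + (\<alpha>' * \<beta>') \<cdot> V (- 1))"
      unfolding s1 s2 coeffs(3)[symmetric] by (rule arg_cong)
    also have "\<dots> = (B * (\<alpha>' * \<beta>') * k0 * \<xi> - B * (\<alpha>' + \<beta>') * k0 + B * k0 * inverse \<xi>) \<cdot> D"
      by (simp add: algebra_simps)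
    also have "B * (\<alpha>' * \<beta>') * k0 * \<xi> - B * (\<alpha>' + \<beta>') * k0 + B * k0 * inverse \<xi>
      = B * ((1 - \<alpha>' * \<xi>) * (1 - \<beta>' * \<xi>)) * (k0 * inverse \<xi>)"
      using \<xi> by (simp add: field_simps)
    finally show ?thesis
      unfolding first second rhs using False ee e'e(1)
      by (simp add: A_def B_def \<alpha>'_def \<beta>'_def pair_coeff_def power_int_minus)
  qed
qed

lemma finite_Lam_Lam:
  assumes "i \<in> {1, 2}" "e \<in> {1, - 1}" "j \<in> {1, 2}" "e' \<in> {1, - 1}"
  shows "finite {t. fps_nth f t \<cdot> Lam q l1 R i e (a + int t) (Lam q l1 R j e' (b - int t) v) \<noteq> 0}"
proof -
  obtain N where N: "\<And>m. m < N \<Longrightarrow> Lam q l1 R j e' m v = 0"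
    using bounded_belowE[OF Lam_bounded_below[OF assms(3,4)], of v] by blast
  have "{t. fps_nth f t \<cdot> Lam q l1 R i e (a + int t) (Lam q l1 R j e' (b - int t) v) \<noteq> 0} \<subseteq> {..nat (b - N)}"
  proof
    fix t assume t: "t \<in> {t. fps_nth f t \<cdot> Lam q l1 R i e (a + int t) (Lam q l1 R j e' (b - int t) v) \<noteq> 0}"
    have "\<not> b - int t < N"
    proof
      assume "b - int t < N"
      from N[OF this] show False using t lin_zero[OF Lam_lin[OF assms(1,2)]] by simp
    qed
    then show "t \<in> {..nat (b - N)}" by auto
  qed
  then show ?thesis by (rule finite_subset) simp
qed

lemma lin_Lam_Lam:
  assumes "i \<in> {1, 2}" "e \<in> {1, - 1}" "j \<in> {1, 2}" "e' \<in> {1, - 1}"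
  shows "lin (\<lambda>v. Sum_any (\<lambda>t. fps_nth f t \<cdot> Lam q l1 R i e (a + int t) (Lam q l1 R j e' (b - int t) v)))"
  by (rule lin_Sum_any_op[OF lin_smult[OF lin_comp[OF Lam_lin Lam_lin]] finite_Lam_Lam]) (rule assms)+

text \<open>
  Both sides are linear in the vector, the left side because only finitely many \<open>t\<close> contribute.
\<close>
lemma pair_identity:
  assumes i: "i \<in> {1, 2}" and j: "j \<in> {1, 2}" and ij: "i \<noteq> j" and e: "e \<in> {1, - 1}" and e': "e' \<in> {1, - 1}"
    and \<xi>: "\<xi> \<noteq> 0"
  shows "\<xi> \<cdot> Sum_any (\<lambda>t. fps_nth (fser q d \<xi>) t \<cdot> Lam q l1 R i e (a + int t) (Lam q l1 R j e' (b - int t) v))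
     + Sum_any (\<lambda>t. fps_nth (fser q d (inverse \<xi>)) t \<cdot> Lam q l1 R j e' (b + int t) (Lam q l1 R i e (a - int t) v))
     = \<xi> powi (- a) \<cdot> pair_coeff \<xi> e e' \<cdot> Lam_pair q l1 R \<xi> i e j e' (a + b + e * e') v"
    (is "?L v = ?R v")
proof -
  define L where "L = (\<lambda>v. ?L v)"
  define R' where "R' = (\<lambda>v. ?R v)"
  have L: "lin L" unfolding L_def
    by (rule lin_plus[OF lin_smult[OF lin_Lam_Lam[OF i e j e']] lin_Lam_Lam[OF j e' i e]])
  have R: "lin R'" unfolding R'_def
    by (rule lin_smult[OF lin_smult[OF Lam_pair_lin[OF i e j e']]])
  have "L v = R' v"
  proof (rule h0_eigen_induct[OF i, of "\<lambda>v. L v = R' v"])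
    show "L (x + y) = R' (x + y)" if "L x = R' x" "L y = R' y" for x y
      using that by (simp only: lin_add[OF L] lin_add[OF R])
    show "L x = R' x" if "hop R i 0 x = of_int \<mu> \<cdot> x" for \<mu> x
      unfolding L_def R'_def by (rule pair_identity_eigenvector[OF i j ij e e' \<xi> that])
  qed
  then show ?thesis by (simp only: L_def R'_def)
qed

text \<open>
  Splitting the sum over \<open>t\<close> is legitimate because each of the four families has finite support.
\<close>
lemma W_product_expand:
  assumes i: "i \<in> {1, 2}" and j: "j \<in> {1, 2}"
  shows "Sum_any (\<lambda>t. fps_nth f t \<cdot> W q l1 R i (a + int t) (W q l1 R j (b - int t) v))
    = Sum_any (\<lambda>t. fps_nth f t \<cdot> Lam q l1 R i 1 (a + int t) (Lam q l1 R j 1 (b - int t) v))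
    + Sum_any (\<lambda>t. fps_nth f t \<cdot> Lam q l1 R i (- 1) (a + int t) (Lam q l1 R j (- 1) (b - int t) v))
    + Sum_any (\<lambda>t. fps_nth f t \<cdot> Lam q l1 R i 1 (a + int t) (Lam q l1 R j (- 1) (b - int t) v))
    + Sum_any (\<lambda>t. fps_nth f t \<cdot> Lam q l1 R i (- 1) (a + int t) (Lam q l1 R j 1 (b - int t) v))"
proof -
  let ?Y = "\<lambda>e e' t. fps_nth f t \<cdot> Lam q l1 R i e (a + int t) (Lam q l1 R j e' (b - int t) v)"
  have fin: "finite {t. ?Y e e' t \<noteq> 0}" if "e \<in> {1, - 1}" "e' \<in> {1, - 1}" for e e'
    by (rule finite_Lam_Lam[OF i that(1) j that(2)])
  have fin2: "finite {t. g t + h t \<noteq> 0}" if "finite {t. g t \<noteq> 0}" "finite {t. h t \<noteq> 0}"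
    for g h :: "nat \<Rightarrow> 'v"
  proof -
    have "{t. g t + h t \<noteq> 0} \<subseteq> {t. g t \<noteq> 0} \<union> {t. h t \<noteq> 0}" by auto
    then show ?thesis by (rule finite_subset) (use that in simp)
  qed
  have l: "lin (Lam q l1 R i 1 m)" "lin (Lam q l1 R i (- 1) m)" for m
    using Lam_lin[OF i] by simp_all
  have "fps_nth f t \<cdot> W q l1 R i (a + int t) (W q l1 R j (b - int t) v)
    = ?Y 1 1 t + ?Y (- 1) (- 1) t + ?Y 1 (- 1) t + ?Y (- 1) 1 t" for t
    by (simp add: W_def lin_add[OF l(1)] lin_add[OF l(2)] scale_right_distrib)
  then have "Sum_any (\<lambda>t. fps_nth f t \<cdot> W q l1 R i (a + int t) (W q l1 R j (b - int t) v))
    = Sum_any (\<lambda>t. ?Y 1 1 t + ?Y (- 1) (- 1) t + ?Y 1 (- 1) t + ?Y (- 1) 1 t)"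
    by (simp only:)
  also have "\<dots> = Sum_any (?Y 1 1) + Sum_any (?Y (- 1) (- 1)) + Sum_any (?Y 1 (- 1)) + Sum_any (?Y (- 1) 1)"
  proof -
    have f: "finite {t. ?Y 1 1 t \<noteq> 0}" "finite {t. ?Y (- 1) (- 1) t \<noteq> 0}"
      "finite {t. ?Y 1 (- 1) t \<noteq> 0}" "finite {t. ?Y (- 1) 1 t \<noteq> 0}"
      by (rule fin; simp)+
    show ?thesis
      unfolding Sum_any.distrib[OF fin2[OF fin2[OF f(1,2)] f(3)] f(4)]
        Sum_any.distrib[OF fin2[OF f(1,2)] f(3)] Sum_any.distrib[OF f(1,2)] ..
  qed
  finally show ?thesis .
qed

text \<open>
  The factor \<open>z\<^sup>2\<close> in the mixed terms of \<open>\<T>\<^sub>i\<^sub>j\<close> shifts the index \<open>a + b + 1\<close> by \<open>2\<close>, so that for all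
  signs \<open>Lam_pair\<close> is taken at \<open>a + b + e e'\<close>, as in \<open>pair_identity\<close>.
\<close>
lemma quadratic_relation:
  assumes i: "i \<in> {1, 2}" and j: "j \<in> {1, 2}" and ij: "i \<noteq> j" and \<xi>: "\<xi> \<noteq> 0"
  shows "\<xi> \<cdot> smult2 scal (at_w_over_z (fser q d \<xi>)) (prod_zw (W q l1 R i) (W q l1 R j)) a b v
         + smult2 scal (at_z_over_w (fser q d (inverse \<xi>))) (prod_wz (W q l1 R j) (W q l1 R i)) a b v
         = smult2 scal (delta_w_over_z \<xi>) (winv_ser (T q d l1 R i j \<xi>)) a b v"
proof -
  note pair = pair_identity[OF i j ij _ _ \<xi>, of _ _ a b v]
  have "\<xi> powi (- a) \<cdot> T q d l1 R i j \<xi> (a + b + 1) v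
    = \<xi> powi (- a) \<cdot> pair_coeff \<xi> 1 1 \<cdot> Lam_pair q l1 R \<xi> i 1 j 1 (a + b + 1 * 1) v
    + \<xi> powi (- a) \<cdot> pair_coeff \<xi> (- 1) (- 1) \<cdot> Lam_pair q l1 R \<xi> i (- 1) j (- 1) (a + b + (- 1) * (- 1)) v
    + \<xi> powi (- a) \<cdot> pair_coeff \<xi> 1 (- 1) \<cdot> Lam_pair q l1 R \<xi> i 1 j (- 1) (a + b + 1 * (- 1)) v
    + \<xi> powi (- a) \<cdot> pair_coeff \<xi> (- 1) 1 \<cdot> Lam_pair q l1 R \<xi> i (- 1) j 1 (a + b + (- 1) * 1) v"
    by (simp add: T_def pair_coeff_def power_int_minus scale_right_distrib mult.assoc)
  then show ?thesis
    unfolding smult2_at_w_over_z[where s = scal, OF scale_zero_left]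
      smult2_at_z_over_w[where s = scal, OF scale_zero_left]
      smult2_delta[where s = scal, OF scale_zero_left scale_zero_right]
      prod_zw_def prod_wz_def W_product_expand[OF i j] W_product_expand[OF j i]
    by (simp only: pair[symmetric] insert_iff simp_thms scale_right_distrib) (simp only: add_ac)
qed

end

theorem theorem5p3:
  fixes q d l1 l3 \<xi> :: complex
    and R :: "('v::ab_group_add) heisenberg_ops"
    and i j :: nat
    and a b :: int
    and v :: 'v
  assumes "generic q d"
    and "heisenberg_module q d l1 l3 R"
    and "\<xi> \<noteq> 0"
    and "i \<in> {1, 2}" and "j \<in> {1, 2}" and "i \<noteq> j"
  shows "smul R \<xi>
           (smult2 (smul R) (at_w_over_z (fser q d \<xi>))
              (prod_zw (W q l1 R i) (W q l1 R j)) a b v)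
         + smult2 (smul R) (at_z_over_w (fser q d (inverse \<xi>)))
              (prod_wz (W q l1 R j) (W q l1 R i)) a b v
         = smult2 (smul R) (delta_w_over_z \<xi>) (winv_ser (T q d l1 R i j \<xi>)) a b v"
proof -
  interpret generic_heisenberg_module q d l1 l3 R
    using assms(1,2) by (simp add: generic_heisenberg_module_def generic_heisenberg_module_axioms_def)
  show ?thesis by (rule quadratic_relation[OF assms(4,5,6,3)])
qed

end
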